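(* Let $A$ be a commutative ring with $2\in A^\times$. If $a,b\in A^\times$, then under the surjective map \[ H_2(\mathrm{E}_2(A),\mathbb{Z})\to I^2(A), \] the homology class of the cycle $\big([D(a)|D(b)]+R_{ab}-R_a-R_b+R_1\big)\otimes 1$ maps to $\langle\!\langle a\rangle\!\rangle\langle\!\langle b\rangle\!\rangle\in I^2(A)$, where for any $z\in A^\times$, \begin{align*} R_z:=\;&[w|g_z^{-1}]-[w|h_z^{-1}]-[h_z^{-1}D(z)^{-1}|wh_z^{-1}]+[h_{z^{-1}}|w^{-1}]-[h_z^{-1}|D(z)^{-1}]+[D(z)h_z|D(z)^{-1}]\\ &-[D(z)h_z|h_z^{-1}]+2[h_z^{-1}|h_z^{-1}]+[h_z^{-2}|h_z^{-2}]+[D(2)h_z^{-1}D(2)^{-1}|D(2)]-[D(2)|h_z^{-1}] \end{align*} with \[ D(z)=\begin{pmatrix}z & 0\\ 0 & z^{-1}\end{pmatrix},\quad w=\begin{pmatrix}0 & 1\\ -1 & 0\end{pmatrix},\quad g_z=\begin{pmatrix}0 & 1\\ -1 & z\end{pmatrix},\quad h_z=\begin{pmatrix}1 & z^{-1}\\ 0 & 1\end{pmatrix}. \]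
   Context: $\mathrm{E}_2(A)$ is the subgroup of $\mathrm{GL}_2(A)$ generated by the elementary matrices $\begin{pmatrix}1 & x\\ 0 & 1\end{pmatrix}$, $\begin{pmatrix}1 & 0\\ x & 1\end{pmatrix}$, $x\in A$; $\mathrm{GE}_2(A)$ is the subgroup generated by these and the invertible diagonal matrices. $B_\bullet(G)\to\mathbb{Z}$ is the bar resolution of a group $G$, written in the usual bar notation $[g_1|\cdots|g_n]$. For a left $G$-module $N$, $H_n(G,N)=H_n(B_\bullet(G)\otimes_G N)$, where a left action is converted when necessary to a right action by $m\cdot g:=g^{-1}m$. The cycle in the claim lives in $B_2(\mathrm{E}_2(A))\otimes_{\mathrm{E}_2(A)}\mathbb{Z}$. The complex $Y_\bullet(A^2)$: a vector $u\in A^2$ is $\mathrm{GE}_2$-unimodular if $(u,v)\in\mathrm{GE}_2(A)$ for some $v\in A^2$; $Y_n(A^2)$ is the free abelian group on tuples of lines $(\langle v_0\rangle,\dots,\langle v_n\rangle)$, $\langle v\rangle=Av$, with every $v_i$ $\mathrm{GE}_2$-unimodular and $(v_i,v_j)\in\mathrm{GL}_2(A)$ for $i\neq j$; $\partial_n$ ($n\ge1$) is the alternating sum of the maps omitting the $i$-th entry; $\varepsilon:Y_0(A^2)\to\mathbb{Z}$ sends every generator to $1$. The group $\mathrm{E}_2(A)$ acts naturally from the left. Put $Z_1^Y(A^2)=\ker\partial_1$, $Z_0^Y(A^2)=\ker\varepsilon$. For every commutative ring the sequence $0\to Z_1^Y(A^2)\to Y_1(A^2)\to Y_0(A^2)\xrightarrow{\varepsilon}\mathbb{Z}\to0$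 is exact. Write $\boldsymbol\infty=\langle e_1\rangle$, $\boldsymbol 0=\langle e_2\rangle$, $\boldsymbol a=\langle e_1+ae_2\rangle$ for $a\in A^\times$, where $e_1,e_2$ is the standard basis of $A^2$. $I(A)$ and $I^2(A)$: let $\mathrm{GW}(A):=H_0(\mathrm{E}_2(A),Z_1^Y(A^2))$, and let $I(A)$ be the kernel of the map $\mathrm{GW}(A)\to H_0(\mathrm{E}_2(A),Y_1(A^2))\simeq\mathbb{Z}$ induced by inclusion. Let $C_\bullet$ be the complex $C_0=Y_0(A^2)$, $C_1=Y_1(A^2)$, $C_2=Z_1^Y(A^2)$, $C_p=0$ otherwise, with spectral sequence $E^1_{p,q}=H_q(\mathrm{E}_2(A),C_p)\Rightarrow H_{p+q}(\mathrm{E}_2(A),\mathbb{Z})$ of the double complex $B_\bullet(\mathrm{E}_2(A))\otimes_{\mathrm{E}_2(A)}C_\bullet$. Then $E^2_{2,0}=I(A)$ and $I^2(A):=\ker\big(d^2_{2,0}:I(A)\to E^2_{0,1}\big)$. The surjective map $H_2(\mathrm{E}_2(A),\mathbb{Z})\to I^2(A)\subseteq\mathrm{GW}(A)$ is the one arising from this spectral sequence; it is $\delta_2\circ\delta_1$, where $\delta_1:H_2(\mathrm{E}_2(A),\mathbb{Z})\to H_1(\mathrm{E}_2(A),Z_0^Y(A^2))$ and $\delta_2:H_1(\mathrm{E}_2(A),Z_0^Y(A^2))\to H_0(\mathrm{E}_2(A),Z_1^Y(A^2))$ are the connecting homomorphisms of $0\to Z_0^Y(A^2)\to Y_0(A^2)\to\mathbb{Z}\to0$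 and $0\to Z_1^Y(A^2)\to Y_1(A^2)\to Z_0^Y(A^2)\to0$. The element $\langle\!\langle a\rangle\!\rangle\langle\!\langle b\rangle\!\rangle$: let $\mathcal{G}_A=A^\times/(A^\times)^2$, let $\langle a\rangle\in\mathcal{G}_A$ be the class of $a\in A^\times$, and $\langle\!\langle a\rangle\!\rangle=\langle a\rangle-1\in\mathbb{Z}[\mathcal{G}_A]$. There is an isomorphism $\mathbb{Z}[\mathcal{G}_A]\simeq Y_2(A^2)_{\mathrm{E}_2(A)}$ sending $\langle a\rangle$ to the class of $(\boldsymbol\infty,\boldsymbol0,\boldsymbol a)$; composing with the map induced by $\partial_2:Y_2(A^2)\to Z_1^Y(A^2)$ gives a map $\mathbb{Z}[\mathcal{G}_A]\to\mathrm{GW}(A)$. The image of $\langle\!\langle a\rangle\!\rangle\langle\!\langle b\rangle\!\rangle=\langle ab\rangle-\langle a\rangle-\langle b\rangle+1$ under this map lies in $I^2(A)$ (as $2\in A^\times$) and is again denoted $\langle\!\langle a\rangle\!\rangle\langle\!\langle b\rangle\!\rangle$. *)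

theory Defs
  imports "HOL-Analysis.Analysis" "HOL-Algebra.Free_Abelian_Groups"
begin

section \<open>Modules over a group, tensor products\<close>

text \<open>
  A left \<open>G\<close>-module: an abelian group (written with the monoid operations of HOL-Algebra) with an
  action. The record carries no axioms; all instances below are concrete.
\<close>

record ('m, 'g) gmodule = "'m monoid" +
  act :: "'g \<Rightarrow> 'm \<Rightarrow> 'm"

definition trivial_int :: "(int, 'g) gmodule" where
  "trivial_int = \<lparr>carrier = UNIV, monoid.mult = (+), one = 0, act = (\<lambda>g k. k)\<rparr>"

definition tensor_free :: "('m, 'g) gmodule \<Rightarrow> ('n, 'g) gmodule \<Rightarrow> ('m \<times> 'n \<Rightarrow>\<^sub>0 int) monoid" where
  "tensor_free M N = free_Abelian_group (carrier M \<times> carrier N)"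

text \<open>
  The left module \<open>M\<close> is made into a right module by \<open>m \<cdot> g = g\<inverse> m\<close>, so that the third family of
  relations says \<open>m \<cdot> g \<otimes> n = m \<otimes> g n\<close>.
\<close>

definition tensor_rel ::
  "('g, 'b) monoid_scheme \<Rightarrow> ('m, 'g) gmodule \<Rightarrow> ('n, 'g) gmodule \<Rightarrow> ('m \<times> 'n \<Rightarrow>\<^sub>0 int) set" where
  "tensor_rel G M N = generate (tensor_free M N)
     ({frag_of (m \<otimes>\<^bsub>M\<^esub> m', n) - frag_of (m, n) - frag_of (m', n) | m m' n.
          m \<in> carrier M \<and> m' \<in> carrier M \<and> n \<in> carrier N}
    \<union> {frag_of (m, n \<otimes>\<^bsub>N\<^esub> n') - frag_of (m, n) - frag_of (m, n') | m n n'.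
          m \<in> carrier M \<and> n \<in> carrier N \<and> n' \<in> carrier N}
    \<union> {frag_of (act M (inv\<^bsub>G\<^esub> g) m, n) - frag_of (m, act N g n) | g m n.
          g \<in> carrier G \<and> m \<in> carrier M \<and> n \<in> carrier N})"

definition tensor ::
  "('g, 'b) monoid_scheme \<Rightarrow> ('m, 'g) gmodule \<Rightarrow> ('n, 'g) gmodule \<Rightarrow> ('m \<times> 'n \<Rightarrow>\<^sub>0 int) set monoid" where
  "tensor G M N = tensor_free M N Mod tensor_rel G M N"

definition tensor_elt ::
  "('g, 'b) monoid_scheme \<Rightarrow> ('m, 'g) gmodule \<Rightarrow> ('n, 'g) gmodule \<Rightarrow> 'm \<Rightarrow> 'n
    \<Rightarrow> ('m \<times> 'n \<Rightarrow>\<^sub>0 int) set" where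
  "tensor_elt G M N m n = tensor_rel G M N #>\<^bsub>tensor_free M N\<^esub> frag_of (m, n)"

text \<open>
  The homomorphism \<open>f \<otimes> h\<close> with target \<open>M' \<otimes> N'\<close>, for \<open>G\<close>-homomorphisms \<open>f\<close> and \<open>h\<close>: the image of a
  coset of relations is saturated to a coset of relations of the target.
\<close>

definition tensor_map ::
  "('g, 'b) monoid_scheme \<Rightarrow> ('m2, 'g) gmodule \<Rightarrow> ('n2, 'g) gmodule \<Rightarrow> ('m \<Rightarrow> 'm2) \<Rightarrow> ('n \<Rightarrow> 'n2)
    \<Rightarrow> ('m \<times> 'n \<Rightarrow>\<^sub>0 int) set \<Rightarrow> ('m2 \<times> 'n2 \<Rightarrow>\<^sub>0 int) set" where
  "tensor_map G M' N' f h X =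
     tensor_rel G M' N' <#>\<^bsub>tensor_free M' N'\<^esub>
       (frag_extend (\<lambda>(m, n). frag_of (f m, h n)) ` X)"


section \<open>The bar resolution and group homology\<close>

text \<open>
  The bar resolution is taken normalized: \<open>B\<^sub>n\<close> is the free \<open>\<int>[G]\<close>-module on the symbols
  \<open>[g\<^sub>1|\<dots>|g\<^sub>n]\<close> with all \<open>g\<^sub>i \<noteq> 1\<close>, and a symbol with an entry \<open>1\<close> denotes \<open>0\<close>. (In the unnormalized
  complex the chain of the theorem has boundary \<open>[1] \<otimes> 1 \<noteq> 0\<close>.) The \<open>\<int>\<close>-basis element
  \<open>(x, [g\<^sub>1, \<dots>, g\<^sub>n])\<close> stands for \<open>x [g\<^sub>1|\<dots>|g\<^sub>n]\<close>.
\<close>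

type_synonym 'g bar = "'g \<times> 'g list \<Rightarrow>\<^sub>0 int"

definition bar_act :: "('g, 'b) monoid_scheme \<Rightarrow> 'g \<Rightarrow> 'g bar \<Rightarrow> 'g bar" where
  "bar_act G x = frag_extend (\<lambda>(y, gs). frag_of (x \<otimes>\<^bsub>G\<^esub> y, gs))"

definition bar_res :: "('g, 'b) monoid_scheme \<Rightarrow> nat \<Rightarrow> ('g bar, 'g) gmodule" where
  "bar_res G n =
     \<lparr>carrier = {c. Poly_Mapping.keys c \<subseteq>
        carrier G \<times> {gs. length gs = n \<and> set gs \<subseteq> carrier G - {\<one>\<^bsub>G\<^esub>}}},
      monoid.mult = (+), one = 0, act = bar_act G\<rparr>"

definition bar_symbol :: "('g, 'b) monoid_scheme \<Rightarrow> 'g list \<Rightarrow> 'g bar" where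
  "bar_symbol G gs = (if \<one>\<^bsub>G\<^esub> \<in> set gs then 0 else frag_of (\<one>\<^bsub>G\<^esub>, gs))"

text \<open>
  \<open>d [g\<^sub>1|\<dots>|g\<^sub>n] = g\<^sub>1 [g\<^sub>2|\<dots>|g\<^sub>n] + (\<Sum>0<i<n. (-1)\<^sup>i [g\<^sub>1|\<dots>|g\<^sub>i g\<^sub>i\<^sub>+\<^sub>1|\<dots>|g\<^sub>n]) + (-1)\<^sup>n [g\<^sub>1|\<dots>|g\<^sub>n\<^sub>-\<^sub>1]\<close>;
  list positions are counted from \<open>0\<close>.
\<close>

definition bar_bd_symbol :: "('g, 'b) monoid_scheme \<Rightarrow> 'g list \<Rightarrow> 'g bar" where
  "bar_bd_symbol G gs =
     (if gs = [] then 0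
      else bar_act G (hd gs) (bar_symbol G (tl gs))
         + (\<Sum>i = 1..<length gs. frag_cmul ((-1) ^ i)
              (bar_symbol G (take (i - 1) gs @ [gs ! (i - 1) \<otimes>\<^bsub>G\<^esub> gs ! i] @ drop (i + 1) gs)))
         + frag_cmul ((-1) ^ length gs) (bar_symbol G (butlast gs)))"

definition bar_bd :: "('g, 'b) monoid_scheme \<Rightarrow> 'g bar \<Rightarrow> 'g bar" where
  "bar_bd G = frag_extend (\<lambda>(x, gs). bar_act G x (bar_bd_symbol G gs))"

type_synonym ('g, 'n) hchain = "('g bar \<times> 'n \<Rightarrow>\<^sub>0 int) set"

definition chains :: "('g, 'b) monoid_scheme \<Rightarrow> ('n, 'g) gmodule \<Rightarrow> nat \<Rightarrow> ('g, 'n) hchain monoid" where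
  "chains G N n = tensor G (bar_res G n) N"

text \<open>\<open>chain_bd G N n\<close> goes from degree \<open>n + 1\<close> to degree \<open>n\<close>.\<close>

definition chain_bd ::
  "('g, 'b) monoid_scheme \<Rightarrow> ('n, 'g) gmodule \<Rightarrow> nat \<Rightarrow> ('g, 'n) hchain \<Rightarrow> ('g, 'n) hchain" where
  "chain_bd G N n = tensor_map G (bar_res G n) N (bar_bd G) (\<lambda>x. x)"

definition coeff_map ::
  "('g, 'b) monoid_scheme \<Rightarrow> ('n2, 'g) gmodule \<Rightarrow> nat \<Rightarrow> ('n \<Rightarrow> 'n2) \<Rightarrow> ('g, 'n) hchain \<Rightarrow> ('g, 'n2) hchain" where
  "coeff_map G N' n f = tensor_map G (bar_res G n) N' (\<lambda>x. x) f"

definition cycles :: "('g, 'b) monoid_scheme \<Rightarrow> ('n, 'g) gmodule \<Rightarrow> nat \<Rightarrow> ('g, 'n) hchain set" where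
  "cycles G N n =
     (case n of 0 \<Rightarrow> carrier (chains G N 0)
      | Suc k \<Rightarrow> kernel (chains G N (Suc k)) (chains G N k) (chain_bd G N k))"

definition boundaries :: "('g, 'b) monoid_scheme \<Rightarrow> ('n, 'g) gmodule \<Rightarrow> nat \<Rightarrow> ('g, 'n) hchain set" where
  "boundaries G N n = chain_bd G N n ` carrier (chains G N (Suc n))"

definition homology ::
  "('g, 'b) monoid_scheme \<Rightarrow> ('n, 'g) gmodule \<Rightarrow> nat \<Rightarrow> ('g, 'n) hchain set monoid" where
  "homology G N n = (chains G N n)\<lparr>carrier := cycles G N n\<rparr> Mod boundaries G N n"

definition hclass ::
  "('g, 'b) monoid_scheme \<Rightarrow> ('n, 'g) gmodule \<Rightarrow> nat \<Rightarrow> ('g, 'n) hchain \<Rightarrow> ('g, 'n) hchain set" where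
  "hclass G N n c = boundaries G N n #>\<^bsub>chains G N n\<^esub> c"

text \<open>\<open>H\<^sub>n(G, N) \<rightarrow> H\<^sub>n(G, N')\<close> induced by \<open>f : N \<rightarrow> N'\<close>.\<close>

definition homology_map ::
  "('g, 'b) monoid_scheme \<Rightarrow> ('n2, 'g) gmodule \<Rightarrow> nat \<Rightarrow> ('n \<Rightarrow> 'n2)
    \<Rightarrow> ('g, 'n) hchain set \<Rightarrow> ('g, 'n2) hchain set" where
  "homology_map G N' n f X = boundaries G N' n <#>\<^bsub>chains G N' n\<^esub> (coeff_map G N' n f ` X)"

text \<open>
  The connecting homomorphism \<open>H\<^sub>n\<^sub>+\<^sub>1(G, N'') \<rightarrow> H\<^sub>n(G, N')\<close> of a short exact sequence
  \<open>0 \<rightarrow> N' \<rightarrow> N \<rightarrow> N'' \<rightarrow> 0\<close>, where \<open>N'\<close> is a submodule of \<open>N\<close> and \<open>p : N \<rightarrow> N''\<close>. The value at the class \<open>X\<close>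
  is the set of all cycles \<open>z\<close> whose image in the chains of \<open>N\<close> is the boundary of a lift of some
  representative of \<open>X\<close>. By exactness these \<open>z\<close> form one homology class.
\<close>

definition connecting ::
  "('g, 'b) monoid_scheme \<Rightarrow> ('n, 'g) gmodule \<Rightarrow> ('n, 'g) gmodule \<Rightarrow> ('n2, 'g) gmodule \<Rightarrow> ('n \<Rightarrow> 'n2)
    \<Rightarrow> nat \<Rightarrow> ('g, 'n2) hchain set \<Rightarrow> ('g, 'n) hchain set" where
  "connecting G N' N N'' p n X =
     {z \<in> cycles G N' n. \<exists>c \<in> carrier (chains G N (Suc n)).
        coeff_map G N'' (Suc n) p c \<in> X \<and>
        chain_bd G N n c = coeff_map G N n (\<lambda>x. x) z}"


section \<open>The groups of matrices\<close>

definition mat2 :: "'a::comm_ring_1 \<Rightarrow> 'a \<Rightarrow> 'a \<Rightarrow> 'a \<Rightarrow> 'a^2^2" where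
  "mat2 p q r s = vector [vector [p, q], vector [r, s]]"

definition GL2 :: "('a::comm_ring_1^2^2) monoid" where
  "GL2 = \<lparr>carrier = {M. invertible M}, monoid.mult = (**), one = mat 1\<rparr>"

definition elementary2 :: "('a::comm_ring_1^2^2) set" where
  "elementary2 = range (\<lambda>x. mat2 1 x 0 1) \<union> range (\<lambda>x. mat2 1 0 x 1)"

definition E2 :: "('a::comm_ring_1^2^2) monoid" where
  "E2 = subgroup_generated GL2 elementary2"

definition GE2 :: "('a::comm_ring_1^2^2) monoid" where
  "GE2 = subgroup_generated GL2
     (elementary2 \<union> {mat2 x 0 0 y | x y. x dvd 1 \<and> y dvd 1})"

text \<open>Only meaningful for units.\<close>

definition uinv :: "'a::comm_ring_1 \<Rightarrow> 'a" where
  "uinv x = (THE y. x * y = 1)"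


section \<open>The complex of lines\<close>

type_synonym 'a line = "('a^2) set"

definition line :: "'a::comm_ring_1^2 \<Rightarrow> 'a line" where
  "line v = range (\<lambda>c. c *s v)"

text \<open>The matrix with columns \<open>u\<close>, \<open>v\<close>.\<close>

definition cols2 :: "'a::comm_ring_1^2 \<Rightarrow> 'a^2 \<Rightarrow> 'a^2^2" where
  "cols2 u v = mat2 (u $ 1) (v $ 1) (u $ 2) (v $ 2)"

definition GE2_unimodular :: "'a::comm_ring_1^2 \<Rightarrow> bool" where
  "GE2_unimodular u \<longleftrightarrow> (\<exists>v. cols2 u v \<in> carrier GE2)"

definition Y_tuples :: "nat \<Rightarrow> 'a::comm_ring_1 line list set" where
  "Y_tuples n = {map line vs | vs. length vs = n + 1 \<and> (\<forall>v \<in> set vs. GE2_unimodular v) \<and>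
     (\<forall>i < length vs. \<forall>j < length vs. i \<noteq> j \<longrightarrow> cols2 (vs ! i) (vs ! j) \<in> carrier GL2)}"

type_synonym 'a ychain = "'a line list \<Rightarrow>\<^sub>0 int"

definition Y_act :: "'a::comm_ring_1^2^2 \<Rightarrow> 'a ychain \<Rightarrow> 'a ychain" where
  "Y_act M = frag_extend (\<lambda>ls. frag_of (map (\<lambda>l. (\<lambda>v. M *v v) ` l) ls))"

definition Y :: "nat \<Rightarrow> ('a::comm_ring_1 ychain, 'a^2^2) gmodule" where
  "Y n = \<lparr>carrier = {c. Poly_Mapping.keys c \<subseteq> Y_tuples n}, monoid.mult = (+), one = 0, act = Y_act\<rparr>"

text \<open>Used on \<open>Y n\<close> with \<open>n \<ge> 1\<close>.\<close>

definition Y_bd :: "'a::comm_ring_1 ychain \<Rightarrow> 'a ychain" where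
  "Y_bd = frag_extend (\<lambda>ls. \<Sum>i < length ls. frag_cmul ((-1) ^ i) (frag_of (take i ls @ drop (i + 1) ls)))"

definition Y_aug :: "'a::comm_ring_1 ychain \<Rightarrow> int" where
  "Y_aug c = (\<Sum>ls \<in> Poly_Mapping.keys c. Poly_Mapping.lookup c ls)"

definition Z1Y :: "('a::comm_ring_1 ychain, 'a^2^2) gmodule" where
  "Z1Y = (Y 1)\<lparr>carrier := kernel (Y 1) (Y 0) Y_bd\<rparr>"

definition Z0Y :: "('a::comm_ring_1 ychain, 'a^2^2) gmodule" where
  "Z0Y = (Y 0)\<lparr>carrier := kernel (Y 0) integer_group Y_aug\<rparr>"

definition line_infty :: "'a::comm_ring_1 line" where
  "line_infty = line (vector [1, 0])"

definition line_zero :: "'a::comm_ring_1 line" where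
  "line_zero = line (vector [0, 1])"

definition line_unit :: "'a::comm_ring_1 \<Rightarrow> 'a line" where
  "line_unit a = line (vector [1, a])"


section \<open>\<open>GW(A)\<close>, \<open>I(A)\<close>, \<open>I\<^sup>2(A)\<close> and the map from \<open>H\<^sub>2\<close>\<close>

definition GW :: "('a::comm_ring_1^2^2, 'a ychain) hchain set monoid" where
  "GW = homology E2 Z1Y 0"

definition I1 :: "('a::comm_ring_1^2^2, 'a ychain) hchain set set" where
  "I1 = kernel GW (homology E2 (Y 1) 0) (homology_map E2 (Y 1) 0 (\<lambda>x. x))"

text \<open>\<open>E\<^sup>2\<^sub>0\<^sub>,\<^sub>1\<close> is the cokernel of \<open>d\<^sup>1 : H\<^sub>1(E\<^sub>2(A), Y\<^sub>1) \<rightarrow> H\<^sub>1(E\<^sub>2(A), Y\<^sub>0)\<close>.\<close>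

definition Esecond_01 :: "('a::comm_ring_1^2^2, 'a ychain) hchain set set monoid" where
  "Esecond_01 = homology E2 (Y 0) 1 Mod
     (homology_map E2 (Y 0) 1 Y_bd ` carrier (homology E2 (Y 1) 1))"

text \<open>
  The differential \<open>d\<^sup>2\<^sub>2\<^sub>,\<^sub>0\<close> by the usual zig-zag: for a representative \<open>z\<close>, its image in \<open>B\<^sub>0 \<otimes> Y\<^sub>1\<close> is
  the boundary of some \<open>c\<close> in \<open>B\<^sub>1 \<otimes> Y\<^sub>1\<close>, and the value is represented by the image of \<open>c\<close> in
  \<open>B\<^sub>1 \<otimes> Y\<^sub>0\<close>. The set of all classes obtained in this way is one coset, i.e. one element of
  \<open>E\<^sup>2\<^sub>0\<^sub>,\<^sub>1\<close>. A sign depending on conventions for double complexes is immaterial for the kernel.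
\<close>

definition dsecond_20 ::
  "('a::comm_ring_1^2^2, 'a ychain) hchain set \<Rightarrow> ('a^2^2, 'a ychain) hchain set set" where
  "dsecond_20 X = {W \<in> carrier (homology E2 (Y 0) 1).
     \<exists>z \<in> X. \<exists>c \<in> carrier (chains E2 (Y 1) 1).
       chain_bd E2 (Y 1) 0 c = coeff_map E2 (Y 1) 0 (\<lambda>x. x) z \<and>
       coeff_map E2 (Y 0) 1 Y_bd c \<in> W}"

definition I2 :: "('a::comm_ring_1^2^2, 'a ychain) hchain set set" where
  "I2 = kernel (GW\<lparr>carrier := I1\<rparr>) Esecond_01 dsecond_20"

definition delta1 ::
  "('a::comm_ring_1^2^2, int) hchain set \<Rightarrow> ('a^2^2, 'a ychain) hchain set" where
  "delta1 = connecting E2 Z0Y (Y 0) trivial_int Y_aug 1"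

definition delta2 ::
  "('a::comm_ring_1^2^2, 'a ychain) hchain set \<Rightarrow> ('a^2^2, 'a ychain) hchain set" where
  "delta2 = connecting E2 Z1Y (Y 1) Z0Y Y_bd 0"

definition H2_to_I2 ::
  "('a::comm_ring_1^2^2, int) hchain set \<Rightarrow> ('a^2^2, 'a ychain) hchain set" where
  "H2_to_I2 X = delta2 (delta1 X)"


section \<open>Square classes and the elements \<open>\<langle>\<langle>a\<rangle>\<rangle>\<langle>\<langle>b\<rangle>\<rangle>\<close>\<close>

definition unit_group :: "'a::comm_ring_1 monoid" where
  "unit_group = \<lparr>carrier = {x. x dvd 1}, monoid.mult = (*), one = 1\<rparr>"

definition unit_squares :: "'a::comm_ring_1 set" where
  "unit_squares = {x ^ 2 | x. x dvd 1}"

definition sq_classes :: "'a::comm_ring_1 set monoid" where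
  "sq_classes = unit_group Mod unit_squares"

definition sq_class :: "'a::comm_ring_1 \<Rightarrow> 'a set" where
  "sq_class a = unit_squares #>\<^bsub>unit_group\<^esub> a"

text \<open>Multiplication in the group ring \<open>\<int>[G]\<close>.\<close>

definition group_ring_mult ::
  "('g, 'b) monoid_scheme \<Rightarrow> ('g \<Rightarrow>\<^sub>0 int) \<Rightarrow> ('g \<Rightarrow>\<^sub>0 int) \<Rightarrow> ('g \<Rightarrow>\<^sub>0 int)" where
  "group_ring_mult G x y = frag_extend (\<lambda>g. frag_extend (\<lambda>h. frag_of (g \<otimes>\<^bsub>G\<^esub> h)) y) x"

definition pf :: "'a::comm_ring_1 \<Rightarrow> ('a set \<Rightarrow>\<^sub>0 int)" where
  "pf a = frag_of (sq_class a) - frag_of \<one>\<^bsub>sq_classes\<^esub>"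

text \<open>
  The coinvariants of a module \<open>N\<close> are \<open>H\<^sub>0(G, N)\<close>; the class of \<open>m\<close> is the class of \<open>[] \<otimes> m\<close>.
\<close>

definition coinv_class ::
  "('g, 'b) monoid_scheme \<Rightarrow> ('n, 'g) gmodule \<Rightarrow> 'n \<Rightarrow> ('g, 'n) hchain set" where
  "coinv_class G N m = hclass G N 0 (tensor_elt G (bar_res G 0) N (bar_symbol G []) m)"

text \<open>
  The additive map \<open>\<int>[A\<^sup>\<times>/(A\<^sup>\<times>)\<^sup>2] \<rightarrow> H\<^sub>0(E\<^sub>2(A), Y\<^sub>2)\<close> sending \<open>\<langle>a\<rangle>\<close> to the class of \<open>(\<infinity>, 0, a)\<close>, which does
  not depend on the representative \<open>a\<close> chosen in the square class. The target is written
  multiplicatively.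
\<close>

definition sq_to_Y2 :: "('a::comm_ring_1 set \<Rightarrow>\<^sub>0 int) \<Rightarrow> ('a^2^2, 'a ychain) hchain set" where
  "sq_to_Y2 x = finprod (homology E2 (Y 2) 0)
     (\<lambda>q. coinv_class E2 (Y 2) (frag_of [line_infty, line_zero, line_unit (SOME a. a \<in> q)])
            [^]\<^bsub>homology E2 (Y 2) 0\<^esub> Poly_Mapping.lookup x q)
     (Poly_Mapping.keys x)"

definition sq_to_GW :: "('a::comm_ring_1 set \<Rightarrow>\<^sub>0 int) \<Rightarrow> ('a^2^2, 'a ychain) hchain set" where
  "sq_to_GW x = homology_map E2 Z1Y 0 Y_bd (sq_to_Y2 x)"


section \<open>The cycle\<close>

definition mD :: "'a::comm_ring_1 \<Rightarrow> 'a^2^2" where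
  "mD z = mat2 z 0 0 (uinv z)"

definition mw :: "'a::comm_ring_1^2^2" where
  "mw = mat2 0 1 (-1) 0"

definition mg :: "'a::comm_ring_1 \<Rightarrow> 'a^2^2" where
  "mg z = mat2 0 1 (-1) z"

definition mh :: "'a::comm_ring_1 \<Rightarrow> 'a^2^2" where
  "mh z = mat2 1 (uinv z) 0 1"

abbreviation bar2 :: "'a::comm_ring_1^2^2 \<Rightarrow> 'a^2^2 \<Rightarrow> ('a^2^2) bar" where
  "bar2 x y \<equiv> bar_symbol E2 [x, y]"

definition mR :: "'a::comm_ring_1 \<Rightarrow> ('a^2^2) bar" where
  "mR z =
     bar2 mw (inv\<^bsub>E2\<^esub> (mg z))
   - bar2 mw (inv\<^bsub>E2\<^esub> (mh z))
   - bar2 (inv\<^bsub>E2\<^esub> (mh z) ** inv\<^bsub>E2\<^esub> (mD z)) (mw ** inv\<^bsub>E2\<^esub> (mh z))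
   + bar2 (mh (uinv z)) (inv\<^bsub>E2\<^esub> mw)
   - bar2 (inv\<^bsub>E2\<^esub> (mh z)) (inv\<^bsub>E2\<^esub> (mD z))
   + bar2 (mD z ** mh z) (inv\<^bsub>E2\<^esub> (mD z))
   - bar2 (mD z ** mh z) (inv\<^bsub>E2\<^esub> (mh z))
   + frag_cmul 2 (bar2 (inv\<^bsub>E2\<^esub> (mh z)) (inv\<^bsub>E2\<^esub> (mh z)))
   + bar2 (mh z [^]\<^bsub>E2\<^esub> (-2::int)) (mh z [^]\<^bsub>E2\<^esub> (-2::int))
   + bar2 (mD 2 ** inv\<^bsub>E2\<^esub> (mh z) ** inv\<^bsub>E2\<^esub> (mD 2)) (mD 2)
   - bar2 (mD 2) (inv\<^bsub>E2\<^esub> (mh z))"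

end

theory Submission
  imports Defs
begin

text \<open>
  The bar resolution is free, so a chain with coefficients in \<open>N\<close> is a finitely supported function from
  symbols \<open>[g\<^sub>1|\<dots>|g\<^sub>n]\<close> to \<open>N\<close>, and the connecting homomorphisms can be evaluated on coordinates.
  Modulo terms that cancel in \<open>z = ab, a, b, 1\<close>, the boundary of \<open>R\<^sub>z \<otimes> m\<close> is
  \<open>[D(z)] \<otimes> m + ([g\<^sub>z\<inverse>] - [h\<^sub>z\<inverse>]) \<otimes> (w\<inverse> m - m)\<close> whenever all upper triangular matrices fix \<open>m\<close>.
  For \<open>m = 1\<close> in \<open>\<int>\<close> this shows that the chain is a cycle. For \<open>m = \<infinity>\<close> in \<open>Y\<^sub>0\<close> we have
  \<open>w\<inverse> m - m = \<partial>(\<infinity>, 0)\<close>, and the boundary of \<open>([g\<^sub>z\<inverse>] - [h\<^sub>z\<inverse>]) \<otimes> (\<infinity>, 0)\<close> is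
  \<open>g\<^sub>z(\<infinity>, 0) - h\<^sub>z(\<infinity>, 0) = (0, z) - (\<infinity>, z) = \<partial>(\<infinity>, 0, z) - (\<infinity>, 0)\<close>, where the last term cancels
  in the alternating sum. Since \<open>\<delta>\<^sub>1\<close> and \<open>\<delta>\<^sub>2\<close> are sets of cycles, their value is a full coset only by
  exactness of \<open>Y\<^sub>1 \<rightarrow> Y\<^sub>0 \<rightarrow> \<int> \<rightarrow> 0\<close>, that is, because the graph of lines is connected.
\<close>

section \<open>Additive maps out of finitely supported functions\<close>

text \<open>The lift of the cycle to \<open>Y 0\<close> keeps the bar symbols and replaces the
  coefficient 1 by \<infinity>. This works because \<open>w\<close> is the only first entry of a
  symbol that is not upper triangular: all other first entries fix \<infinity>, so the boundary
  differs from the one with trivial coefficients only in the two symbols of each R_z that start with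
  \<open>w\<close>. The signs of \<open>ab\<close>, \<open>a\<close>, \<open>b\<close>,
  \<open>1\<close> form a cross effect: it removes what does not depend on \<open>z\<close>, and
  what R_z leaves of [D(z)] cancels against the boundary of [D(a)|D(b)].

  The obstacle is formal. A tensor is a coset, a homology class is a coset of such cosets, and a
  connecting homomorphism returns a set of them, so every claim is an equality of sets of sets.
  Coordinates remove both layers: a tensor becomes one function, and equality of classes becomes an
  equation \<open>f = g + coord_bd G N t\<close>.

  Membership in \<open>I2\<close> comes from the same two chains that evaluate the connecting
  homomorphisms: the chain over \<open>Y 1\<close> witnesses the zig-zag for the second
  differential, and its image over \<open>Y 0\<close> is the boundary of the lift of the
  cycle.\<close>

definition zscale :: "int \<Rightarrow> 'a::ab_group_add \<Rightarrow> 'a" where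
  "zscale k x = (\<Sum>i<nat k. x) - (\<Sum>i<nat (- k). x)"

lemma sum_const_add: "(\<Sum>i<m + n. x) = (\<Sum>i<m. x) + (\<Sum>i<n::nat. x::'a::ab_group_add)"
  by (induction n) (simp_all add: add_ac)

text \<open>Any difference of naturals may represent \<open>k\<close>, so additivity in
  \<open>k\<close> needs no case distinction on signs.\<close>

lemma zscale_diff_int: "zscale (int m - int n) x = (\<Sum>i<m. x) - (\<Sum>i<n. x)"
proof (cases "m \<le> n")
  case True
  then obtain d where d: "n = m + d" using le_Suc_ex by blast
  show ?thesis unfolding zscale_def d sum_const_add by simp
next
  case False
  then obtain d where d: "m = n + d" using le_Suc_ex nle_le by blast
  show ?thesis unfolding zscale_def d sum_const_add by simp
qed

lemma zscale_0_left [simp]: "zscale 0 x = 0"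
  by (simp add: zscale_def)

lemma zscale_1 [simp]: "zscale 1 x = x"
  by (simp add: zscale_def)

lemma zscale_0_right [simp]: "zscale k 0 = 0"
  by (simp add: zscale_def)

lemma zscale_add_left: "zscale (k + l) x = zscale k x + zscale l x"
proof -
  obtain m n m' n' where "k = int m - int n" "l = int m' - int n'"
    by (metis int_diff_cases)
  then have *: "k = int m - int n" "l = int m' - int n'" "k + l = int (m + m') - int (n + n')"
    by auto
  show ?thesis
    unfolding *(3) unfolding *(1,2) zscale_diff_int sum_const_add by simp
qed

lemma zscale_add_right: "zscale k (x + y) = zscale k x + zscale k y"
  by (simp add: zscale_def sum.distrib)

lemma zscale_closed:
  assumes "0 \<in> S" "\<And>x y. x \<in> S \<Longrightarrow> y \<in> S \<Longrightarrow> x - y \<in> S" "x \<in> S"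
  shows "zscale k x \<in> S"
proof -
  have add: "u + v \<in> S" if "u \<in> S" "v \<in> S" for u v
    using assms(2)[OF that(1) assms(2)[OF assms(1) that(2)]] by simp
  have "(\<Sum>i<n. x) \<in> S" for n :: nat
    by (induction n) (use assms add in auto)
  then show ?thesis unfolding zscale_def using assms by blast
qed

text \<open>\<open>\<phi> k\<close> receives the whole coefficient, so one construction serves
  integer coefficients (\<open>fext\<close>, \<open>Y_aug\<close>) and coefficients in a module
  (\<open>coord_bd\<close>, \<open>coord_map\<close>).\<close>

definition psum :: "('k \<Rightarrow> 'a::zero \<Rightarrow> 'b::comm_monoid_add) \<Rightarrow> ('k \<Rightarrow>\<^sub>0 'a) \<Rightarrow> 'b" where
  "psum \<phi> f = (\<Sum>k\<in>Poly_Mapping.keys f. \<phi> k (Poly_Mapping.lookup f k))"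

lemma psum_superset:
  assumes "finite S" "Poly_Mapping.keys f \<subseteq> S" "\<And>k. \<phi> k 0 = 0"
  shows "psum \<phi> f = (\<Sum>k\<in>S. \<phi> k (Poly_Mapping.lookup f k))"
  unfolding psum_def using assms
  by (intro sum.mono_neutral_left) (auto simp: in_keys_iff)

lemma psum_0 [simp]: "psum \<phi> 0 = 0"
  by (simp add: psum_def)

lemma psum_single: "\<phi> k 0 = 0 \<Longrightarrow> psum \<phi> (Poly_Mapping.single k a) = \<phi> k a"
  by (cases "a = 0") (simp_all add: psum_def)

lemma additive_psum:
  fixes \<phi> :: "'k \<Rightarrow> 'a::ab_group_add \<Rightarrow> 'b::ab_group_add"
  assumes "\<And>k. Modules.additive (\<phi> k)"
  shows "Modules.additive (psum \<phi>)"
proof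
  fix f g :: "'k \<Rightarrow>\<^sub>0 'a"
  let ?S = "Poly_Mapping.keys f \<union> Poly_Mapping.keys g"
  have z: "\<phi> k 0 = 0" for k using Modules.additive.zero[OF assms] .
  have "psum \<phi> (f + g) = (\<Sum>k\<in>?S. \<phi> k (Poly_Mapping.lookup (f + g) k))"
    by (intro psum_superset z) (auto dest: subsetD[OF keys_add])
  also have "\<dots> = psum \<phi> f + psum \<phi> g"
    by (simp add: psum_superset[of ?S f] psum_superset[of ?S g] z lookup_add Modules.additive.add[OF assms]
        sum.distrib)
  finally show "psum \<phi> (f + g) = psum \<phi> f + psum \<phi> g" .
qed

lemma psum_single_self: "psum Poly_Mapping.single f = (f :: 'k \<Rightarrow>\<^sub>0 'a::ab_group_add)"
proof (rule poly_mapping_eqI)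
  fix k
  show "Poly_Mapping.lookup (psum Poly_Mapping.single f) k = Poly_Mapping.lookup f k"
    unfolding psum_def lookup_sum
    by (simp add: lookup_single when_def in_keys_iff)
qed

lemma additive_sum_keys:
  fixes f :: "'k \<Rightarrow>\<^sub>0 'a::ab_group_add"
  assumes "Modules.additive h"
  shows "h f = (\<Sum>k\<in>Poly_Mapping.keys f. h (Poly_Mapping.single k (Poly_Mapping.lookup f k)))"
  using Modules.additive.sum[OF assms] psum_single_self[of f] unfolding psum_def by metis

text \<open>Only the monomials of \<open>f\<close> itself are compared, so whatever is known about
  its support and its coefficients is available.\<close>

lemma additive_ext:
  fixes f :: "'k \<Rightarrow>\<^sub>0 'a::ab_group_add"
  assumes "Modules.additive h" "Modules.additive h'"
    and "\<And>k. k \<in> Poly_Mapping.keys f \<Longrightarrow> h (Poly_Mapping.single k (Poly_Mapping.lookup f k))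
             = h' (Poly_Mapping.single k (Poly_Mapping.lookup f k))"
  shows "h f = h' f"
  using assms(3) unfolding additive_sum_keys[OF assms(1), of f] additive_sum_keys[OF assms(2), of f]
  by (intro sum.cong) auto

lemma additive_compose: "Modules.additive f \<Longrightarrow> Modules.additive g \<Longrightarrow> Modules.additive (\<lambda>x. f (g x))"
  by (simp add: Modules.additive_def)

lemma additive_id: "Modules.additive (\<lambda>x. x)"
  by (simp add: Modules.additive_def)

lemma additive_single: "Modules.additive (Poly_Mapping.single k)"
  by (simp add: Modules.additive_def single_add)

lemma additive_zscale: "Modules.additive (\<lambda>k. zscale k x)"
  by (simp add: Modules.additive_def zscale_add_left)

lemma additive_frag_extend: "Modules.additive (frag_extend f)"
  by (simp add: Modules.additive_def frag_extend_add)

lemma zscale_additive: "Modules.additive f \<Longrightarrow> f (zscale k x) = zscale k (f x)"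
  by (simp add: zscale_def Modules.additive.diff Modules.additive.sum)

text \<open>Unlike \<open>frag_induction\<close>, this rule hands the supports of both terms to the
  \<open>diff\<close> case, where closure arguments need them.\<close>

lemmas keys_induct = free_Abelian_group_induct [consumes 1, case_names zero diff one]

text \<open>Like \<open>frag_extend\<close>, but with values in any abelian group: coordinates are
  functions with values in a module.\<close>

definition fext :: "('k \<Rightarrow> 'b::ab_group_add) \<Rightarrow> ('k \<Rightarrow>\<^sub>0 int) \<Rightarrow> 'b" where
  "fext f = psum (\<lambda>k c. zscale c (f k))"

lemma additive_fext: "Modules.additive (fext f)"
  unfolding fext_def by (intro additive_psum additive_zscale)

lemma fext_of [simp]: "fext f (frag_of k) = f k"
  by (simp add: fext_def psum_single)

lemmas fext_add = Modules.additive.add[OF additive_fext]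
lemmas fext_diff = Modules.additive.diff[OF additive_fext]
lemmas fext_zero [simp] = Modules.additive.zero[OF additive_fext]

lemma additive_fext_arg:
  assumes "\<And>k. Modules.additive (\<lambda>m. f m k)"
  shows "Modules.additive (\<lambda>m. fext (f m) b)"
  unfolding fext_def psum_def Modules.additive_def
  by (simp add: Modules.additive.add[OF assms] zscale_add_right sum.distrib)

lemma frag_extend_eq_additive:
  assumes "Poly_Mapping.keys c \<subseteq> S" "Modules.additive h" "Modules.additive h'" "\<And>k. k \<in> S \<Longrightarrow> h (frag_of k) = h' (frag_of k)"
  shows "h c = h' c"
  using assms(1)
  by (induction c rule: frag_induction)
    (simp_all add: assms(4) Modules.additive.zero[OF assms(2)] Modules.additive.zero[OF assms(3)]
      Modules.additive.diff[OF assms(2)] Modules.additive.diff[OF assms(3)])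

lemma fext_closed:
  assumes "0 \<in> S" "\<And>x y. x \<in> S \<Longrightarrow> y \<in> S \<Longrightarrow> x - y \<in> S" "\<And>k. k \<in> Poly_Mapping.keys c \<Longrightarrow> f k \<in> S"
  shows "fext f c \<in> S"
proof -
  have "Poly_Mapping.keys c \<subseteq> {k. f k \<in> S}" using assms(3) by auto
  then show ?thesis
    by (induction c rule: frag_induction) (simp_all add: assms fext_diff)
qed


section \<open>Coordinates on the chains of a module\<close>

definition bar_basis :: "('g, 'b) monoid_scheme \<Rightarrow> nat \<Rightarrow> 'g list set" where
  "bar_basis G n = {gs. length gs = n \<and> set gs \<subseteq> carrier G - {\<one>\<^bsub>G\<^esub>}}"

definition fchains :: "('g, 'b) monoid_scheme \<Rightarrow> ('n::ab_group_add, 'g) gmodule \<Rightarrow> nat \<Rightarrow> ('g list \<Rightarrow>\<^sub>0 'n) set" where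
  "fchains G N n = {f. Poly_Mapping.keys f \<subseteq> bar_basis G n \<and> (\<forall>gs. Poly_Mapping.lookup f gs \<in> carrier N)}"

text \<open>\<open>x [g\<^sub>1|\<dots>|g\<^sub>n] \<otimes> m = [g\<^sub>1|\<dots>|g\<^sub>n] \<otimes> x\<inverse> m\<close>, so that \<open>B\<^sub>n \<otimes> N\<close> is a direct sum of copies of \<open>N\<close>.\<close>

definition coords_elt :: "('g, 'b) monoid_scheme \<Rightarrow> ('n::ab_group_add, 'g) gmodule \<Rightarrow> 'g bar \<Rightarrow> 'n \<Rightarrow> ('g list \<Rightarrow>\<^sub>0 'n)" where
  "coords_elt G N b m = fext (\<lambda>(x, gs). Poly_Mapping.single gs (act N (inv\<^bsub>G\<^esub> x) m)) b"

definition coords :: "('g, 'b) monoid_scheme \<Rightarrow> ('n::ab_group_add, 'g) gmodule \<Rightarrow> ('g bar \<times> 'n \<Rightarrow>\<^sub>0 int) \<Rightarrow> ('g list \<Rightarrow>\<^sub>0 'n)" where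
  "coords G N = fext (\<lambda>(b, m). coords_elt G N b m)"

text \<open>An element of the tensor product is a set, namely a coset of relations. The whole fibre
  of \<open>coords\<close> is literally that coset (\<open>tensor_rel_coset\<close>), so no further
  identification is needed.\<close>

definition of_coords :: "('g, 'b) monoid_scheme \<Rightarrow> ('n::ab_group_add, 'g) gmodule \<Rightarrow> nat \<Rightarrow> ('g list \<Rightarrow>\<^sub>0 'n) \<Rightarrow> ('g, 'n) hchain" where
  "of_coords G N n f = {x \<in> carrier (tensor_free (bar_res G n) N). coords G N x = f}"

lemma coords_of [simp]: "coords G N (frag_of (b, m)) = coords_elt G N b m"
  by (simp add: coords_def)

lemma additive_coords: "Modules.additive (coords G N)"
  unfolding coords_def by (rule additive_fext)

lemmas coords_add = Modules.additive.add[OF additive_coords]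
lemmas coords_diff = Modules.additive.diff[OF additive_coords]
lemmas coords_zero [simp] = Modules.additive.zero[OF additive_coords]

lemma additive_coords_elt_left: "Modules.additive (\<lambda>b. coords_elt G N b m)"
  unfolding coords_elt_def by (rule additive_fext)

lemma coords_elt_of [simp]: "coords_elt G N (frag_of (x, gs)) m = Poly_Mapping.single gs (act N (inv\<^bsub>G\<^esub> x) m)"
  by (simp add: coords_elt_def)

lemmas coords_elt_add_left = Modules.additive.add[OF additive_coords_elt_left]
lemmas coords_elt_diff_left = Modules.additive.diff[OF additive_coords_elt_left]
lemmas coords_elt_zero_left [simp] = Modules.additive.zero[OF additive_coords_elt_left]

lemma coords_elt_cmul_left: "coords_elt G N (frag_cmul k b) m = zscale k (coords_elt G N b m)"
proof -
  have "Modules.additive (\<lambda>k. coords_elt G N (frag_cmul k b) m)"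
    by (simp add: Modules.additive_def frag_cmul_distrib coords_elt_add_left)
  moreover have "k = zscale k 1" for k :: int
    by (cases "0 \<le> k") (simp_all add: zscale_def)
  ultimately show ?thesis
    using zscale_additive[of "\<lambda>k. coords_elt G N (frag_cmul k b) m" k 1] by simp
qed

lemma carrier_bar_res: "c \<in> carrier (bar_res G n) \<longleftrightarrow> Poly_Mapping.keys c \<subseteq> carrier G \<times> bar_basis G n"
  by (simp add: bar_res_def bar_basis_def)

lemma mult_bar_res [simp]: "monoid.mult (bar_res G n) = (+)"
  by (simp add: bar_res_def)

lemma act_bar_res [simp]: "act (bar_res G n) = bar_act G"
  by (simp add: bar_res_def)

lemma additive_bar_act: "Modules.additive (bar_act G x)"
  unfolding bar_act_def by (rule additive_frag_extend)

lemma bar_act_of [simp]: "bar_act G x (frag_of (y, gs)) = frag_of (x \<otimes>\<^bsub>G\<^esub> y, gs)"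
  by (simp add: bar_act_def)

lemma carrier_tensor_free: "x \<in> carrier (tensor_free M N) \<longleftrightarrow> Poly_Mapping.keys x \<subseteq> carrier M \<times> carrier N"
  by (simp add: tensor_free_def)

text \<open>The operations of the module are those of the type, and the action is additive on the
  whole type. Hence \<open>coords_elt\<close> is additive in the module argument without side
  conditions, and \<open>carrier N\<close> matters only for closure.\<close>

locale bar_module = group G for G (structure) +
  fixes N :: "('n::ab_group_add, 'a) gmodule"
  assumes mult_eq: "monoid.mult N = (+)"
    and one_eq: "one N = 0"
    and zero_closed: "0 \<in> carrier N"
    and diff_closed: "m \<in> carrier N \<Longrightarrow> n \<in> carrier N \<Longrightarrow> m - n \<in> carrier N"
    and act_closed: "g \<in> carrier G \<Longrightarrow> m \<in> carrier N \<Longrightarrow> act N g m \<in> carrier N"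
    and act_add: "act N g (m + n) = act N g m + act N g n"
    and act_one: "act N \<one> m = m"
    and act_mult: "g \<in> carrier G \<Longrightarrow> h \<in> carrier G \<Longrightarrow> act N (g \<otimes> h) m = act N g (act N h m)"
begin

lemma minus_closed: "m \<in> carrier N \<Longrightarrow> - m \<in> carrier N"
  using diff_closed[OF zero_closed] by simp

lemma add_closed: "m \<in> carrier N \<Longrightarrow> n \<in> carrier N \<Longrightarrow> m + n \<in> carrier N"
  using diff_closed[OF _ minus_closed] by fastforce

lemma additive_coords_elt: "Modules.additive (coords_elt G N b)"
  unfolding coords_elt_def
  by (intro additive_fext_arg) (auto simp: Modules.additive_def act_add single_add)

lemma fchains_zero: "0 \<in> fchains G N n"
  by (simp add: fchains_def zero_closed)

lemma fchains_diff:
  assumes "f \<in> fchains G N n" "g \<in> fchains G N n" shows "f - g \<in> fchains G N n"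
proof -
  have "Poly_Mapping.keys (f - g) \<subseteq> Poly_Mapping.keys f \<union> Poly_Mapping.keys g"
    by (rule keys_diff)
  then show ?thesis
    using assms by (auto simp: fchains_def lookup_minus diff_closed)
qed

lemma fchains_add: "f \<in> fchains G N n \<Longrightarrow> g \<in> fchains G N n \<Longrightarrow> f + g \<in> fchains G N n"
  using fchains_diff[OF _ fchains_diff[OF fchains_zero]] by fastforce

lemma fchains_single:
  "gs \<in> bar_basis G n \<Longrightarrow> m \<in> carrier N \<Longrightarrow> Poly_Mapping.single gs m \<in> fchains G N n"
  by (auto simp: fchains_def lookup_single when_def zero_closed)

lemma coords_elt_closed:
  assumes "b \<in> carrier (bar_res G n)" "m \<in> carrier N"
  shows "coords_elt G N b m \<in> fchains G N n"
  unfolding coords_elt_def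
  by (rule fext_closed[OF fchains_zero fchains_diff])
    (use assms in \<open>auto simp: carrier_bar_res intro!: fchains_single act_closed\<close>)

lemma coords_closed:
  assumes "x \<in> carrier (tensor_free (bar_res G n) N)" shows "coords G N x \<in> fchains G N n"
  unfolding coords_def
  by (rule fext_closed[OF fchains_zero fchains_diff])
    (use assms in \<open>auto simp: carrier_tensor_free intro!: coords_elt_closed\<close>)

text \<open>Both sides rest on \<open>inv (g \<otimes> x) = inv x \<otimes> inv g\<close>. This is
  why the coordinates respect the third family of tensor relations.\<close>

lemma coords_elt_bar_act:
  assumes "b \<in> carrier (bar_res G n)" "g \<in> carrier G"
  shows "coords_elt G N (bar_act G g b) m = coords_elt G N b (act N (inv g) m)"
proof -
  have "Poly_Mapping.keys b \<subseteq> carrier G \<times> bar_basis G n"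
    using assms by (simp add: carrier_bar_res)
  then show ?thesis
    by (rule frag_extend_eq_additive)
      (use assms in \<open>auto intro!: additive_compose[OF additive_coords_elt_left additive_bar_act]
        additive_coords_elt_left simp: inv_mult_group act_mult\<close>)
qed

section \<open>The relations of the tensor product\<close>

lemma group_tensor_free [simp]: "Group.group (tensor_free M N)"
  by (simp add: tensor_free_def)

lemma mult_tensor_free [simp]: "monoid.mult (tensor_free M N) = (+)"
  by (simp add: tensor_free_def free_Abelian_group_def)

lemma one_tensor_free [simp]: "one (tensor_free M N) = 0"
  by (simp add: tensor_free_def)

lemma inv_tensor_free: "x \<in> carrier (tensor_free M N) \<Longrightarrow> inv\<^bsub>tensor_free M N\<^esub> x = - x"
  by (simp add: tensor_free_def)

lemma tensor_free_diff:
  assumes "x \<in> carrier (tensor_free M N)" "y \<in> carrier (tensor_free M N)"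
  shows "x - y \<in> carrier (tensor_free M N)"
  using assms by (auto simp: carrier_tensor_free dest!: subsetD[OF keys_diff])

lemma tensor_free_add:
  assumes "x \<in> carrier (tensor_free M N)" "y \<in> carrier (tensor_free M N)"
  shows "x + y \<in> carrier (tensor_free M N)"
  using assms by (auto simp: carrier_tensor_free dest!: subsetD[OF keys_add])

lemma tensor_free_of [simp]: "frag_of (b, m) \<in> carrier (tensor_free M N) \<longleftrightarrow> b \<in> carrier M \<and> m \<in> carrier N"
  by (simp add: carrier_tensor_free)

lemma carrier_bar_res_add:
  "b \<in> carrier (bar_res G n) \<Longrightarrow> b' \<in> carrier (bar_res G n) \<Longrightarrow> b + b' \<in> carrier (bar_res G n)"
  by (auto simp: carrier_bar_res dest!: subsetD[OF keys_add])

lemma carrier_bar_res_act: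
  assumes "b \<in> carrier (bar_res G n)" "g \<in> carrier G"
  shows "bar_act G g b \<in> carrier (bar_res G n)"
  using assms keys_frag_extend[of "\<lambda>(y, gs). frag_of (g \<otimes> y, gs)" b]
  by (fastforce simp: bar_act_def carrier_bar_res)

text \<open>The zero fibre of \<open>coords\<close> is a subgroup and contains the three families of
  generators. This is the easy half of \<open>tensor_rel_iff\<close>.\<close>

lemma coords_tensor_rel:
  assumes "x \<in> tensor_rel G (bar_res G n) N"
  shows "x \<in> carrier (tensor_free (bar_res G n) N) \<and> coords G N x = 0"
proof -
  let ?T = "tensor_free (bar_res G n) N"
  let ?K = "{x \<in> carrier ?T. coords G N x = 0}"
  have K: "subgroup ?K ?T"
    by (rule subgroup.intro) (auto simp: carrier_tensor_free inv_tensor_free coords_add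
        Modules.additive.minus[OF additive_coords] dest!: subsetD[OF keys_add])
  have "tensor_rel G (bar_res G n) N \<subseteq> ?K"
    unfolding tensor_rel_def
    by (rule group.generate_subgroup_incl[OF group_tensor_free _ K])
      (auto intro!: tensor_free_diff simp: carrier_bar_res_add carrier_bar_res_act mult_eq add_closed
        coords_diff coords_elt_add_left Modules.additive.add[OF additive_coords_elt] coords_elt_bar_act
        act_closed)
  then show ?thesis using assms by blast
qed

lemma subgroup_tensor_rel: "subgroup (tensor_rel G (bar_res G n) N) (tensor_free (bar_res G n) N)"
  unfolding tensor_rel_def
  by (rule group.generate_is_subgroup[OF group_tensor_free])
    (auto intro!: tensor_free_diff simp: carrier_bar_res_add carrier_bar_res_act mult_eq add_closed act_closed)

lemma tensor_rel_zero: "0 \<in> tensor_rel G (bar_res G n) N"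
  using subgroup.one_closed[OF subgroup_tensor_rel] by simp

lemma tensor_rel_minus:
  assumes "x \<in> tensor_rel G (bar_res G n) N" shows "- x \<in> tensor_rel G (bar_res G n) N"
  using subgroup.m_inv_closed[OF subgroup_tensor_rel assms] coords_tensor_rel[OF assms]
  by (simp add: inv_tensor_free)

lemma tensor_rel_add:
  "x \<in> tensor_rel G (bar_res G n) N \<Longrightarrow> y \<in> tensor_rel G (bar_res G n) N \<Longrightarrow>
   x + y \<in> tensor_rel G (bar_res G n) N"
  using subgroup.m_closed[OF subgroup_tensor_rel] by simp

lemma tensor_rel_diff:
  "x \<in> tensor_rel G (bar_res G n) N \<Longrightarrow> y \<in> tensor_rel G (bar_res G n) N \<Longrightarrow>
   x - y \<in> tensor_rel G (bar_res G n) N"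
  using tensor_rel_add[OF _ tensor_rel_minus] by fastforce

lemma tensor_rel_sum:
  "(\<And>k. k \<in> K \<Longrightarrow> h k \<in> tensor_rel G (bar_res G n) N) \<Longrightarrow> sum h K \<in> tensor_rel G (bar_res G n) N"
  by (induction K rule: infinite_finite_induct) (auto intro: tensor_rel_zero tensor_rel_add)

lemma tensor_rel_left:
  assumes "b \<in> carrier (bar_res G n)" "b' \<in> carrier (bar_res G n)" "m \<in> carrier N"
  shows "frag_of (b + b', m) - frag_of (b, m) - frag_of (b', m) \<in> tensor_rel G (bar_res G n) N"
  unfolding tensor_rel_def mult_bar_res act_bar_res by (rule generate.incl) (use assms in blast)

lemma tensor_rel_right:
  assumes "b \<in> carrier (bar_res G n)" "m \<in> carrier N" "m' \<in> carrier N"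
  shows "frag_of (b, m + m') - frag_of (b, m) - frag_of (b, m') \<in> tensor_rel G (bar_res G n) N"
  unfolding tensor_rel_def mult_eq by (rule generate.incl) (use assms in blast)

lemma tensor_rel_act:
  assumes "b \<in> carrier (bar_res G n)" "m \<in> carrier N" "g \<in> carrier G"
  shows "frag_of (bar_act G (inv g) b, m) - frag_of (b, act N g m) \<in> tensor_rel G (bar_res G n) N"
  unfolding tensor_rel_def mult_bar_res act_bar_res by (rule generate.incl) (use assms in blast)

lemma tensor_rel_zero_right:
  assumes "b \<in> carrier (bar_res G n)"
  shows "frag_of (b, 0) \<in> tensor_rel G (bar_res G n) N"
  using tensor_rel_minus[OF tensor_rel_right[OF assms zero_closed zero_closed]] by simp

section \<open>Normal forms of tensors\<close>

definition normal_form :: "('a list \<Rightarrow>\<^sub>0 'n) \<Rightarrow> ('a bar \<times> 'n \<Rightarrow>\<^sub>0 int)" where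
  "normal_form f = (\<Sum>gs\<in>Poly_Mapping.keys f. frag_of (frag_of (\<one>, gs), Poly_Mapping.lookup f gs))"

lemma carrier_bar_res_of [simp]:
  "frag_of (x, gs) \<in> carrier (bar_res G n) \<longleftrightarrow> x \<in> carrier G \<and> gs \<in> bar_basis G n"
  by (simp add: carrier_bar_res)

lemma normal_form_closed:
  assumes "f \<in> fchains G N n" shows "normal_form f \<in> carrier (tensor_free (bar_res G n) N)"
proof -
  have "(\<Sum>gs\<in>K. frag_of (frag_of (\<one>, gs), Poly_Mapping.lookup f gs)) \<in> carrier (tensor_free (bar_res G n) N)"
    if "K \<subseteq> Poly_Mapping.keys f" for K
    using that assms
    by (induction K rule: infinite_finite_induct) 
      (auto intro!: tensor_free_add simp: fchains_def, auto simp: carrier_tensor_free)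
  then show ?thesis unfolding normal_form_def by blast
qed

lemma coords_normal_form: "coords G N (normal_form f) = f"
  using psum_single_self[of f]
  by (simp add: normal_form_def Modules.additive.sum[OF additive_coords] psum_def act_one)

text \<open>The normal forms of \<open>f\<close>, \<open>g\<close> and \<open>f + g\<close> are sums
  over different supports. A common index set adds terms with second entry 0, which are nonzero in
  the free group but are relations.\<close>

lemma normal_form_superset:
  assumes "f \<in> fchains G N n" "finite S" "S \<subseteq> bar_basis G n" "Poly_Mapping.keys f \<subseteq> S"
  shows "(\<Sum>gs\<in>S. frag_of (frag_of (\<one>, gs), Poly_Mapping.lookup f gs)) - normal_form f
     \<in> tensor_rel G (bar_res G n) N"
proof -
  have "(\<Sum>gs\<in>S. frag_of (frag_of (\<one>, gs), Poly_Mapping.lookup f gs)) - normal_form f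
     = (\<Sum>gs\<in>S - Poly_Mapping.keys f. frag_of (frag_of (\<one>, gs), Poly_Mapping.lookup f gs))"
    unfolding normal_form_def by (simp add: sum.subset_diff[OF assms(4,2)])
  also have "\<dots> = (\<Sum>gs\<in>S - Poly_Mapping.keys f. frag_of (frag_of (\<one>, gs), 0))"
    by (intro sum.cong) (auto simp: in_keys_iff)
  finally show ?thesis
    using assms(3) by (auto intro!: tensor_rel_sum tensor_rel_zero_right)
qed

text \<open>Each \<open>frag_of (b, m)\<close> is a separate free generator, so
  \<open>normal_form\<close> is additive only modulo relations.\<close>

lemma normal_form_add:
  assumes "f \<in> fchains G N n" "g \<in> fchains G N n"
  shows "normal_form (f + g) - normal_form f - normal_form g \<in> tensor_rel G (bar_res G n) N"
proof -
  let ?S = "Poly_Mapping.keys f \<union> Poly_Mapping.keys g"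
  let ?T = "\<lambda>f. \<Sum>gs\<in>?S. frag_of (frag_of (\<one>, gs), Poly_Mapping.lookup f gs)"
  have S: "?S \<subseteq> bar_basis G n" using assms by (auto simp: fchains_def)
  have *: "?T (f + g) - ?T f - ?T g \<in> tensor_rel G (bar_res G n) N"
    unfolding sum_subtractf[symmetric] lookup_add
    using assms S by (intro tensor_rel_sum tensor_rel_right) (auto simp: fchains_def)
  have "?T f - normal_form f \<in> tensor_rel G (bar_res G n) N"
    "?T g - normal_form g \<in> tensor_rel G (bar_res G n) N"
    "?T (f + g) - normal_form (f + g) \<in> tensor_rel G (bar_res G n) N"
    by (rule normal_form_superset; use assms S fchains_add in \<open>auto dest: subsetD[OF keys_add]\<close>)+
  from tensor_rel_diff[OF tensor_rel_add[OF * tensor_rel_add[OF this(1,2)]] this(3)]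
  show ?thesis by (simp add: algebra_simps)
qed

lemma normal_form_single:
  assumes "gs \<in> bar_basis G n" "m \<in> carrier N"
  shows "normal_form (Poly_Mapping.single gs m) - frag_of (frag_of (\<one>, gs), m) \<in> tensor_rel G (bar_res G n) N"
  using assms
  by (cases "m = 0") (auto simp: normal_form_def lookup_single intro!: tensor_rel_zero_right tensor_rel_zero tensor_rel_minus)

lemma normal_form_elt:
  assumes "b \<in> carrier (bar_res G n)" "m \<in> carrier N"
  shows "normal_form (coords_elt G N b m) - frag_of (b, m) \<in> tensor_rel G (bar_res G n) N"
proof -
  have "Poly_Mapping.keys b \<subseteq> carrier G \<times> bar_basis G n"
    using assms by (simp add: carrier_bar_res)
  then show ?thesis
  proof (induction b rule: keys_induct)
    case zero
    then show ?case
      using tensor_rel_left[of 0 n 0 m] assms(2) by (simp add: normal_form_def carrier_bar_res)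
  next
    case (diff b b')
    from diff have b: "b \<in> carrier (bar_res G n)" "b' \<in> carrier (bar_res G n)" "b - b' \<in> carrier (bar_res G n)"
      by (auto simp: carrier_bar_res dest!: subsetD[OF keys_diff])
    let ?n = "\<lambda>b. normal_form (coords_elt G N b m)"
    \<comment> \<open>The additivity relation and \<open>normal_form_add\<close> concern sums, so
      \<open>b\<close> is read as \<open>(b - b') + b'\<close>.\<close>
    have rel: "frag_of (b - b' + b', m) - frag_of (b - b', m) - frag_of (b', m) \<in> tensor_rel G (bar_res G n) N"
      by (intro tensor_rel_left b assms)
    have "?n (b - b' + b') - ?n (b - b') - ?n b' \<in> tensor_rel G (bar_res G n) N"
      unfolding coords_elt_add_left by (intro normal_form_add coords_elt_closed b assms)
    from tensor_rel_diff[OF tensor_rel_add[OF tensor_rel_diff[OF diff(3,4)] rel] this]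
    show ?case by (simp add: algebra_simps)
  next
    case (one a)
    then obtain x gs where a: "a = (x, gs)" "x \<in> carrier G" "gs \<in> bar_basis G n" by auto
    \<comment> \<open>The identity of \<open>x [gs] \<otimes> m\<close> with
      \<open>[gs] \<otimes> inv x m\<close> is the action relation for the group element
      \<open>inv x\<close>, whence the double inverse.\<close>
    have "frag_of (bar_act G (inv (inv x)) (frag_of (\<one>, gs)), m) - frag_of (frag_of (\<one>, gs), act N (inv x) m)
        \<in> tensor_rel G (bar_res G n) N"
      using a assms by (intro tensor_rel_act) auto
    from tensor_rel_diff[OF normal_form_single[OF a(3) act_closed[OF inv_closed[OF a(2)] assms(2)]] this]
    show ?case using a by simp
  qed
qed

lemma normal_form_rel:
  assumes "x \<in> carrier (tensor_free (bar_res G n) N)"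
  shows "normal_form (coords G N x) - x \<in> tensor_rel G (bar_res G n) N"
proof -
  have "Poly_Mapping.keys x \<subseteq> carrier (bar_res G n) \<times> carrier N"
    using assms by (simp add: carrier_tensor_free)
  then show ?thesis
  proof (induction x rule: keys_induct)
    case zero
    then show ?case by (simp add: normal_form_def tensor_rel_zero)
  next
    case (diff x y)
    then have "x \<in> carrier (tensor_free (bar_res G n) N)" "y \<in> carrier (tensor_free (bar_res G n) N)"
      by (auto simp: carrier_tensor_free)
    then have "normal_form (coords G N (x - y) + coords G N y) - normal_form (coords G N (x - y)) - normal_form (coords G N y)
       \<in> tensor_rel G (bar_res G n) N"
      by (intro normal_form_add coords_closed tensor_free_diff)
    from tensor_rel_diff[OF tensor_rel_diff[OF diff(3,4)] this]
    show ?case by (simp add: coords_diff algebra_simps)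
  next
    case (one a)
    then show ?case by (cases a) (auto intro: normal_form_elt)
  qed
qed

text \<open>Modulo relations \<open>x\<close> equals its normal form, which is an empty sum if the
  coordinates vanish. From here on tensors are handled through their coordinates.\<close>

lemma tensor_rel_iff:
  "x \<in> tensor_rel G (bar_res G n) N \<longleftrightarrow> x \<in> carrier (tensor_free (bar_res G n) N) \<and> coords G N x = 0"
proof
  assume x: "x \<in> carrier (tensor_free (bar_res G n) N) \<and> coords G N x = 0"
  then have "- (normal_form (coords G N x) - x) \<in> tensor_rel G (bar_res G n) N"
    by (intro tensor_rel_minus normal_form_rel) auto
  then show "x \<in> tensor_rel G (bar_res G n) N"
    using x by (simp add: normal_form_def)
qed (rule coords_tensor_rel)

lemma tensor_rel_eq: "tensor_rel G (bar_res G n) N = of_coords G N n 0"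
  by (auto simp: tensor_rel_iff of_coords_def)

section \<open>Tensors and chains as fibres of the coordinates\<close>

lemma of_coords_nonempty: "f \<in> fchains G N n \<Longrightarrow> of_coords G N n f \<noteq> {}"
  using normal_form_closed coords_normal_form by (auto simp: of_coords_def)

lemma of_coords_inj:
  "f \<in> fchains G N n \<Longrightarrow> of_coords G N n f = of_coords G N n g \<longleftrightarrow> f = g"
  using of_coords_nonempty by (fastforce simp: of_coords_def)

lemma of_coords_mult:
  assumes "f \<in> fchains G N n" "g \<in> fchains G N n"
  shows "of_coords G N n f <#>\<^bsub>tensor_free (bar_res G n) N\<^esub> of_coords G N n g = of_coords G N n (f + g)"
proof (intro equalityI subsetI)
  fix z assume z: "z \<in> of_coords G N n (f + g)"
  have "z = (z - normal_form g) + normal_form g" by simp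
  moreover have "normal_form g \<in> of_coords G N n g" "z - normal_form g \<in> of_coords G N n f"
    using z assms normal_form_closed[OF assms(2)]
    by (auto simp: of_coords_def coords_normal_form coords_diff tensor_free_diff)
  ultimately show "z \<in> of_coords G N n f <#>\<^bsub>tensor_free (bar_res G n) N\<^esub> of_coords G N n g"
    unfolding set_mult_def by fastforce
qed (auto simp: set_mult_def of_coords_def coords_add tensor_free_add)

lemma tensor_rel_coset:
  assumes "x \<in> carrier (tensor_free (bar_res G n) N)"
  shows "tensor_rel G (bar_res G n) N #>\<^bsub>tensor_free (bar_res G n) N\<^esub> x = of_coords G N n (coords G N x)"
proof (intro equalityI subsetI)
  fix z assume z: "z \<in> of_coords G N n (coords G N x)"
  have "z = (z - x) + x" by simp
  moreover have "z - x \<in> of_coords G N n 0"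
    using z assms by (auto simp: of_coords_def coords_diff tensor_free_diff)
  ultimately show "z \<in> tensor_rel G (bar_res G n) N #>\<^bsub>tensor_free (bar_res G n) N\<^esub> x"
    unfolding r_coset_def tensor_rel_eq by fastforce
qed (use assms in \<open>auto simp: r_coset_def tensor_rel_eq of_coords_def coords_add tensor_free_add\<close>)

lemma tensor_elt_eq:
  "b \<in> carrier (bar_res G n) \<Longrightarrow> m \<in> carrier N \<Longrightarrow>
   tensor_elt G (bar_res G n) N b m = of_coords G N n (coords_elt G N b m)"
  by (simp add: tensor_elt_def tensor_rel_coset)

lemma coords_image: "coords G N ` carrier (tensor_free (bar_res G n) N) = fchains G N n"
proof (intro equalityI subsetI)
  fix f assume "f \<in> fchains G N n"
  then show "f \<in> coords G N ` carrier (tensor_free (bar_res G n) N)"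
    using normal_form_closed coords_normal_form by (metis image_eqI)
qed (auto intro: coords_closed)

lemma carrier_chains: "carrier (chains G N n) = of_coords G N n ` fchains G N n"
  unfolding chains_def tensor_def carrier_FactGroup coords_image[symmetric] image_image
  by (intro image_cong refl tensor_rel_coset)

lemma mult_chains:
  "f \<in> fchains G N n \<Longrightarrow> g \<in> fchains G N n \<Longrightarrow>
   of_coords G N n f \<otimes>\<^bsub>chains G N n\<^esub> of_coords G N n g = of_coords G N n (f + g)"
  by (simp add: chains_def tensor_def of_coords_mult)

lemma one_chains: "\<one>\<^bsub>chains G N n\<^esub> = of_coords G N n 0"
  by (simp add: chains_def tensor_def tensor_rel_eq)

end

text \<open>\<open>tensor_map\<close> saturates an image by relations, so every element of the
  target fibre must differ by a relation from some image; the image of the normal form serves for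
  all of them. The boundary is the case where \<open>v\<close> is the identity, the coefficient map
  the case where \<open>u\<close> is.\<close>

lemma tensor_map_eq:
  assumes "bar_module G N" "bar_module G N'" "f \<in> fchains G N n" "Modules.additive T"
    and "\<And>b m. b \<in> carrier (bar_res G n) \<Longrightarrow> m \<in> carrier N \<Longrightarrow> u b \<in> carrier (bar_res G n') \<and> v m \<in> carrier N'
         \<and> coords_elt G N' (u b) (v m) = T (coords_elt G N b m)"
  shows "tensor_map G (bar_res G n') N' u v (of_coords G N n f) = of_coords G N' n' (T f)"
proof -
  interpret N: bar_module G N by fact
  interpret N': bar_module G N' by fact
  let ?h = "\<lambda>(m, n). frag_of (u m, v n)"
  have h: "frag_extend ?h x \<in> carrier (tensor_free (bar_res G n') N') \<and> coords G N' (frag_extend ?h x) = T (coords G N x)"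
    if "x \<in> carrier (tensor_free (bar_res G n) N)" for x
  proof -
    have "Poly_Mapping.keys x \<subseteq> carrier (bar_res G n) \<times> carrier N"
      using that by (simp add: carrier_tensor_free)
    then show ?thesis
    proof (induction x rule: keys_induct)
      case zero
      then show ?case
        by (simp add: carrier_tensor_free Modules.additive.zero[OF assms(4)])
    next
      case (diff x y)
      then show ?case
        by (simp add: frag_extend_diff N'.tensor_free_diff coords_diff Modules.additive.diff[OF assms(4)])
    next
      case (one a)
      then show ?case using assms(5) by (cases a) auto
    qed
  qed
  have nf: "N.normal_form f \<in> of_coords G N n f"
    using assms(3) N.normal_form_closed N.coords_normal_form by (simp add: of_coords_def)
  have "\<exists>x. x \<in> tensor_rel G (bar_res G n') N' \<and> (\<exists>y\<in>of_coords G N n f. z = x + frag_extend ?h y)"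
    if "z \<in> of_coords G N' n' (T f)" for z
  proof (intro exI conjI bexI)
    show "z - frag_extend ?h (N.normal_form f) \<in> tensor_rel G (bar_res G n') N'"
      using that nf h[of "N.normal_form f"]
      by (auto simp: N'.tensor_rel_iff of_coords_def N'.tensor_free_diff coords_diff)
  qed (use nf in auto)
  then show ?thesis
    unfolding tensor_map_def set_mult_def
    using h by (fastforce simp: of_coords_def N'.tensor_rel_iff coords_add N'.tensor_free_add)
qed

section \<open>Boundaries, coefficient maps and homology in coordinates\<close>

text \<open>The normalization of \<open>bar_symbol\<close> is built in, so boundary formulas can be
  stated without assuming that the entries differ from 1.\<close>

definition symb :: "('g, 'b) monoid_scheme \<Rightarrow> 'g list \<Rightarrow> 'n::ab_group_add \<Rightarrow> ('g list \<Rightarrow>\<^sub>0 'n)" where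
  "symb G gs m = (if \<one>\<^bsub>G\<^esub> \<in> set gs then 0 else Poly_Mapping.single gs m)"

definition coord_bd :: "('g, 'b) monoid_scheme \<Rightarrow> ('n::ab_group_add, 'g) gmodule \<Rightarrow> ('g list \<Rightarrow>\<^sub>0 'n) \<Rightarrow> ('g list \<Rightarrow>\<^sub>0 'n)" where
  "coord_bd G N = psum (\<lambda>gs m. coords_elt G N (bar_bd_symbol G gs) m)"

definition coord_map :: "('n::ab_group_add \<Rightarrow> 'n2::ab_group_add) \<Rightarrow> ('g list \<Rightarrow>\<^sub>0 'n) \<Rightarrow> ('g list \<Rightarrow>\<^sub>0 'n2)" where
  "coord_map h = psum (\<lambda>gs m. Poly_Mapping.single gs (h m))"

definition fcycles :: "('g, 'b) monoid_scheme \<Rightarrow> ('n::ab_group_add, 'g) gmodule \<Rightarrow> nat \<Rightarrow> ('g list \<Rightarrow>\<^sub>0 'n) set" where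
  "fcycles G N n = {f \<in> fchains G N n. n \<noteq> 0 \<longrightarrow> coord_bd G N f = 0}"

text \<open>A homology class as it occurs in \<open>homology\<close>: a set of fibres, one for each
  way of adding a boundary.\<close>

definition coord_class :: "('g, 'b) monoid_scheme \<Rightarrow> ('n::ab_group_add, 'g) gmodule \<Rightarrow> nat \<Rightarrow> ('g list \<Rightarrow>\<^sub>0 'n) \<Rightarrow> ('g, 'n) hchain set" where
  "coord_class G N n f = (\<lambda>t. of_coords G N n (f + coord_bd G N t)) ` fchains G N (Suc n)"

lemma additive_symb: "Modules.additive (symb G gs)"
  by (simp add: symb_def Modules.additive_def single_add)

lemma symb_diff: "symb G gs (m - m') = symb G gs m - symb G gs m'"
  by (rule Modules.additive.diff[OF additive_symb])

lemma symb_one: "\<one>\<^bsub>G\<^esub> \<in> set gs \<Longrightarrow> symb G gs m = 0"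
  by (simp add: symb_def)

lemma additive_coord_map:
  assumes "Modules.additive h" shows "Modules.additive (coord_map h)"
  unfolding coord_map_def
  by (intro additive_psum additive_compose[OF additive_single assms])

lemma lookup_coord_map: "h 0 = 0 \<Longrightarrow> Poly_Mapping.lookup (coord_map h f) gs = h (Poly_Mapping.lookup f gs)"
  unfolding coord_map_def psum_def lookup_sum
  by (simp add: lookup_single when_def in_keys_iff)

lemma coord_map_single: "h 0 = 0 \<Longrightarrow> coord_map h (Poly_Mapping.single gs m) = Poly_Mapping.single gs (h m)"
  by (simp add: coord_map_def psum_single)

lemma coord_map_symb: "h 0 = 0 \<Longrightarrow> coord_map h (symb G gs m) = symb G gs (h m)"
  by (simp add: symb_def coord_map_single) (simp add: coord_map_def)

lemma coord_map_id: "coord_map (\<lambda>x. x) f = f"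
  by (rule poly_mapping_eqI) (simp add: lookup_coord_map)

text \<open>A submodule inherits the action, so its boundaries may be computed in the ambient
  module.\<close>

lemma coord_bd_cong: "act N = act N' \<Longrightarrow> coord_bd G N = coord_bd G N'"
  by (simp add: coord_bd_def coords_elt_def)

lemma fchains_mono: "carrier N \<subseteq> carrier N' \<Longrightarrow> fchains G N n \<subseteq> fchains G N' n"
  by (auto simp: fchains_def)

context bar_module
begin

lemma additive_coord_bd: "Modules.additive (coord_bd G N)"
  unfolding coord_bd_def by (intro additive_psum additive_coords_elt)

lemmas coord_bd_add = Modules.additive.add[OF additive_coord_bd]
lemmas coord_bd_diff = Modules.additive.diff[OF additive_coord_bd]
lemmas coord_bd_zero = Modules.additive.zero[OF additive_coord_bd]

lemma coord_bd_single: "coord_bd G N (Poly_Mapping.single gs m) = coords_elt G N (bar_bd_symbol G gs) m"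
  unfolding coord_bd_def
  by (rule psum_single) (rule Modules.additive.zero[OF additive_coords_elt])

lemma bar_symbol_closed:
  "length gs = n \<Longrightarrow> set gs \<subseteq> carrier G \<Longrightarrow> bar_symbol G gs \<in> carrier (bar_res G n)"
  by (auto simp: bar_symbol_def carrier_bar_res bar_basis_def)

lemma symb_closed:
  "length gs = n \<Longrightarrow> set gs \<subseteq> carrier G \<Longrightarrow> m \<in> carrier N \<Longrightarrow> symb G gs m \<in> fchains G N n"
  by (auto simp: symb_def bar_basis_def intro!: fchains_zero fchains_single)

lemma coords_bar_symbol: "coords_elt G N (bar_symbol G gs) m = symb G gs m"
  by (simp add: bar_symbol_def symb_def act_one)

lemma carrier_bar_res_sum:
  "(\<And>i. i \<in> I \<Longrightarrow> h i \<in> carrier (bar_res G n)) \<Longrightarrow> sum h I \<in> carrier (bar_res G n)"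
  by (induction I rule: infinite_finite_induct) (simp_all add: carrier_bar_res_add, simp_all add: carrier_bar_res)

lemma carrier_bar_res_cmul: "b \<in> carrier (bar_res G n) \<Longrightarrow> frag_cmul k b \<in> carrier (bar_res G n)"
  by (auto simp: carrier_bar_res)

lemma bar_bd_symbol_closed:
  assumes "gs \<in> bar_basis G (Suc n)" shows "bar_bd_symbol G gs \<in> carrier (bar_res G n)"
proof -
  have gs: "length gs = Suc n" "set gs \<subseteq> carrier G" "gs \<noteq> []"
    using assms by (auto simp: bar_basis_def)
  have "hd gs \<in> carrier G" "set (tl gs) \<subseteq> carrier G" "set (butlast gs) \<subseteq> carrier G"
    using gs by (auto dest: in_set_butlastD list.set_sel(2))
  then have "bar_act G (hd gs) (bar_symbol G (tl gs)) \<in> carrier (bar_res G n)"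
    "bar_symbol G (butlast gs) \<in> carrier (bar_res G n)"
    using gs by (auto intro!: carrier_bar_res_act bar_symbol_closed)
  moreover have "bar_symbol G (take (i - 1) gs @ [gs ! (i - 1) \<otimes> gs ! i] @ drop (i + 1) gs) \<in> carrier (bar_res G n)"
    if "i \<in> {1..<length gs}" for i
  proof (rule bar_symbol_closed)
    have "gs ! (i - 1) \<in> carrier G" "gs ! i \<in> carrier G"
      using that by (auto intro!: subsetD[OF gs(2)] nth_mem)
    then show "set (take (i - 1) gs @ [gs ! (i - 1) \<otimes> gs ! i] @ drop (i + 1) gs) \<subseteq> carrier G"
      using gs(2) by (auto dest: in_set_takeD in_set_dropD)
  qed (use that gs(1) in auto)
  ultimately show ?thesis
    unfolding bar_bd_symbol_def if_not_P[OF gs(3)]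
    by (intro carrier_bar_res_add carrier_bar_res_sum carrier_bar_res_cmul)
qed

lemma fchains_sum:
  "(\<And>i. i \<in> I \<Longrightarrow> h i \<in> fchains G N n) \<Longrightarrow> sum h I \<in> fchains G N n"
  by (induction I rule: infinite_finite_induct) (simp_all add: fchains_add fchains_zero)

lemma coord_bd_closed:
  assumes "f \<in> fchains G N (Suc n)" shows "coord_bd G N f \<in> fchains G N n"
  unfolding coord_bd_def psum_def
  using assms by (intro fchains_sum coords_elt_closed bar_bd_symbol_closed) (auto simp: fchains_def)

lemma bar_bd_closed:
  assumes "b \<in> carrier (bar_res G (Suc n))"
  shows "bar_bd G b \<in> carrier (bar_res G n) \<and> coords_elt G N (bar_bd G b) m = coord_bd G N (coords_elt G N b m)"
proof -
  have "Poly_Mapping.keys b \<subseteq> carrier G \<times> bar_basis G (Suc n)"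
    using assms by (simp add: carrier_bar_res)
  then show ?thesis
  proof (induction b rule: keys_induct)
    case zero
    then show ?case by (simp add: bar_bd_def carrier_bar_res coord_bd_zero)
  next
    case (diff b b')
    then show ?case
      unfolding bar_bd_def by (auto simp: frag_extend_diff coords_elt_diff_left coord_bd_diff
          carrier_bar_res dest!: subsetD[OF keys_diff])
  next
    case (one a)
    then show ?case
      by (cases a) (auto simp: bar_bd_def coord_bd_single coords_elt_bar_act[OF bar_bd_symbol_closed]
          intro: carrier_bar_res_act[OF bar_bd_symbol_closed])
  qed
qed

lemma chain_bd_eq:
  assumes "f \<in> fchains G N (Suc n)"
  shows "chain_bd G N n (of_coords G N (Suc n) f) = of_coords G N n (coord_bd G N f)"
  unfolding chain_bd_def
  by (rule tensor_map_eq[OF bar_module_axioms bar_module_axioms assms additive_coord_bd])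
    (simp add: bar_bd_closed)

section \<open>Boundaries of symbols of length at most three\<close>

lemma coord_bd_symb1:
  assumes "g \<in> carrier G"
  shows "coord_bd G N (symb G [g] m) = symb G [] (act N (inv g) m) - symb G [] m"
proof (cases "g = \<one>")
  case True
  then show ?thesis by (simp add: symb_one coord_bd_zero act_one)
next
  case False
  have "coord_bd G N (symb G [g] m) = coords_elt G N (bar_bd_symbol G [g]) m"
    using False by (simp add: symb_def coord_bd_single)
  also have "\<dots> = symb G [] (act N (inv g) m) - symb G [] m"
    using assms by (simp add: bar_bd_symbol_def coords_elt_diff_left coords_bar_symbol
        coords_elt_bar_act[OF bar_symbol_closed[OF refl]])
  finally show ?thesis .
qed

text \<open>If an entry is 1, the right-hand side cancels as well. Later computations therefore
  never ask whether a matrix such as D(z) happens to be the identity.\<close>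

lemma coord_bd_symb2:
  assumes "g \<in> carrier G" "h \<in> carrier G"
  shows "coord_bd G N (symb G [g, h] m) = symb G [h] (act N (inv g) m) - symb G [g \<otimes> h] m + symb G [g] m"
proof (cases "g = \<one> \<or> h = \<one>")
  case True
  then show ?thesis using assms by (auto simp: symb_one coord_bd_zero act_one)
next
  case False
  then have "coord_bd G N (symb G [g, h] m) = coords_elt G N (bar_bd_symbol G [g, h]) m"
    by (auto simp: symb_def coord_bd_single)
  also have "\<dots> = symb G [h] (act N (inv g) m) - symb G [g \<otimes> h] m + symb G [g] m"
    using assms by (simp add: bar_bd_symbol_def coords_elt_diff_left coords_elt_add_left coords_bar_symbol
        coords_elt_bar_act[OF bar_symbol_closed[OF refl]])
  finally show ?thesis .
qed

lemma coord_bd_single3: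
  assumes "[g, h, k] \<in> bar_basis G 3"
  shows "coord_bd G N (Poly_Mapping.single [g, h, k] m) =
    symb G [h, k] (act N (inv g) m) - symb G [g \<otimes> h, k] m + symb G [g, h \<otimes> k] m - symb G [g, h] m"
proof -
  have [simp]: "{1..<3::nat} = {1, 2}" by auto
  show ?thesis
    using assms by (simp add: coord_bd_single bar_basis_def bar_bd_symbol_def coords_elt_diff_left coords_elt_add_left
        coords_bar_symbol coords_elt_bar_act[OF bar_symbol_closed[OF refl]] eval_nat_numeral)
qed

text \<open>The zig-zag from degree 2 to degree 0 meets only chains of degree at most 3, so it
  suffices to check that the boundary squares to zero on symbols of length 2 and 3.\<close>

lemma coord_bd_bd_2:
  assumes "f \<in> fchains G N 2" shows "coord_bd G N (coord_bd G N f) = 0"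
proof (rule additive_ext[of "\<lambda>f. coord_bd G N (coord_bd G N f)" "\<lambda>f. 0" f])
  fix gs assume "gs \<in> Poly_Mapping.keys f"
  then have "gs \<in> bar_basis G 2" using assms by (auto simp: fchains_def)
  then obtain g h where gs: "gs = [g, h]" "g \<in> carrier G" "h \<in> carrier G" "g \<noteq> \<one>" "h \<noteq> \<one>"
    by (auto simp: bar_basis_def length_Suc_conv eval_nat_numeral)
  have s: "Poly_Mapping.single gs m = symb G [g, h] m" for m :: 'n
    using gs by (auto simp: symb_def)
  show "coord_bd G N (coord_bd G N (Poly_Mapping.single gs (Poly_Mapping.lookup f gs))) = 0"
    unfolding s using gs
    by (simp add: coord_bd_symb2 coord_bd_symb1 coord_bd_add coord_bd_diff inv_mult_group act_mult)
qed (simp_all add: additive_compose additive_coord_bd Modules.additive_def coord_bd_add)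

lemma coord_bd_bd_3:
  assumes "f \<in> fchains G N 3" shows "coord_bd G N (coord_bd G N f) = 0"
proof (rule additive_ext[of "\<lambda>f. coord_bd G N (coord_bd G N f)" "\<lambda>f. 0" f])
  fix gs assume "gs \<in> Poly_Mapping.keys f"
  then have b: "gs \<in> bar_basis G 3" using assms by (auto simp: fchains_def)
  then obtain g h k where gs: "gs = [g, h, k]" "g \<in> carrier G" "h \<in> carrier G" "k \<in> carrier G"
    by (auto simp: bar_basis_def length_Suc_conv eval_nat_numeral)
  show "coord_bd G N (coord_bd G N (Poly_Mapping.single gs (Poly_Mapping.lookup f gs))) = 0"
    unfolding gs(1) coord_bd_single3[OF b[unfolded gs(1)]] using gs
    by (simp add: coord_bd_symb2 coord_bd_add coord_bd_diff inv_mult_group act_mult m_assoc)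
qed (simp_all add: additive_compose additive_coord_bd Modules.additive_def coord_bd_add)

section \<open>Cycles and homology classes in coordinates\<close>

lemma fcycles_fchains: "f \<in> fcycles G N n \<Longrightarrow> f \<in> fchains G N n"
  by (simp add: fcycles_def)

lemma cycles_eq: "cycles G N n = of_coords G N n ` fcycles G N n"
proof (cases n)
  case 0
  then show ?thesis by (simp add: cycles_def carrier_chains fcycles_def)
next
  case (Suc k)
  show ?thesis
    unfolding Suc cycles_def kernel_def fcycles_def
    by (auto simp: carrier_chains one_chains chain_bd_eq of_coords_inj coord_bd_closed)
qed

lemma boundaries_eq: "boundaries G N n = coord_class G N n 0"
  unfolding boundaries_def carrier_chains image_image coord_class_def
  by (intro image_cong refl) (simp add: chain_bd_eq)

lemma coord_class_mem:
  assumes "f \<in> fchains G N n"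
  shows "of_coords G N n f \<in> coord_class G N n g \<longleftrightarrow> (\<exists>t\<in>fchains G N (Suc n). f = g + coord_bd G N t)"
  using of_coords_inj[OF assms] by (auto simp: coord_class_def)

lemma coord_class_self: "f \<in> fchains G N n \<Longrightarrow> of_coords G N n f \<in> coord_class G N n f"
  using coord_class_mem[of f n f] fchains_zero coord_bd_zero by force

lemma coord_class_eqI:
  assumes "s \<in> fchains G N (Suc n)" "f = g + coord_bd G N s"
  shows "coord_class G N n f = coord_class G N n g"
proof -
  have "f + coord_bd G N t = g + coord_bd G N (s + t)" for t
    by (simp add: assms(2) coord_bd_add add_ac)
  then have "coord_class G N n f = (\<lambda>t. of_coords G N n (g + coord_bd G N t)) ` (+) s ` fchains G N (Suc n)"
    by (simp add: coord_class_def image_image)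
  moreover have "(+) s ` fchains G N (Suc n) = fchains G N (Suc n)"
  proof (intro equalityI subsetI)
    fix t assume "t \<in> fchains G N (Suc n)"
    then show "t \<in> (+) s ` fchains G N (Suc n)"
      using fchains_diff[OF _ assms(1)] by (intro image_eqI[of _ _ "t - s"]) auto
  qed (use fchains_add[OF assms(1)] in auto)
  ultimately show ?thesis by (simp add: coord_class_def)
qed

lemma hclass_eq:
  assumes "f \<in> fchains G N n" shows "hclass G N n (of_coords G N n f) = coord_class G N n f"
  using assms by (auto simp: hclass_def boundaries_eq coord_class_def r_coset_def mult_chains coord_bd_closed add.commute)

lemma carrier_homology: "carrier (homology G N n) = coord_class G N n ` fcycles G N n"
proof -
  have "boundaries G N n #>\<^bsub>chains G N n\<lparr>carrier := cycles G N n\<rparr>\<^esub> x = hclass G N n x" for x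
    by (simp add: hclass_def r_coset_def)
  then show ?thesis
    by (auto simp: homology_def carrier_FactGroup cycles_eq image_image hclass_eq fcycles_fchains)
qed

lemma one_homology: "\<one>\<^bsub>homology G N n\<^esub> = coord_class G N n 0"
  by (simp add: homology_def boundaries_eq)

lemma coord_class_mult:
  assumes "f \<in> fchains G N n" "g \<in> fchains G N n"
  shows "coord_class G N n f <#>\<^bsub>chains G N n\<^esub> coord_class G N n g = coord_class G N n (f + g)"
proof -
  have *: "of_coords G N n (f + coord_bd G N s) \<otimes>\<^bsub>chains G N n\<^esub> of_coords G N n (g + coord_bd G N t)
     = of_coords G N n (f + g + coord_bd G N (s + t))"
    if "s \<in> fchains G N (Suc n)" "t \<in> fchains G N (Suc n)" for s t
    using that assms by (simp add: mult_chains fchains_add coord_bd_closed coord_bd_add add_ac)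
  have "of_coords G N n (f + g + coord_bd G N t) \<in> coord_class G N n f <#>\<^bsub>chains G N n\<^esub> coord_class G N n g"
    if "t \<in> fchains G N (Suc n)" for t
    using *[OF that fchains_zero] that fchains_zero unfolding set_mult_def coord_class_def by fastforce
  then show ?thesis
    using * fchains_add by (fastforce simp: set_mult_def coord_class_def)
qed

lemma mult_homology:
  assumes "f \<in> fchains G N n" "g \<in> fchains G N n"
  shows "coord_class G N n f \<otimes>\<^bsub>homology G N n\<^esub> coord_class G N n g = coord_class G N n (f + g)"
  using coord_class_mult[OF assms] by (simp add: homology_def set_mult_def)

lemma fcycles_zero: "0 \<in> fcycles G N n"
  by (simp add: fcycles_def fchains_zero coord_bd_zero)

lemma fcycles_diff: "f \<in> fcycles G N n \<Longrightarrow> g \<in> fcycles G N n \<Longrightarrow> f - g \<in> fcycles G N n"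
  by (simp add: fcycles_def fchains_diff coord_bd_diff)

lemma fcycles_add: "f \<in> fcycles G N n \<Longrightarrow> g \<in> fcycles G N n \<Longrightarrow> f + g \<in> fcycles G N n"
  by (simp add: fcycles_def fchains_add coord_bd_add)

lemma comm_group_homology: "comm_group (homology G N n)"
proof (rule comm_groupI)
  fix x assume "x \<in> carrier (homology G N n)"
  then obtain f where f: "f \<in> fcycles G N n" "x = coord_class G N n f" by (auto simp: carrier_homology)
  then show "\<exists>y\<in>carrier (homology G N n). y \<otimes>\<^bsub>homology G N n\<^esub> x = \<one>\<^bsub>homology G N n\<^esub>"
    using fcycles_diff[OF fcycles_zero f(1)]
    by (intro bexI[of _ "coord_class G N n (0 - f)"])
      (auto simp: carrier_homology mult_homology fcycles_fchains one_homology)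
qed (auto simp: carrier_homology mult_homology fcycles_fchains fcycles_add fcycles_zero one_homology add_ac fchains_add)

lemma int_pow_homology:
  assumes "f \<in> fcycles G N n"
  shows "coord_class G N n f [^]\<^bsub>homology G N n\<^esub> (k::int) = coord_class G N n (zscale k f)"
proof -
  interpret H: comm_group "homology G N n" by (rule comm_group_homology)
  have c: "coord_class G N n g \<in> carrier (homology G N n)" if "g \<in> fcycles G N n" for g
    using that by (simp add: carrier_homology)
  have z: "zscale k f \<in> fcycles G N n" for k
    using assms by (intro zscale_closed fcycles_zero fcycles_diff)
  have step: "coord_class G N n (zscale k f) \<otimes>\<^bsub>homology G N n\<^esub> coord_class G N n f = coord_class G N n (zscale (k + 1) f)" for k
    using assms z by (simp add: mult_homology fcycles_fchains zscale_add_left)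
  have pow: "x [^]\<^bsub>homology G N n\<^esub> (k + 1) = x [^]\<^bsub>homology G N n\<^esub> k \<otimes>\<^bsub>homology G N n\<^esub> x"
    if "x \<in> carrier (homology G N n)" for x and k :: int
    using that by (simp add: H.int_pow_mult)
  show ?thesis
  proof (induction k rule: int_induct[of _ 0])
    case base
    then show ?case by (simp add: one_homology)
  next
    case (step1 i)
    then show ?case using pow[OF c[OF assms]] step by simp
  next
    case (step2 i)
    then have "coord_class G N n f [^]\<^bsub>homology G N n\<^esub> (i - 1) \<otimes>\<^bsub>homology G N n\<^esub> coord_class G N n f
       = coord_class G N n (zscale (i - 1) f) \<otimes>\<^bsub>homology G N n\<^esub> coord_class G N n f"
      using pow[OF c[OF assms], of "i - 1"] step[of "i - 1"] by simp
    then show ?case using c z assms by simp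
  qed
qed

lemma finprod_homology:
  assumes "finite Q" "\<And>q. q \<in> Q \<Longrightarrow> f q \<in> fcycles G N n"
  shows "finprod (homology G N n) (\<lambda>q. coord_class G N n (f q)) Q = coord_class G N n (sum f Q)"
proof -
  interpret H: comm_group "homology G N n" by (rule comm_group_homology)
  have "sum f Q \<in> fcycles G N n \<and> ?thesis"
    using assms
  proof (induction Q rule: finite_induct)
    case empty
    then show ?case by (simp add: one_homology fcycles_zero)
  next
    case (insert q Q)
    then show ?case
      by (auto simp: carrier_homology mult_homology fcycles_fchains fcycles_add Pi_def)
  qed
  then show ?thesis ..
qed

end

section \<open>Homomorphisms of modules and the maps they induce\<close>

locale bar_hom = N: bar_module G N + N': bar_module G N'
  for G :: "('g, 'b) monoid_scheme" (structure) and N :: "('n::ab_group_add, 'g) gmodule"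
    and N' :: "('n2::ab_group_add, 'g) gmodule" +
  fixes h :: "'n \<Rightarrow> 'n2"
  assumes additive_hom: "Modules.additive h"
    and hom_closed: "m \<in> carrier N \<Longrightarrow> h m \<in> carrier N'"
    and hom_act: "g \<in> carrier G \<Longrightarrow> m \<in> carrier N \<Longrightarrow> h (act N g m) = act N' g (h m)"
begin

lemma hom_zero [simp]: "h 0 = 0"
  by (rule Modules.additive.zero[OF additive_hom])

lemmas coord_map_add = Modules.additive.add[OF additive_coord_map[OF additive_hom]]
lemmas coord_map_diff = Modules.additive.diff[OF additive_coord_map[OF additive_hom]]
lemmas coord_map_zero = Modules.additive.zero[OF additive_coord_map[OF additive_hom]]

lemma coord_map_closed:
  assumes "f \<in> fchains G N n" shows "coord_map h f \<in> fchains G N' n"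
proof -
  have "Poly_Mapping.keys (coord_map h f) \<subseteq> Poly_Mapping.keys f"
    by (auto simp: in_keys_iff lookup_coord_map)
  then show ?thesis using assms by (auto simp: fchains_def lookup_coord_map hom_closed)
qed

lemma coords_elt_hom:
  assumes "b \<in> carrier (bar_res G n)" "m \<in> carrier N"
  shows "coords_elt G N' b (h m) = coord_map h (coords_elt G N b m)"
proof -
  have "Poly_Mapping.keys b \<subseteq> carrier G \<times> bar_basis G n"
    using assms by (simp add: carrier_bar_res)
  then show ?thesis
    by (rule frag_extend_eq_additive[OF _ additive_coords_elt_left
          additive_compose[OF additive_coord_map[OF additive_hom] additive_coords_elt_left]])
      (use assms in \<open>auto simp: coord_map_single hom_act\<close>)
qed

lemma coord_bd_hom:
  assumes "f \<in> fchains G N (Suc n)"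
  shows "coord_bd G N' (coord_map h f) = coord_map h (coord_bd G N f)"
proof (rule additive_ext[of "\<lambda>f. coord_bd G N' (coord_map h f)" "\<lambda>f. coord_map h (coord_bd G N f)"])
  fix gs assume "gs \<in> Poly_Mapping.keys f"
  then show "coord_bd G N' (coord_map h (Poly_Mapping.single gs (Poly_Mapping.lookup f gs)))
      = coord_map h (coord_bd G N (Poly_Mapping.single gs (Poly_Mapping.lookup f gs)))"
    using assms by (auto simp: fchains_def coord_map_single N.coord_bd_single N'.coord_bd_single
        intro!: coords_elt_hom N.bar_bd_symbol_closed)
qed (intro additive_compose[OF N'.additive_coord_bd] additive_coord_map additive_hom
    additive_compose[OF additive_coord_map[OF additive_hom]] N.additive_coord_bd)+

lemma coeff_map_eq:
  assumes "f \<in> fchains G N n"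
  shows "coeff_map G N' n h (of_coords G N n f) = of_coords G N' n (coord_map h f)"
  unfolding coeff_map_def
  by (rule tensor_map_eq[OF N.bar_module_axioms N'.bar_module_axioms assms additive_coord_map[OF additive_hom]])
    (simp add: hom_closed coords_elt_hom)

lemma homology_map_eq:
  assumes "f \<in> fchains G N n"
  shows "homology_map G N' n h (coord_class G N n f) = coord_class G N' n (coord_map h f)"
proof -
  have c: "coeff_map G N' n h ` coord_class G N n f
     = (\<lambda>t. of_coords G N' n (coord_map h f + coord_bd G N' (coord_map h t))) ` fchains G N (Suc n)"
    unfolding coord_class_def image_image
    using assms by (intro image_cong refl)
      (simp add: coeff_map_eq N.fchains_add N.coord_bd_closed coord_map_add coord_bd_hom)
  have m: "of_coords G N' n (coord_bd G N' s) \<otimes>\<^bsub>chains G N' n\<^esub> of_coords G N' n (coord_map h f + coord_bd G N' (coord_map h t))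
     = of_coords G N' n (coord_map h f + coord_bd G N' (s + coord_map h t))"
    if "s \<in> fchains G N' (Suc n)" "t \<in> fchains G N (Suc n)" for s t
    using that assms by (simp add: N'.mult_chains N'.fchains_add N'.coord_bd_closed coord_map_closed N'.coord_bd_add add_ac)
  have "of_coords G N' n (coord_map h f + coord_bd G N' t) \<in> homology_map G N' n h (coord_class G N n f)"
    if "t \<in> fchains G N' (Suc n)" for t
    unfolding homology_map_def c N'.boundaries_eq set_mult_def
    using m[OF that N.fchains_zero] that N.fchains_zero
    by (force simp: coord_map_zero coord_class_def)
  moreover have "of_coords G N' n (coord_bd G N' s) \<otimes>\<^bsub>chains G N' n\<^esub> of_coords G N' n (coord_map h f + coord_bd G N' (coord_map h t))
      \<in> coord_class G N' n (coord_map h f)"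
    if "s \<in> fchains G N' (Suc n)" "t \<in> fchains G N (Suc n)" for s t
    unfolding m[OF that] coord_class_def using that by (auto intro: N'.fchains_add coord_map_closed)
  ultimately show ?thesis
    unfolding homology_map_def c
    by (auto simp: set_mult_def N'.boundaries_eq coord_class_def)
qed

lemma coord_map_cycle: "f \<in> fcycles G N n \<Longrightarrow> coord_map h f \<in> fcycles G N' n"
  by (cases n) (auto simp: fcycles_def coord_map_closed coord_bd_hom coord_map_zero)

lemma coord_map_surj:
  assumes "h ` carrier N = carrier N'" "f \<in> fchains G N' n"
  obtains f' where "f' \<in> fchains G N n" "coord_map h f' = f"
proof -
  define pre where "pre = inv_into (carrier N) h"
  have pre: "pre m \<in> carrier N" "h (pre m) = m" if "m \<in> carrier N'" for m
    using that assms(1) by (auto simp: pre_def f_inv_into_f inv_into_into)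
  show thesis
  proof
    show "psum (\<lambda>gs m. Poly_Mapping.single gs (pre m)) f \<in> fchains G N n"
      unfolding psum_def using assms(2) pre by (intro N.fchains_sum N.fchains_single) (auto simp: fchains_def)
    have "coord_map h (psum (\<lambda>gs m. Poly_Mapping.single gs (pre m)) f) = psum Poly_Mapping.single f"
      unfolding psum_def Modules.additive.sum[OF additive_coord_map[OF additive_hom]]
      using assms(2) pre by (intro sum.cong refl) (auto simp: coord_map_single fchains_def)
    then show "coord_map h (psum (\<lambda>gs m. Poly_Mapping.single gs (pre m)) f) = f"
      by (simp add: psum_single_self)
  qed
qed

end

section \<open>Connecting homomorphisms\<close>

lemma bar_hom_inclusion:
  assumes "bar_module G N'" "bar_module G N" "carrier N' \<subseteq> carrier N" "act N' = act N"
  shows "bar_hom G N' N (\<lambda>x. x)"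
  using assms unfolding bar_hom_def bar_hom_axioms_def by (auto intro: additive_id)

text \<open>\<open>S\<close> may be any set of chains. This allows the second connecting
  homomorphism to be applied to the output of the first before that output is known to be a homology
  class.\<close>

lemma connecting_eq:
  assumes p: "bar_hom G N N'' p" and N': "bar_module G N'" "carrier N' \<subseteq> carrier N" "act N' = act N"
    and S: "S \<subseteq> fchains G N'' (Suc n)"
  shows "connecting G N' N N'' p n (of_coords G N'' (Suc n) ` S)
    = of_coords G N' n ` {z \<in> fcycles G N' n. \<exists>c \<in> fchains G N (Suc n). coord_map p c \<in> S \<and> coord_bd G N c = z}"
proof -
  interpret p: bar_hom G N N'' p by fact
  interpret N': bar_module G N' by fact
  interpret i: bar_hom G N' N "\<lambda>x. x"
    using bar_hom_inclusion[OF N'(1) p.N.bar_module_axioms N'(2,3)] .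
  have "of_coords G N'' (Suc n) (coord_map p c) \<in> of_coords G N'' (Suc n) ` S \<longleftrightarrow> coord_map p c \<in> S"
    if "c \<in> fchains G N (Suc n)" for c
    by (auto simp: p.N'.of_coords_inj[OF p.coord_map_closed[OF that]] image_iff)
  moreover have "of_coords G N n (coord_bd G N c) = of_coords G N n z \<longleftrightarrow> coord_bd G N c = z"
    if "c \<in> fchains G N (Suc n)" for c z
    using p.N.of_coords_inj[OF p.N.coord_bd_closed[OF that]] .
  ultimately show ?thesis
    unfolding connecting_def N'.cycles_eq p.N.carrier_chains
    by (auto simp: p.coeff_map_eq p.N.chain_bd_eq i.coeff_map_eq N'.fcycles_fchains coord_map_id
        intro!: imageI)
qed

text \<open>
  Exactness enters only through the modules: in coordinates, a lift, or a preimage under an inclusion,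
  is taken at each basis element separately.
\<close>

lemma connecting_connecting:
  assumes d: "bar_hom G M1 N0 d" and e: "bar_hom G M0 T e" and N1: "bar_module G N1"
    and carrier: "carrier N1 = {m \<in> carrier M1. d m = 0}" "carrier N0 = {m \<in> carrier M0. e m = 0}"
    and act: "act N1 = act M1" "act N0 = act M0"
    and surj: "d ` carrier M1 = carrier N0" "e ` carrier M0 = carrier T"
    and X: "X \<in> fchains G M0 2" and c: "c \<in> fchains G M1 1" "coord_map d c = coord_bd G M0 X"
  shows "coord_bd G M1 c \<in> fchains G N1 0"
    and "connecting G N1 M1 N0 d 0 (connecting G N0 M0 T e 1 (coord_class G T 2 (coord_map e X)))
      = coord_class G N1 0 (coord_bd G M1 c)"
proof -
  interpret d: bar_hom G M1 N0 d by fact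
  interpret e: bar_hom G M0 T e by fact
  interpret N1: bar_module G N1 by fact
  have sub: "carrier N1 \<subseteq> carrier M1" "carrier N0 \<subseteq> carrier M0" using carrier by auto
  have bd: "coord_bd G N1 = coord_bd G M1" "coord_bd G N0 = coord_bd G M0"
    using act by (auto intro: coord_bd_cong)
  have mono: "fchains G N1 n \<subseteq> fchains G M1 n" "fchains G N0 n \<subseteq> fchains G M0 n" for n
    using sub fchains_mono by blast+
  have ker_d: "f \<in> fchains G N1 n" if "f \<in> fchains G M1 n" "coord_map d f = 0" for f n
    using that lookup_coord_map[of d f, OF d.hom_zero] by (auto simp: fchains_def carrier(1))
  have ker_e: "f \<in> fchains G N0 n" if "f \<in> fchains G M0 n" "coord_map e f = 0" for f n
    using that lookup_coord_map[of e f, OF e.hom_zero] by (auto simp: fchains_def carrier(2))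
  have d_ker: "coord_map d f = 0" if "f \<in> fchains G N1 n" for f n
    using that by (intro poly_mapping_eqI) (auto simp: lookup_coord_map fchains_def carrier(1))
  have e_ker: "coord_map e f = 0" if "f \<in> fchains G N0 n" for f n
    using that by (intro poly_mapping_eqI) (auto simp: lookup_coord_map fchains_def carrier(2))
  have num: "Suc 0 = 1" "Suc 1 = 2" "Suc 2 = 3" by simp_all
  have c': "c \<in> fchains G M1 (Suc 0)" using c by simp
  have dc: "coord_map d c \<in> fchains G N0 1" using d.coord_map_closed c(1) .
  let ?z = "coord_bd G M1 c"
  have cyc: "coord_bd G N0 (coord_map d c) = 0"
    using e.N.coord_bd_bd_2[OF X] c(2) bd by simp
  show z: "?z \<in> fchains G N1 0"
    using d.coord_bd_hom[OF c'] cyc by (intro ker_d d.N.coord_bd_closed c') simp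
  let ?S = "(\<lambda>t. coord_map e X + coord_bd G T t) ` fchains G T 3"
  have eX: "coord_map e X \<in> fchains G T 2" by (rule e.coord_map_closed[OF X])
  define U where "U = {z \<in> fcycles G N0 1. \<exists>c \<in> fchains G M0 2. coord_map e c \<in> ?S \<and> coord_bd G M0 c = z}"
  have 1: "connecting G N0 M0 T e 1 (coord_class G T 2 (coord_map e X)) = of_coords G N0 1 ` U"
    using connecting_eq[OF e d.N'.bar_module_axioms sub(2) act(2), of ?S 1] eX e.N'.coord_bd_closed[of _ 2]
    unfolding num coord_class_def U_def by (simp add: image_image e.N'.fchains_add image_subset_iff)
  let ?V = "{z \<in> fcycles G N1 0. \<exists>c \<in> fchains G M1 1. coord_map d c \<in> U \<and> coord_bd G M1 c = z}"
  have "U \<subseteq> fchains G N0 1" by (auto simp: U_def d.N'.fcycles_fchains)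
  with connecting_eq[OF d N1 sub(1) act(1), of U 0]
  have 0: "connecting G N1 M1 N0 d 0 (of_coords G N0 1 ` U) = of_coords G N1 0 ` ?V"
    unfolding num by blast
  have "?V = (\<lambda>t. ?z + coord_bd G N1 t) ` fchains G N1 1"
  proof (intro equalityI subsetI)
    fix y assume "y \<in> (\<lambda>t. ?z + coord_bd G N1 t) ` fchains G N1 1"
    then obtain t where t: "t \<in> fchains G N1 1" "y = ?z + coord_bd G N1 t" by blast
    \<comment> \<open>\<open>X\<close> itself is a lift of a representative (the one with
      \<open>t = 0\<close>), and adding \<open>t\<close> to \<open>c\<close> does not change its
      image under \<open>d\<close>.\<close>
    have "coord_map e X = coord_map e X + coord_bd G T 0" by (simp add: e.N'.coord_bd_zero)
    then have "coord_map e X \<in> ?S" using e.N'.fchains_zero by blast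
    then have "coord_map d c \<in> U"
      using dc cyc X c(2) by (auto simp: U_def fcycles_def)
    moreover have "coord_map d (c + t) = coord_map d c"
      using d_ker[OF t(1)] by (simp add: d.coord_map_add)
    moreover have "c + t \<in> fchains G M1 1" "coord_bd G M1 (c + t) = y"
      using c(1) t mono by (auto intro!: d.N.fchains_add simp: bd d.N.coord_bd_add)
    moreover have "y \<in> fcycles G N1 0"
      using t z N1.coord_bd_closed[of t 0] by (simp add: fcycles_def N1.fchains_add)
    ultimately show "y \<in> ?V" by (intro CollectI conjI bexI[of _ "c + t"]) simp_all
  next
    fix y assume "y \<in> ?V"
    then obtain c1 X1 t where y: "c1 \<in> fchains G M1 1" "coord_bd G M1 c1 = y"
      and X1: "X1 \<in> fchains G M0 2" "coord_map e X1 = coord_map e X + coord_bd G T t" "coord_bd G M0 X1 = coord_map d c1"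
      and t: "t \<in> fchains G T 3"
      by (auto simp: U_def)
    \<comment> \<open>Another representative of the class differs by the boundary of
      \<open>t\<close>. Lifting \<open>t\<close> and subtracting the boundary of the lift makes
      \<open>X1\<close> and \<open>X\<close> agree in \<open>T\<close>, so that \<open>?r\<close>
      has coefficients in \<open>N0\<close>.\<close>
    obtain s where s: "s \<in> fchains G M0 3" "coord_map e s = t"
      using e.coord_map_surj[OF surj(2) t] .
    have bs: "coord_bd G M0 s \<in> fchains G M0 2" "coord_map e (coord_bd G M0 s) = coord_bd G T t"
      using s e.N.coord_bd_closed[of s 2] e.coord_bd_hom[of s 2] by auto
    let ?r = "X1 - X - coord_bd G M0 s"
    have r: "?r \<in> fchains G N0 2"
      using X X1 bs by (intro ker_e) (auto simp: e.N.fchains_diff e.coord_map_diff)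
    \<comment> \<open>By surjectivity of \<open>d\<close> the discrepancy \<open>?r\<close> comes
      from \<open>M1\<close>. Correcting \<open>c1\<close> by the boundary of \<open>q\<close>
      leaves a chain killed by \<open>d\<close>, and the correction has boundary 0.\<close>
    obtain q where q: "q \<in> fchains G M1 2" "coord_map d q = ?r"
      using d.coord_map_surj[OF surj(1) r] .
    have bq: "coord_bd G M1 q \<in> fchains G M1 1" "coord_map d (coord_bd G M1 q) = coord_bd G N0 ?r"
      using q d.N.coord_bd_closed[of q 1, unfolded num] d.coord_bd_hom[of q 1, unfolded num] by simp_all
    let ?k = "c1 - c - coord_bd G M1 q"
    have "coord_bd G N0 ?r = coord_map d c1 - coord_map d c"
      using X1(3) c(2) e.N.coord_bd_bd_3[OF s(1)] by (simp add: bd e.N.coord_bd_diff)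
    then have "?k \<in> fchains G N1 1"
      using y c bq by (intro ker_d) (auto simp: d.N.fchains_diff d.coord_map_diff)
    moreover have "y = ?z + coord_bd G N1 ?k"
      using y(2) d.N.coord_bd_bd_2[OF q(1)] by (simp add: bd d.N.coord_bd_diff)
    ultimately show "y \<in> (\<lambda>t. ?z + coord_bd G N1 t) ` fchains G N1 1" by blast
  qed
  then show "connecting G N1 M1 N0 d 0 (connecting G N0 M0 T e 1 (coord_class G T 2 (coord_map e X)))
      = coord_class G N1 0 ?z"
    unfolding 1 0 by (simp add: coord_class_def image_image)
qed

section \<open>Matrices\<close>

lemma mat2_nth [simp]:
  "mat2 p q r s $ 1 $ 1 = p" "mat2 p q r s $ 1 $ 2 = q" "mat2 p q r s $ 2 $ 1 = r" "mat2 p q r s $ 2 $ 2 = s"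
  by (simp_all add: mat2_def)

lemma mat2_eqI: "p = p' \<Longrightarrow> q = q' \<Longrightarrow> r = r' \<Longrightarrow> s = s' \<Longrightarrow> mat2 p q r s = mat2 p' q' r' s'"
  by simp

lemma mat2_mult:
  "mat2 p q r s ** mat2 p' q' r' s' = mat2 (p * p' + q * r') (p * q' + q * s') (r * p' + s * r') (r * q' + s * s')"
  by (simp add: vec_eq_iff forall_2 matrix_matrix_mult_def sum_2)

lemma mat_1_mat2: "(mat 1 :: 'a::comm_ring_1^2^2) = mat2 1 0 0 1"
  by (simp add: vec_eq_iff forall_2 mat_def)

lemma mat2_vector: "mat2 p q r s *v vector [x, y] = vector [p * x + q * y, r * x + s * y]"
  by (simp add: vec_eq_iff forall_2 matrix_vector_mult_def sum_2)

lemma uinv_eqI: "x * y = 1 \<Longrightarrow> uinv x = (y::'a::comm_ring_1)"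
  unfolding uinv_def
  by (rule the_equality) (simp_all, metis mult.commute mult.left_commute mult_1_right)

lemma uinv_right: "x dvd 1 \<Longrightarrow> x * uinv x = (1::'a::comm_ring_1)"
  using uinv_eqI by (metis dvdE)

lemma uinv_left: "x dvd 1 \<Longrightarrow> uinv x * x = (1::'a::comm_ring_1)"
  by (simp add: uinv_right mult.commute)

lemma uinv_dvd: "x dvd 1 \<Longrightarrow> uinv x dvd (1::'a::comm_ring_1)"
  by (metis uinv_left dvdI)

lemma uinv_uinv: "x dvd 1 \<Longrightarrow> uinv (uinv x) = (x::'a::comm_ring_1)"
  by (rule uinv_eqI) (rule uinv_left)

lemma group_GL2: "group (GL2 :: ('a::comm_ring_1^2^2) monoid)"
proof (rule groupI)
  fix A :: "'a^2^2" assume "A \<in> carrier GL2"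
  then obtain B where "A ** B = mat 1" "B ** A = mat 1"
    by (auto simp: GL2_def invertible_def)
  then show "\<exists>B\<in>carrier GL2. B \<otimes>\<^bsub>GL2\<^esub> A = \<one>\<^bsub>GL2\<^esub>"
    by (intro bexI[of _ B]) (auto simp: GL2_def invertible_def)
qed (auto simp: GL2_def matrix_mul_assoc invertible_mult, auto simp: invertible_def)

lemma mult_GL2 [simp]: "monoid.mult GL2 = (**)"
  by (simp add: GL2_def)

lemma one_GL2 [simp]: "\<one>\<^bsub>GL2\<^esub> = mat 1"
  by (simp add: GL2_def)

lemma mat2_GL2:
  fixes p q r s u :: "'a::comm_ring_1"
  assumes "(p * s - q * r) * u = 1"
  shows "mat2 p q r s \<in> carrier GL2"
proof -
  let ?B = "mat2 (s * u) (- q * u) (- r * u) (p * u)"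
  have "mat2 p q r s ** ?B = mat 1" "?B ** mat2 p q r s = mat 1"
    unfolding mat2_mult mat_1_mat2 using assms by (auto intro!: mat2_eqI simp: algebra_simps)
  then show ?thesis by (auto simp: GL2_def invertible_def)
qed

section \<open>Elements of \<open>E2\<close> and \<open>GE2\<close> and their inverses\<close>

lemma group_E2: "group E2"
  unfolding E2_def by (rule group.group_subgroup_generated[OF group_GL2])

lemma group_GE2: "group GE2"
  unfolding GE2_def by (rule group.group_subgroup_generated[OF group_GL2])

lemma mult_E2 [simp]: "monoid.mult E2 = (**)" and one_E2 [simp]: "\<one>\<^bsub>E2\<^esub> = mat 1"
  by (simp_all add: E2_def)

lemma mult_GE2 [simp]: "monoid.mult GE2 = (**)" and one_GE2 [simp]: "\<one>\<^bsub>GE2\<^esub> = mat 1"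
  by (simp_all add: GE2_def)

lemma E2_subset_GE2: "carrier E2 \<subseteq> carrier GE2"
  unfolding E2_def GE2_def carrier_subgroup_generated
  by (rule group.mono_generate[OF group_GL2]) blast

lemma GE2_subset_GL2: "carrier GE2 \<subseteq> carrier GL2"
  unfolding GE2_def by (rule group.carrier_subgroup_generated_subset[OF group_GL2])

lemma E2_mult_closed: "A \<in> carrier E2 \<Longrightarrow> B \<in> carrier E2 \<Longrightarrow> A ** B \<in> carrier E2"
  using monoid.m_closed[OF group.is_monoid[OF group_E2], of A B] by simp

lemma inv_E2_eqI: "A \<in> carrier E2 \<Longrightarrow> B \<in> carrier E2 \<Longrightarrow> B ** A = mat 1 \<Longrightarrow> inv\<^bsub>E2\<^esub> A = B"
  using group.inv_equality[OF group_E2, of B A] by simp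

lemma upper_E2: "mat2 1 x 0 1 \<in> carrier E2" and lower_E2: "mat2 1 0 x 1 \<in> carrier E2"
  unfolding E2_def carrier_subgroup_generated
  by (rule generate.incl, use mat2_GL2[of 1 1 x 0 1] mat2_GL2[of 1 1 0 x 1] in \<open>auto simp: elementary2_def\<close>)+

text \<open>The classical word upper, lower, upper for a Weyl element; two such elements multiply to
  a diagonal matrix.\<close>

lemma antidiagonal_E2:
  fixes z y :: "'a::comm_ring_1"
  assumes "z * y = 1" shows "mat2 0 z (- y) 0 \<in> carrier E2"
proof -
  have "mat2 1 z 0 1 ** mat2 1 0 (- y) 1 ** mat2 1 z 0 1 = mat2 0 z (- y) 0"
    unfolding mat2_mult using assms by (auto intro!: mat2_eqI simp: algebra_simps)
  then show ?thesis by (metis E2_mult_closed upper_E2 lower_E2)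
qed

lemma upper_triangular_E2:
  fixes z y x :: "'a::comm_ring_1"
  assumes "z * y = 1" shows "mat2 z x 0 y \<in> carrier E2"
proof -
  have yz: "y * z = 1" using assms by (simp add: mult.commute)
  \<comment> \<open>The first two factors give the diagonal matrix with entries \<open>z\<close>,
    \<open>y\<close>; the corner \<open>y * x\<close> of the third becomes
    \<open>z * y * x = x\<close>.\<close>
  have "mat2 0 z (- y) 0 ** mat2 0 (- 1) (- (- 1)) 0 ** mat2 1 (y * x) 0 1 = mat2 z x 0 y"
    unfolding mat2_mult using assms by (auto intro!: mat2_eqI simp: mult.assoc[symmetric])
  then show ?thesis
    by (metis E2_mult_closed upper_E2 antidiagonal_E2 assms mult_minus1 minus_minus)
qed

lemma inv_upper_triangular:
  fixes z y x :: "'a::comm_ring_1"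
  assumes "z * y = 1" shows "inv\<^bsub>E2\<^esub> (mat2 z x 0 y) = mat2 y (- x) 0 z"
proof (rule inv_E2_eqI)
  show "mat2 y (- x) 0 z ** mat2 z x 0 y = mat 1"
    unfolding mat2_mult mat_1_mat2 using assms by (auto intro!: mat2_eqI simp: mult.commute)
qed (use assms in \<open>auto intro: upper_triangular_E2 simp: mult.commute\<close>)

lemma mw_E2: "mw \<in> carrier E2" and inv_mw: "inv\<^bsub>E2\<^esub> mw = mat2 0 (- 1) 1 0"
  and inv_mw_E2: "mat2 0 (- 1) 1 0 \<in> carrier E2"
proof -
  show w: "mw \<in> carrier E2" using antidiagonal_E2[of 1 1] by (simp add: mw_def)
  show w': "mat2 0 (- 1) 1 0 \<in> carrier E2" using antidiagonal_E2[of "-1" "-1"] by simp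
  show "inv\<^bsub>E2\<^esub> mw = mat2 0 (- 1) 1 0"
    by (rule inv_E2_eqI[OF w w']) (simp add: mw_def mat2_mult mat_1_mat2)
qed

lemma mg_E2: "mg z \<in> carrier E2" and inv_mg: "inv\<^bsub>E2\<^esub> (mg z) = mat2 z (- 1) 1 0"
  and inv_mg_E2: "mat2 z (- 1) 1 0 \<in> carrier E2"
proof -
  have "mg z = mw ** mat2 1 (- z) 0 1" "mat2 z (- 1) 1 0 = mat2 1 z 0 1 ** mat2 0 (- 1) 1 0"
    by (simp_all add: mg_def mw_def mat2_mult)
  then show g: "mg z \<in> carrier E2" and g': "mat2 z (- 1) 1 0 \<in> carrier E2"
    by (simp_all add: E2_mult_closed upper_E2 mw_E2 inv_mw_E2)
  show "inv\<^bsub>E2\<^esub> (mg z) = mat2 z (- 1) 1 0"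
    by (rule inv_E2_eqI[OF g g']) (simp add: mg_def mat2_mult mat_1_mat2)
qed

lemma mh_pow_minus_2: "mh z [^]\<^bsub>E2\<^esub> (-2::int) = mat2 1 (- 2 * uinv z) 0 1"
proof -
  interpret group E2 by (rule group_E2)
  have h: "mh z \<in> carrier E2" by (simp add: mh_def upper_E2)
  have "mh z [^]\<^bsub>E2\<^esub> (-2::int) = inv\<^bsub>E2\<^esub> (mh z [^]\<^bsub>E2\<^esub> (1 + 1 ::int))"
    using int_pow_neg[OF h, of 2] by simp
  also have "\<dots> = inv\<^bsub>E2\<^esub> (mat2 1 (2 * uinv z) 0 1)"
    using h int_pow_mult[OF h, of 1 1] by (simp add: mh_def mat2_mult)
  finally show ?thesis by (simp add: inv_upper_triangular)
qed

section \<open>The boundary of the chains \<open>R\<^sub>z\<close>\<close>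

text \<open>Each symbol encodes a relation between matrices. With trivial coefficients,
  \<open>w g_z^-1\<close> and \<open>h_z^-1 D(z)^-1 w h_z^-1\<close> are the same lower triangular
  matrix, \<open>h_{z^-1} w^-1 = g_z^-1\<close> and \<open>D(z) h_z D(z)^-1 = h_{z^-1}\<close>; so
  the first seven symbols leave [w^-1] + [D(z)] - 3[h_z^-1]. The last four supply 3[h_z^-1]:
  doubling twice turns 4[h_z^-1] into [h_z^-4], and \<open>h_z^-4 = D(2) h_z^-1 D(2)^-1\<close> is
  homologous to one [h_z^-1]. This is where 2 being a unit enters.\<close>

lemma coord_bd_mR:
  fixes z :: "'a::comm_ring_1"
  assumes "bar_module E2 N" and unit: "z dvd 1" "(2::'a) dvd 1"
    and fixed: "\<And>p q s. p * s = 1 \<Longrightarrow> act N (mat2 p q 0 s) m = m"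
  shows "coord_bd E2 N (coords_elt E2 N (mR z) m) =
    symb E2 [inv\<^bsub>E2\<^esub> mw] m + symb E2 [mD z] m
    + symb E2 [inv\<^bsub>E2\<^esub> (mg z)] (act N (inv\<^bsub>E2\<^esub> mw) m - m) - symb E2 [inv\<^bsub>E2\<^esub> (mh z)] (act N (inv\<^bsub>E2\<^esub> mw) m - m)"
proof -
  interpret N: bar_module E2 N by fact
  define i where "i = uinv z"
  define j where "j = uinv (2::'a)"
  have i: "z * i = 1" "i * z = 1" using unit by (simp_all add: i_def uinv_right uinv_left)
  have j: "2 * j = 1" "j * 2 = 1" using unit by (simp_all add: j_def uinv_right uinv_left)
  let ?s = "\<lambda>A. symb E2 [A] m"
  have upper: "coord_bd E2 N (symb E2 [mat2 p q 0 s, B] m) = ?s B - ?s C + ?s (mat2 p q 0 s)"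
    if "p * s = 1" "B \<in> carrier E2" "mat2 p q 0 s ** B = C" for p q s B C
  proof -
    have "s * p = 1" using that(1) by (simp add: mult.commute)
    then show ?thesis
      using that by (simp add: N.coord_bd_symb2 upper_triangular_E2 inv_upper_triangular fixed)
  qed
  \<comment> \<open>Only \<open>w\<close> moves \<open>m\<close>. The deviation from the fixed case
    is split off, so that the remaining terms cancel as with trivial coefficients.\<close>
  have w: "coord_bd E2 N (symb E2 [mw, B] m) = symb E2 [B] (act N (inv\<^bsub>E2\<^esub> mw) m - m) + ?s B - ?s C + ?s mw"
    if "B \<in> carrier E2" "mw ** B = C" for B C
    using that by (simp add: N.coord_bd_symb2 mw_E2 symb_diff)
  have inv: "inv\<^bsub>E2\<^esub> (mh z) = mat2 1 (- i) 0 1" "inv\<^bsub>E2\<^esub> (mD z) = mat2 i 0 0 z" "inv\<^bsub>E2\<^esub> (mD 2) = mat2 j 0 0 2"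
    "mh (uinv z) = mat2 1 z 0 1" "mD z = mat2 z 0 0 i" "mh z = mat2 1 i 0 1" "mD 2 = mat2 2 0 0 j"
    using i j unit by (simp_all add: mh_def mD_def i_def[symmetric] j_def[symmetric] inv_upper_triangular)
      (simp_all add: i_def uinv_uinv)
  have D: "mat2 z 0 0 i \<in> carrier E2" "mat2 i 0 0 z \<in> carrier E2" "mat2 2 0 0 j \<in> carrier E2" "mat2 1 x 0 1 \<in> carrier E2" for x
    using i j by (simp_all add: upper_triangular_E2)
  have gi: "mat2 0 1 (- 1) i \<in> carrier E2" using mg_E2[of i] by (simp add: mg_def)
  have prods: "mat2 1 (- i) 0 1 ** mat2 i 0 0 z = mat2 i (- 1) 0 z"
      "mw ** mat2 1 (- i) 0 1 = mat2 0 1 (- 1) i"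
      "mat2 z 0 0 i ** mat2 1 i 0 1 = mat2 z 1 0 i"
      "mat2 2 0 0 j ** mat2 1 (- i) 0 1 ** mat2 j 0 0 2 = mat2 1 (- 4 * i) 0 1"
    using i j by (simp_all add: mat2_mult mw_def mult.assoc[symmetric])
  have 1: "coord_bd E2 N (symb E2 [mw, mat2 z (- 1) 1 0] m) = symb E2 [mat2 z (- 1) 1 0] (act N (inv\<^bsub>E2\<^esub> mw) m - m)
      + ?s (mat2 z (- 1) 1 0) - ?s (mat2 1 0 (- z) 1) + ?s mw"
    by (rule w) (simp_all add: inv_mg_E2 mw_def mat2_mult)
  have 2: "coord_bd E2 N (symb E2 [mw, mat2 1 (- i) 0 1] m) = symb E2 [mat2 1 (- i) 0 1] (act N (inv\<^bsub>E2\<^esub> mw) m - m)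
      + ?s (mat2 1 (- i) 0 1) - ?s (mat2 0 1 (- 1) i) + ?s mw"
    by (rule w) (simp_all add: upper_E2 mw_def mat2_mult)
  have 3: "coord_bd E2 N (symb E2 [mat2 i (- 1) 0 z, mat2 0 1 (- 1) i] m) =
      ?s (mat2 0 1 (- 1) i) - ?s (mat2 1 0 (- z) 1) + ?s (mat2 i (- 1) 0 z)"
    using i gi by (intro upper) (simp_all add: mat2_mult)
  have 4: "coord_bd E2 N (symb E2 [mat2 1 z 0 1, mat2 0 (- 1) 1 0] m) =
      ?s (mat2 0 (- 1) 1 0) - ?s (mat2 z (- 1) 1 0) + ?s (mat2 1 z 0 1)"
    by (intro upper) (simp_all add: mat2_mult inv_mw_E2)
  have 5: "coord_bd E2 N (symb E2 [mat2 1 (- i) 0 1, mat2 i 0 0 z] m) =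
      ?s (mat2 i 0 0 z) - ?s (mat2 i (- 1) 0 z) + ?s (mat2 1 (- i) 0 1)"
    using i D by (intro upper) (simp_all add: mat2_mult)
  have 6: "coord_bd E2 N (symb E2 [mat2 z 1 0 i, mat2 i 0 0 z] m) =
      ?s (mat2 i 0 0 z) - ?s (mat2 1 z 0 1) + ?s (mat2 z 1 0 i)"
    using i D by (intro upper) (simp_all add: mat2_mult)
  have 7: "coord_bd E2 N (symb E2 [mat2 z 1 0 i, mat2 1 (- i) 0 1] m) =
      ?s (mat2 1 (- i) 0 1) - ?s (mat2 z 0 0 i) + ?s (mat2 z 1 0 i)"
    using i D by (intro upper) (simp_all add: mat2_mult)
  have 8: "coord_bd E2 N (symb E2 [mat2 1 x 0 1, mat2 1 x 0 1] m) =
      ?s (mat2 1 x 0 1) - ?s (mat2 1 (2 * x) 0 1) + ?s (mat2 1 x 0 1)" for x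
    by (intro upper) (simp_all add: mat2_mult upper_E2)
  have 9: "coord_bd E2 N (symb E2 [mat2 1 (- 4 * i) 0 1, mat2 2 0 0 j] m) =
      ?s (mat2 2 0 0 j) - ?s (mat2 2 (- 2 * i) 0 j) + ?s (mat2 1 (- 4 * i) 0 1)"
  proof (intro upper D)
    have "4 * i * j = 2 * i * (2 * j)" by (simp add: mult_ac)
    also have "\<dots> = 2 * i" unfolding j by simp
    finally show "mat2 1 (- 4 * i) 0 1 ** mat2 2 0 0 j = mat2 2 (- 2 * i) 0 j"
      by (simp add: mat2_mult)
  qed simp
  have 10: "coord_bd E2 N (symb E2 [mat2 2 0 0 j, mat2 1 (- i) 0 1] m) =
      ?s (mat2 1 (- i) 0 1) - ?s (mat2 2 (- 2 * i) 0 j) + ?s (mat2 2 0 0 j)"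
    using j D by (intro upper) (simp_all add: mat2_mult)
  have two: "zscale 2 x = x + x" for x :: "('a^2^2) list \<Rightarrow>\<^sub>0 'b"
    using zscale_add_left[of 1 1 x] by simp
  show ?thesis
    \<comment> \<open>Inverses go first: unfolding \<open>mD z\<close> and \<open>mh z\<close> would
      destroy the patterns that the rules for their inverses match.\<close>
    unfolding mR_def inv_mg inv_mw mh_pow_minus_2 inv(1-4)
    unfolding inv(5-) i_def[symmetric] prods
      coords_elt_add_left coords_elt_diff_left coords_elt_cmul_left N.coords_bar_symbol two
      N.coord_bd_add N.coord_bd_diff 1 2 3 4 5 6 7 8 9 10
    by (simp add: symb_diff inv_mw)
qed

section \<open>The modules of lines\<close>

lemma bar_module_trivial: "group G \<Longrightarrow> bar_module G trivial_int"
  by (simp add: bar_module_def bar_module_axioms_def trivial_int_def)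

lemma scalar_commute: "A *v (c *s v) = c *s (A *v (v :: 'a::comm_ring_1^'n))"
  by (simp add: vec_eq_iff matrix_vector_mult_def vector_scalar_mult_def sum_distrib_left mult_ac)

lemma image_line: "(*v) A ` line v = line (A *v v)"
  by (simp add: line_def image_image scalar_commute)

lemma line_eqI:
  fixes u v :: "'a::comm_ring_1^2"
  assumes "x dvd 1" "u = x *s v" shows "line u = line v"
proof -
  have "c *s u = (c * x) *s v" "c *s v = (c * uinv x) *s u" for c
    using uinv_left[OF assms(1)] by (simp_all add: assms(2) vector_smult_assoc mult.assoc)
  then show ?thesis by (auto simp: line_def)
qed

lemma cols2_mult: "cols2 (A *v u) (A *v v) = A ** cols2 u v"
  by (simp add: cols2_def vec_eq_iff forall_2 matrix_matrix_mult_def matrix_vector_mult_def sum_2)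

lemma cols2_e1: "cols2 u v *v vector [1, 0] = u"
  by (simp add: cols2_def mat2_vector vec_eq_iff forall_2)

lemma cols2_vector: "cols2 (vector [p, r]) (vector [q, s]) = mat2 p q r s"
  by (simp add: cols2_def)

section \<open>The action on tuples of lines\<close>

lemma additive_Y_act: "Modules.additive (Y_act A)"
  unfolding Y_act_def by (rule additive_frag_extend)

lemma Y_act_of [simp]: "Y_act A (frag_of ls) = frag_of (map ((`) ((*v) A)) ls)"
  by (simp add: Y_act_def)

lemma Y_act_one: "Y_act (mat 1) c = c"
  by (rule frag_extend_eq_additive[OF subset_UNIV additive_Y_act additive_id]) (simp add: map_idI)

lemma Y_act_mult: "Y_act (A ** B) c = Y_act A (Y_act B c)"
proof -
  have *: "(`) ((*v) (A ** B)) = (`) ((*v) A) \<circ> (`) ((*v) B)"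
    by (rule ext) (simp only: comp_apply image_image matrix_vector_mul_assoc)
  show ?thesis
    by (rule frag_extend_eq_additive[OF subset_UNIV additive_Y_act additive_compose[OF additive_Y_act additive_Y_act]])
      (simp add: *)
qed

lemma GE2_unimodular_act: "A \<in> carrier GE2 \<Longrightarrow> GE2_unimodular u \<Longrightarrow> GE2_unimodular (A *v u)"
  unfolding GE2_unimodular_def
  by (metis cols2_mult mult_GE2 monoid.m_closed group.is_monoid group_GE2)

text \<open>The group is \<open>GE2\<close> and not just \<open>E2\<close> because the connectedness
  argument also moves edges by diagonal generators.\<close>

lemma Y_tuples_act:
  assumes "A \<in> carrier GE2" "ls \<in> Y_tuples n" shows "map ((`) ((*v) A)) ls \<in> Y_tuples n"
proof -
  obtain vs where vs: "ls = map line vs" "length vs = n + 1" "\<forall>v \<in> set vs. GE2_unimodular v"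
    "\<forall>i < length vs. \<forall>j < length vs. i \<noteq> j \<longrightarrow> cols2 (vs ! i) (vs ! j) \<in> carrier GL2"
    using assms(2) by (auto simp: Y_tuples_def)
  have "map ((`) ((*v) A)) ls = map line (map ((*v) A) vs)"
    by (simp add: vs(1) image_line)
  moreover have "A ** B \<in> carrier GL2" if "B \<in> carrier GL2" for B
    using that assms(1) GE2_subset_GL2 monoid.m_closed[OF group.is_monoid[OF group_GL2], of A B] by auto
  ultimately show ?thesis
    unfolding Y_tuples_def using vs assms(1)
    by (intro CollectI exI[of _ "map ((*v) A) vs"]) (auto simp: GE2_unimodular_act cols2_mult)
qed

lemma carrier_Y: "c \<in> carrier (Y n) \<longleftrightarrow> Poly_Mapping.keys c \<subseteq> Y_tuples n"
  by (simp add: Y_def)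

lemma Y_diff: "c \<in> carrier (Y n) \<Longrightarrow> d \<in> carrier (Y n) \<Longrightarrow> c - d \<in> carrier (Y n)"
  by (auto simp: carrier_Y dest!: subsetD[OF keys_diff])

lemma Y_act_closed:
  assumes "A \<in> carrier GE2" "c \<in> carrier (Y n)" shows "Y_act A c \<in> carrier (Y n)"
proof -
  have "Poly_Mapping.keys c \<subseteq> Y_tuples n" using assms(2) by (simp add: carrier_Y)
  then show ?thesis
  proof (induction c rule: keys_induct)
    case (diff c d)
    then show ?case by (simp add: Modules.additive.diff[OF additive_Y_act] Y_diff)
  qed (use assms(1) in \<open>simp_all add: Modules.additive.zero[OF additive_Y_act] carrier_Y Y_tuples_act\<close>)
qed

lemma act_Y [simp]: "act (Y n) = Y_act"
  by (simp add: Y_def)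

lemma bar_module_Y: "bar_module E2 (Y n)"
  unfolding bar_module_def bar_module_axioms_def
  using group_E2 Y_act_closed E2_subset_GE2
  by (auto simp: Y_diff Y_act_one Y_act_mult Modules.additive.add[OF additive_Y_act], auto simp: Y_def)

section \<open>Boundary and augmentation of the complex of lines\<close>

lemma additive_Y_bd: "Modules.additive Y_bd"
  unfolding Y_bd_def by (rule additive_frag_extend)

lemma Y_bd_act: "Y_bd (Y_act A c) = Y_act A (Y_bd c)"
  by (rule frag_extend_eq_additive[OF subset_UNIV additive_compose[OF additive_Y_bd additive_Y_act]
        additive_compose[OF additive_Y_act additive_Y_bd]])
    (simp add: Y_bd_def Modules.additive.sum[OF additive_Y_act], 
     simp add: Y_act_def frag_extend_cmul take_map drop_map)

lemma Y_bd_2: "Y_bd (frag_of [x, y]) = frag_of [y] - frag_of [x]"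
  by (simp add: Y_bd_def eval_nat_numeral)

lemma Y_bd_3: "Y_bd (frag_of [x, y, z]) = frag_of [y, z] - frag_of [x, z] + frag_of [x, y]"
  by (simp add: Y_bd_def eval_nat_numeral)

lemma Y_aug_psum: "Y_aug = psum (\<lambda>_ k. k)"
  by (simp add: Y_aug_def psum_def fun_eq_iff)

lemma additive_Y_aug: "Modules.additive Y_aug"
  unfolding Y_aug_psum by (intro additive_psum additive_id)

lemma Y_aug_of [simp]: "Y_aug (frag_of ls) = 1"
  by (simp add: Y_aug_psum psum_single)

lemma Y_aug_act: "Y_aug (Y_act A c) = Y_aug c"
  by (rule frag_extend_eq_additive[OF subset_UNIV additive_compose[OF additive_Y_aug additive_Y_act] additive_Y_aug]) simp

lemma Y_tuples_0I: "GE2_unimodular u \<Longrightarrow> [line u] \<in> Y_tuples 0"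
  unfolding Y_tuples_def by (intro CollectI exI[of _ "[u]"]) simp

lemma Y_tuples_0E:
  assumes "ls \<in> Y_tuples 0" obtains u where "ls = [line u]" "GE2_unimodular u"
  using assms by (auto simp: Y_tuples_def length_Suc_conv)

lemma Y_tuples_1I:
  assumes "GE2_unimodular u" "GE2_unimodular v" "cols2 u v \<in> carrier GL2" "cols2 v u \<in> carrier GL2"
  shows "[line u, line v] \<in> Y_tuples 1"
  unfolding Y_tuples_def using assms
  by (intro CollectI exI[of _ "[u, v]"]) (auto simp: less_Suc_eq)

lemma Y_tuples_1E:
  assumes "ls \<in> Y_tuples 1"
  obtains u v where "ls = [line u, line v]" "GE2_unimodular u" "GE2_unimodular v"
proof -
  obtain vs where vs: "ls = map line vs" "length vs = Suc (Suc 0)" "\<forall>v \<in> set vs. GE2_unimodular v"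
    using assms by (auto simp: Y_tuples_def)
  then obtain u v where "vs = [u, v]" by (auto simp: length_Suc_conv)
  with vs that show thesis by simp
qed

lemma Y_tuples_2I:
  assumes "GE2_unimodular u" "GE2_unimodular v" "GE2_unimodular w"
    "cols2 u v \<in> carrier GL2" "cols2 v u \<in> carrier GL2" "cols2 u w \<in> carrier GL2" "cols2 w u \<in> carrier GL2"
    "cols2 v w \<in> carrier GL2" "cols2 w v \<in> carrier GL2"
  shows "[line u, line v, line w] \<in> Y_tuples 2"
  unfolding Y_tuples_def using assms
  by (intro CollectI exI[of _ "[u, v, w]"]) (auto simp: less_Suc_eq eval_nat_numeral)

lemma Y_tuples_2E:
  assumes "ls \<in> Y_tuples 2"
  obtains u v w where "ls = [line u, line v, line w]"
    "[line v, line w] \<in> Y_tuples 1" "[line u, line w] \<in> Y_tuples 1" "[line u, line v] \<in> Y_tuples 1"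
proof -
  obtain vs where vs: "ls = map line vs" "length vs = Suc (Suc (Suc 0))" "\<forall>v \<in> set vs. GE2_unimodular v"
    "\<forall>i < length vs. \<forall>j < length vs. i \<noteq> j \<longrightarrow> cols2 (vs ! i) (vs ! j) \<in> carrier GL2"
    using assms by (auto simp: Y_tuples_def)
  then obtain u v w where [simp]: "vs = [u, v, w]" by (auto simp: length_Suc_conv)
  note * = vs(4)[simplified, simplified All_less_Suc, simplified]
  have "[line v, line w] \<in> Y_tuples 1" "[line u, line w] \<in> Y_tuples 1" "[line u, line v] \<in> Y_tuples 1"
    by (rule Y_tuples_1I; use vs(3) * in simp)+
  with vs(1) that show thesis by simp
qed

lemma Y_bd_closed_1: "c \<in> carrier (Y 1) \<Longrightarrow> Y_bd c \<in> carrier (Y 0) \<and> Y_aug (Y_bd c) = 0"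
  unfolding carrier_Y[of _ 1]
proof (induction c rule: keys_induct)
  case (diff c d)
  then show ?case
    by (simp add: Modules.additive.diff[OF additive_Y_bd] Modules.additive.diff[OF additive_Y_aug] Y_diff)
next
  case (one ls)
  then show ?case
    by (elim Y_tuples_1E)
      (simp add: Y_bd_2 Modules.additive.diff[OF additive_Y_aug], intro Y_diff; simp add: carrier_Y Y_tuples_0I)
qed (simp add: Modules.additive.zero[OF additive_Y_bd] Modules.additive.zero[OF additive_Y_aug] carrier_Y)

lemma Y_bd_closed_2: "c \<in> carrier (Y 2) \<Longrightarrow> Y_bd c \<in> carrier (Y 1) \<and> Y_bd (Y_bd c) = 0"
  unfolding carrier_Y[of _ 2]
proof (induction c rule: keys_induct)
  case (diff c d)
  then show ?case
    by (simp add: Modules.additive.diff[OF additive_Y_bd] Y_diff)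
next
  case (one ls)
  then obtain u v w where ls: "ls = [line u, line v, line w]"
    "[line v, line w] \<in> Y_tuples 1" "[line u, line w] \<in> Y_tuples 1" "[line u, line v] \<in> Y_tuples 1"
    by (rule Y_tuples_2E)
  have "frag_of [line v, line w] - frag_of [line u, line w] - (0 - frag_of [line u, line v]) \<in> carrier (Y 1)"
    by (intro Y_diff) (use ls in \<open>simp_all add: carrier_Y\<close>)
  then show ?case
    by (simp add: ls(1) Y_bd_3 Y_bd_2 Modules.additive.diff[OF additive_Y_bd] Modules.additive.add[OF additive_Y_bd])
qed (simp add: Modules.additive.zero[OF additive_Y_bd] carrier_Y)

lemma one_Y [simp]: "one (Y n) = 0"
  by (simp add: Y_def)

lemma carrier_Z1Y: "carrier Z1Y = {c \<in> carrier (Y 1). Y_bd c = 0}"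
  by (simp add: Z1Y_def kernel_def)

lemma carrier_Z0Y: "carrier Z0Y = {c \<in> carrier (Y 0). Y_aug c = 0}"
  by (simp add: Z0Y_def kernel_def)

lemma act_Z1Y [simp]: "act Z1Y = Y_act" and act_Z0Y [simp]: "act Z0Y = Y_act"
  by (simp_all add: Z1Y_def Z0Y_def Y_def)

lemma bar_module_submodule:
  assumes N: "bar_module G N" and N': "monoid.mult N' = monoid.mult N" "one N' = one N" "act N' = act N"
    "carrier N' = {m \<in> carrier N. h m = 0}"
    and h: "Modules.additive h" "\<And>g m. g \<in> carrier G \<Longrightarrow> m \<in> carrier N \<Longrightarrow> h m = 0 \<Longrightarrow> h (act N g m) = 0"
  shows "bar_module G N'"
proof -
  interpret bar_module G N by fact
  show ?thesis
    by unfold_locales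
      (auto simp: N' mult_eq one_eq zero_closed diff_closed act_closed act_add act_one act_mult h
        Modules.additive.zero[OF h(1)] Modules.additive.diff[OF h(1)])
qed

lemma bar_module_Z1Y: "bar_module E2 Z1Y"
  by (rule bar_module_submodule[OF bar_module_Y _ _ _ carrier_Z1Y additive_Y_bd])
    (simp_all add: Z1Y_def Y_bd_act Modules.additive.zero[OF additive_Y_act])

lemma bar_module_Z0Y: "bar_module E2 Z0Y"
  by (rule bar_module_submodule[OF bar_module_Y _ _ _ carrier_Z0Y additive_Y_aug])
    (simp_all add: Z0Y_def Y_aug_act)

lemma bar_hom_Y_aug: "bar_hom E2 (Y 0) trivial_int Y_aug"
  unfolding bar_hom_def bar_hom_axioms_def
  by (auto simp: bar_module_Y bar_module_trivial group_E2 additive_Y_aug Y_aug_act, auto simp: trivial_int_def)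

lemma bar_hom_Y_bd_1: "bar_hom E2 (Y 1) (Y 0) Y_bd"
  unfolding bar_hom_def bar_hom_axioms_def
  by (auto simp: bar_module_Y additive_Y_bd Y_bd_act dest: Y_bd_closed_1[simplified])

text \<open>The map of \<open>bar_hom_Y_bd_1\<close> with the smaller target, onto which it is
  surjective; \<delta>_2 is defined by this version.\<close>

lemma bar_hom_Y_bd_Z0Y: "bar_hom E2 (Y 1) Z0Y Y_bd"
  unfolding bar_hom_def bar_hom_axioms_def
  by (auto simp: bar_module_Y bar_module_Z0Y additive_Y_bd Y_bd_act carrier_Z0Y dest: Y_bd_closed_1[simplified])

lemma bar_hom_Y_bd_Z1Y: "bar_hom E2 (Y 2) Z1Y Y_bd"
  unfolding bar_hom_def bar_hom_axioms_def
  by (auto simp: bar_module_Y bar_module_Z1Y additive_Y_bd Y_bd_act carrier_Z1Y dest: Y_bd_closed_2[simplified])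

section \<open>The lines \<infinity>, 0 and those spanned by \<open>e1 + x e2\<close>\<close>

lemma unimodular_units:
  "GE2_unimodular (vector [1, 0])" "GE2_unimodular (vector [0, 1])" "GE2_unimodular (vector [1, x])"
proof -
  have "cols2 (vector [1, 0]) (vector [0, 1]) \<in> carrier GE2"
    "cols2 (vector [0, 1]) (vector [- 1, 0]) \<in> carrier GE2" "cols2 (vector [1, x]) (vector [0, 1]) \<in> carrier GE2"
    unfolding cols2_vector using upper_E2[of 0] inv_mw_E2 lower_E2[of x] E2_subset_GE2 by auto
  then show "GE2_unimodular (vector [1, 0])" "GE2_unimodular (vector [0, 1])" "GE2_unimodular (vector [1, x])"
    by (auto simp: GE2_unimodular_def)
qed

text \<open>\<open>x\<close> is arbitrary here: e1 + x e2 and e2 have determinant 1, so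
  \<open>line_unit x\<close> is adjacent to 0 even if \<open>x\<close> is not a unit.\<close>

lemma infty_zero_Y1: "[line_infty, line_zero] \<in> Y_tuples 1"
  and unit_zero_Y1: "[line_unit x, line_zero] \<in> Y_tuples 1"
  unfolding line_infty_def line_zero_def line_unit_def
  by (rule Y_tuples_1I; (rule unimodular_units | simp add: cols2_vector mat2_GL2[of _ _ _ _ "1"] mat2_GL2[of _ _ _ _ "-1"]))+

text \<open>Adjacency to \<infinity> is what requires a unit, since e1 and e1 + x e2 have
  determinant \<open>x\<close>. Both orders of each pair are checked, hence the opposite
  signs.\<close>

lemma infty_zero_unit_Y2:
  assumes "x dvd (1::'a::comm_ring_1)" shows "[line_infty, line_zero, line_unit x] \<in> Y_tuples 2"
  unfolding line_infty_def line_zero_def line_unit_def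
  by (rule Y_tuples_2I; (rule unimodular_units | simp add: cols2_vector mat2_GL2[of _ _ _ _ "1"] mat2_GL2[of _ _ _ _ "-1"]
        mat2_GL2[of _ _ _ _ "uinv x"] mat2_GL2[of _ _ _ _ "- uinv x"] uinv_right assms))

lemma infty_Y0: "[line_infty] \<in> Y_tuples 0"
  unfolding line_infty_def by (intro Y_tuples_0I unimodular_units)

text \<open>
  Exactness at \<open>Y\<^sub>0\<close>: writing an element of \<open>GE\<^sub>2(A)\<close> as a product of generators joins its first column to
  \<open>\<infinity>\<close> by edges, because a generator moves \<open>\<infinity>\<close> at most to \<open>\<langle>e\<^sub>1 + x e\<^sub>2\<rangle>\<close>, which is adjacent to \<open>0\<close>.
\<close>

lemma GE2_connected:
  fixes A :: "'a::comm_ring_1^2^2"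
  assumes "A \<in> carrier GE2"
  shows "frag_of [line (A *v vector [1, 0])] - frag_of [line_infty] \<in> Y_bd ` carrier (Y 1)"
proof -
  let ?I = "Y_bd ` carrier (Y 1 :: ('a ychain, 'a^2^2) gmodule)"
  let ?e = "vector [1, 0] :: 'a^2"
  interpret GE: group "GE2 :: ('a^2^2) monoid" by (rule group_GE2)
  interpret GL: group "GL2 :: ('a^2^2) monoid" by (rule group_GL2)
  interpret Y1: bar_module E2 "Y 1 :: ('a ychain, 'a^2^2) gmodule" by (rule bar_module_Y)
  have zero: "0 \<in> ?I"
    using Y1.zero_closed Modules.additive.zero[OF additive_Y_bd] by (metis image_eqI)
  have diff: "c - d \<in> ?I" if "c \<in> ?I" "d \<in> ?I" for c d
    using that by (auto simp: Modules.additive.diff[OF additive_Y_bd, symmetric] intro!: imageI Y_diff)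
  have add: "c + d \<in> ?I" if "c \<in> ?I" "d \<in> ?I" for c d
    using diff[OF that(1) diff[OF zero that(2)]] by simp
  have stable: "Y_act B c \<in> ?I" if "B \<in> carrier GE2" "c \<in> ?I" for B c
    using that by (auto simp: Y_bd_act[symmetric] intro!: imageI Y_act_closed)
  \<comment> \<open>\<open>?d B\<close> is the difference of the ends of a path from \<infinity> to
    B\<infinity>. For a product the path of \<open>C\<close> is moved by \<open>B\<close> and
    appended to that of \<open>B\<close>.\<close>
  let ?d = "\<lambda>B. frag_of [line (B *v ?e)] - frag_of [line_infty]"
  have shift: "Y_act B (?d C) = frag_of [line ((B ** C) *v ?e)] - frag_of [line (B *v ?e)]" for B C
    by (simp add: Modules.additive.diff[OF additive_Y_act] image_line line_infty_def matrix_vector_mul_assoc)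
  have mult: "?d (B ** C) \<in> ?I" if "B \<in> carrier GE2" "?d B \<in> ?I" "?d C \<in> ?I" for B C
    using add[OF stable[OF that(1,3)] that(2)] unfolding shift by simp
  have gen: "?d B \<in> ?I" if B: "B \<in> elementary2 \<union> {mat2 x 0 0 y | x y. x dvd 1 \<and> y dvd 1}" for B
  proof (cases "\<exists>x. B = mat2 1 0 x 1")
    case True
    then obtain x where "B = mat2 1 0 x 1" by blast
    \<comment> \<open>The path runs from \<infinity> to \<open>line_unit x\<close> through their
      common neighbour 0.\<close>
    then have "?d B = Y_bd (frag_of [line_infty, line_zero] - frag_of [line_unit x, line_zero])"
      by (simp add: mat2_vector line_unit_def Modules.additive.diff[OF additive_Y_bd] Y_bd_2)
    then show ?thesis
      using infty_zero_Y1 unit_zero_Y1[of x] by (auto intro!: imageI Y_diff simp: carrier_Y)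
  next
    case False
    \<comment> \<open>All other generators are upper triangular and fix \<infinity>.\<close>
    then obtain p q s where "B = mat2 p q 0 s" "p dvd 1"
      using B by (auto simp: elementary2_def)
    then have "line (B *v ?e) = line_infty"
      unfolding line_infty_def by (intro line_eqI[of p]) (simp_all add: mat2_vector, simp add: vec_eq_iff forall_2)
    then show ?thesis using zero by simp
  qed
  have "A \<in> generate GL2 (carrier GL2 \<inter> (elementary2 \<union> {mat2 x 0 0 y | x y. x dvd 1 \<and> y dvd 1}))"
    using assms by (simp add: GE2_def carrier_subgroup_generated)
  \<comment> \<open>Membership in \<open>GE2\<close> is carried through the induction because
    \<open>stable\<close> asks for it in the inverse and product cases.\<close>
  then have "A \<in> carrier GE2 \<and> ?d A \<in> ?I"
  proof (induction rule: generate.induct)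
    case one
    then show ?case using zero GE.one_closed by (simp add: line_infty_def)
  next
    case (incl B)
    then show ?case using gen[of B] generate.incl[OF incl] by (auto simp: GE2_def carrier_subgroup_generated)
  next
    case (inv B)
    then have B: "B \<in> carrier GE2" "?d B \<in> ?I" and BL: "B \<in> carrier GL2"
      using gen[of B] generate.incl[OF inv] by (auto simp: GE2_def carrier_subgroup_generated)
    have inv: "inv\<^bsub>GL2\<^esub> B \<in> carrier GE2"
      using generate.inv[OF inv] by (simp add: GE2_def carrier_subgroup_generated)
    \<comment> \<open>The inverse moves the path from \<infinity> to B\<infinity> to one that ends
      in \<infinity>; it is traversed backwards.\<close>
    have "inv\<^bsub>GL2\<^esub> B ** B = mat 1" using GL.l_inv[OF BL] by simp
    then have "?d (inv\<^bsub>GL2\<^esub> B) = 0 - Y_act (inv\<^bsub>GL2\<^esub> B) (?d B)"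
      unfolding shift by (simp add: line_infty_def)
    then show ?case using diff[OF zero stable[OF inv B(2)]] inv by simp
  next
    case (eng B C)
    then show ?case using mult[of B C] GE.m_closed[of B C] by simp
  qed
  then show ?thesis by blast
qed

text \<open>Subtracting \<open>Y_aug c\<close> copies of \<infinity> gives a claim that is additive
  in \<open>c\<close>, so single lines suffice. A unimodular vector is the first column of a matrix
  in \<open>GE2\<close>, to which \<open>GE2_connected\<close> applies.\<close>

lemma Y_exact_0: "Y_bd ` carrier (Y 1) = carrier (Z0Y :: ('a::comm_ring_1 ychain, 'a^2^2) gmodule)"
proof (intro equalityI subsetI)
  fix c :: "'a ychain" assume c: "c \<in> carrier Z0Y"
  let ?I = "Y_bd ` carrier (Y 1 :: ('a ychain, 'a^2^2) gmodule)"
  have "Poly_Mapping.keys c \<subseteq> Y_tuples 0" using c by (simp add: carrier_Z0Y carrier_Y)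
  then have "c - frag_cmul (Y_aug c) (frag_of [line_infty]) \<in> ?I"
  proof (induction c rule: keys_induct)
    case zero
    have "Y_bd 0 \<in> ?I" by (intro imageI) (simp add: carrier_Y)
    then show ?case by (simp add: Modules.additive.zero[OF additive_Y_bd] Modules.additive.zero[OF additive_Y_aug])
  next
    case (diff c d)
    then obtain c' d' where "c' \<in> carrier (Y 1)" "d' \<in> carrier (Y 1)"
      "c - frag_cmul (Y_aug c) (frag_of [line_infty]) = Y_bd c'" "d - frag_cmul (Y_aug d) (frag_of [line_infty]) = Y_bd d'"
      by blast
    then have "c - d - frag_cmul (Y_aug (c - d)) (frag_of [line_infty]) = Y_bd (c' - d')" "c' - d' \<in> carrier (Y 1)"
      by (simp_all add: Modules.additive.diff[OF additive_Y_bd] Modules.additive.diff[OF additive_Y_aug]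
          frag_cmul_diff_distrib Y_diff algebra_simps)
    then show ?case by blast
  next
    case (one ls)
    then obtain u where u: "ls = [line u]" "GE2_unimodular u" by (rule Y_tuples_0E)
    then obtain v where "cols2 u v \<in> carrier GE2" by (auto simp: GE2_unimodular_def)
    from GE2_connected[OF this] show ?case unfolding u(1) cols2_e1 by simp
  qed
  then show "c \<in> ?I" using c by (simp add: carrier_Z0Y)
qed (auto simp: carrier_Z0Y dest: Y_bd_closed_1[simplified])

lemma Y_aug_surj: "Y_aug ` carrier (Y 0) = carrier trivial_int"
proof -
  have "k = Y_aug (frag_cmul k (frag_of [line_infty]))" for k
    by (cases "k = 0") (simp_all add: Y_aug_def keys_def lookup_frag_cmul)
  moreover have "frag_cmul k (frag_of [line_infty]) \<in> carrier (Y 0)" for k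
    using infty_Y0 by (auto simp: carrier_Y)
  ultimately show ?thesis unfolding trivial_int_def by auto
qed

section \<open>Square classes\<close>

lemma units_mult: "x dvd 1 \<Longrightarrow> y dvd 1 \<Longrightarrow> x * y dvd (1::'a::comm_ring_1)"
  using mult_dvd_mono[of x 1 y 1] by simp

lemma sq_class_eq: "sq_class a = {x ^ 2 * a | x. x dvd (1::'a::comm_ring_1)}"
  by (auto simp: sq_class_def r_coset_def unit_squares_def unit_group_def)

lemma sq_class_1: "\<one>\<^bsub>sq_classes\<^esub> = sq_class 1"
  by (auto simp: sq_classes_def sq_class_eq unit_squares_def)

lemma sq_class_mult:
  fixes a b :: "'a::comm_ring_1"
  shows "sq_class a \<otimes>\<^bsub>sq_classes\<^esub> sq_class b = sq_class (a * b)"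
proof -
  have m: "sq_class a \<otimes>\<^bsub>sq_classes\<^esub> sq_class b = {u * v | u v. u \<in> sq_class a \<and> v \<in> sq_class b}"
    by (auto simp: sq_classes_def set_mult_def unit_group_def)
  show ?thesis
    unfolding m
  proof (intro equalityI subsetI)
    fix t assume "t \<in> {u * v | u v. u \<in> sq_class a \<and> v \<in> sq_class b}"
    then obtain x y where t: "t = x ^ 2 * a * (y ^ 2 * b)" "x dvd 1" "y dvd 1"
      unfolding sq_class_eq by blast
    have "t = (x * y) ^ 2 * (a * b)"
      by (simp add: t(1) power_mult_distrib mult_ac)
    then show "t \<in> sq_class (a * b)"
      unfolding sq_class_eq using units_mult[OF t(2,3)] by blast
  next
    fix t assume "t \<in> sq_class (a * b)"
    then obtain x where x: "t = x ^ 2 * (a * b)" "x dvd 1" unfolding sq_class_eq by blast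
    have "t = (x ^ 2 * a) * (1 ^ 2 * b)" by (simp add: x(1) mult_ac)
    moreover have "x ^ 2 * a \<in> sq_class a" "1 ^ 2 * b \<in> sq_class b"
      unfolding sq_class_eq using x(2) dvd_refl[of "1::'a"] by blast+
    ultimately show "t \<in> {u * v | u v. u \<in> sq_class a \<and> v \<in> sq_class b}" by blast
  qed
qed

lemma pf_mult:
  "group_ring_mult sq_classes (pf a) (pf b) =
    frag_of (sq_class (a * b)) - frag_of (sq_class a) - frag_of (sq_class b) + frag_of (sq_class 1)"
  by (simp add: group_ring_mult_def pf_def sq_class_1 frag_extend_diff sq_class_mult)

section \<open>The triples (\<infinity>, 0, a) and their classes\<close>

definition flag :: "'a::comm_ring_1 \<Rightarrow> 'a ychain" where
  "flag a = frag_of [line_infty, line_zero, line_unit a]"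

lemma flag_Y2: "a dvd 1 \<Longrightarrow> flag a \<in> carrier (Y 2)"
  by (simp add: flag_def carrier_Y infty_zero_unit_Y2)

text \<open>D(x^-1) maps (\<infinity>, 0, a) to (\<infinity>, 0, x^2 a), so the two triples agree in
  the coinvariants. The summand \<open>f\<close> permits replacing one term of a sum at a
  time.\<close>

lemma flag_class:
  fixes a x :: "'a::comm_ring_1"
  assumes "a dvd 1" "x dvd 1"
  shows "coord_class E2 (Y 2) 0 (f + symb E2 [] (flag (x ^ 2 * a))) = coord_class E2 (Y 2) 0 (f + symb E2 [] (flag a))"
proof -
  interpret bar_module E2 "Y 2 :: ('a ychain, 'a^2^2) gmodule" by (rule bar_module_Y)
  let ?y = "uinv x"
  have x: "x * ?y = 1" "?y * x = 1" using assms(2) by (simp_all add: uinv_right uinv_left)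
  let ?A = "mat2 ?y 0 0 x"
  have act: "Y_act ?A (flag a) = flag (x ^ 2 * a)"
  proof -
    have "line (vector [?y, 0] :: 'a^2) = line_infty"
      unfolding line_infty_def by (rule line_eqI[of ?y]) (use assms in \<open>simp_all add: uinv_dvd vec_eq_iff forall_2\<close>)
    moreover have "line (vector [0, x] :: 'a^2) = line_zero"
      unfolding line_zero_def by (rule line_eqI[of x]) (use assms in \<open>simp_all add: vec_eq_iff forall_2\<close>)
    moreover have "line (vector [?y, x * a] :: 'a^2) = line_unit (x ^ 2 * a)"
      unfolding line_unit_def
    proof (rule line_eqI[of ?y])
      have "?y * (x ^ 2 * a) = (?y * x) * (x * a)" by (simp add: power2_eq_square mult_ac)
      then show "vector [?y, x * a] = ?y *s (vector [1, x ^ 2 * a] :: 'a^2)"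
        using x by (simp add: vec_eq_iff forall_2)
    qed (use assms uinv_dvd in auto)
    ultimately show ?thesis
      by (simp add: flag_def image_line mat2_vector line_infty_def line_zero_def line_unit_def)
  qed
  \<comment> \<open>The boundary of a symbol [g] acts by the inverse of g, so the bounding chain
    uses D(x) in order to act by D(x^-1).\<close>
  have A: "mat2 x 0 0 ?y \<in> carrier E2" "inv\<^bsub>E2\<^esub> (mat2 x 0 0 ?y) = ?A"
    using upper_triangular_E2[OF x(1)] inv_upper_triangular[OF x(1), of 0] by simp_all
  show ?thesis
  proof (rule coord_class_eqI)
    show "symb E2 [mat2 x 0 0 ?y] (flag a) \<in> fchains E2 (Y 2) (Suc 0)"
      using A flag_Y2[OF assms(1)] by (intro symb_closed) auto
    show "f + symb E2 [] (flag (x ^ 2 * a)) = f + symb E2 [] (flag a) + coord_bd E2 (Y 2) (symb E2 [mat2 x 0 0 ?y] (flag a))"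
      using A by (simp add: coord_bd_symb1 act)
  qed
qed

text \<open>Two obstacles arise. The square classes of \<open>ab\<close>, \<open>a\<close>,
  \<open>b\<close>, 1 may coincide, so the product over the support need not have four factors;
  reading it as \<open>fext\<close> restores additivity whatever coincides. And \<open>SOME\<close>
  picks an uncontrolled representative, which \<open>flag_class\<close> exchanges for the given
  one.\<close>

lemma sq_to_Y2_eq:
  fixes a b :: "'a::comm_ring_1"
  assumes "a dvd 1" "b dvd 1"
  shows "sq_to_Y2 (group_ring_mult sq_classes (pf a) (pf b))
    = coord_class E2 (Y 2) 0 (symb E2 [] (flag (a * b) - flag a - flag b + flag 1))"
proof -
  interpret bar_module E2 "Y 2 :: ('a ychain, 'a^2^2) gmodule" by (rule bar_module_Y)
  let ?r = "\<lambda>q :: 'a set. SOME a. a \<in> q"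
  let ?T = "\<lambda>q. symb E2 [] (flag (?r q))"
  let ?x = "group_ring_mult sq_classes (pf a) (pf b)"
  let ?Q = "sq_class ` {u :: 'a. u dvd 1}"
  have rep: "\<exists>x. x dvd 1 \<and> ?r (sq_class u) = x ^ 2 * u" for u :: 'a
  proof -
    have "1 ^ 2 * u \<in> sq_class u" unfolding sq_class_eq by (intro CollectI exI[of _ 1]) simp
    then have "?r (sq_class u) \<in> sq_class u" by (rule someI)
    then show ?thesis unfolding sq_class_eq by blast
  qed
  have unit: "?r q dvd 1" if q: "q \<in> ?Q" for q
  proof -
    obtain u where u: "q = sq_class u" "u dvd 1" using q by blast
    obtain x where "x dvd 1" "?r q = x ^ 2 * u" using rep[of u] u(1) by blast
    then show ?thesis using u(2) by (simp add: power2_eq_square units_mult)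
  qed
  have keys: "Poly_Mapping.keys ?x \<subseteq> ?Q"
  proof -
    have f: "Poly_Mapping.keys (frag_of (sq_class u)) \<subseteq> ?Q" if "u dvd 1" for u using that by simp
    have df: "Poly_Mapping.keys (c - d) \<subseteq> ?Q" if "Poly_Mapping.keys c \<subseteq> ?Q" "Poly_Mapping.keys d \<subseteq> ?Q" for c d :: "'a set \<Rightarrow>\<^sub>0 int"
      using order_trans[OF keys_diff Un_least[OF that]] .
    have ad: "Poly_Mapping.keys (c + d) \<subseteq> ?Q" if "Poly_Mapping.keys c \<subseteq> ?Q" "Poly_Mapping.keys d \<subseteq> ?Q" for c d :: "'a set \<Rightarrow>\<^sub>0 int"
      using order_trans[OF keys_add Un_least[OF that]] .
    show ?thesis
      unfolding pf_mult by (intro ad df f assms units_mult) simp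
  qed
  have cyc: "?T q \<in> fcycles E2 (Y 2) 0" if "q \<in> ?Q" for q
    using flag_Y2[OF unit[OF that]] by (auto simp: fcycles_def intro!: symb_closed)
  have cl: "coinv_class E2 (Y 2) (flag (?r q)) = coord_class E2 (Y 2) 0 (?T q)" if "q \<in> ?Q" for q
    using flag_Y2[OF unit[OF that]]
    by (simp add: coinv_class_def tensor_elt_eq bar_symbol_closed coords_bar_symbol hclass_eq symb_closed)
  interpret H: comm_group "homology E2 (Y 2 :: ('a ychain, 'a^2^2) gmodule) 0" by (rule comm_group_homology)
  have z: "zscale k (?T q) \<in> fcycles E2 (Y 2) 0" if "q \<in> ?Q" for q k
    using cyc[OF that] by (intro zscale_closed fcycles_zero fcycles_diff)
  have "sq_to_Y2 ?x = finprod (homology E2 (Y 2) 0)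
     (\<lambda>q. coord_class E2 (Y 2) 0 (zscale (Poly_Mapping.lookup ?x q) (?T q))) (Poly_Mapping.keys ?x)"
    unfolding sq_to_Y2_def flag_def[symmetric]
    using keys z by (intro H.finprod_cong')
      (auto simp: carrier_homology int_pow_homology[OF cyc] cl)
  also have "\<dots> = coord_class E2 (Y 2) 0 (\<Sum>q\<in>Poly_Mapping.keys ?x. zscale (Poly_Mapping.lookup ?x q) (?T q))"
    using keys z by (intro finprod_homology) auto
  also have "(\<Sum>q\<in>Poly_Mapping.keys ?x. zscale (Poly_Mapping.lookup ?x q) (?T q)) = fext ?T ?x"
    by (simp add: fext_def psum_def)
  also have "\<dots> = ?T (sq_class (a * b)) - ?T (sq_class a) - ?T (sq_class b) + ?T (sq_class 1)"
    by (simp add: pf_mult fext_add fext_diff)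
  also have "coord_class E2 (Y 2) 0 \<dots> = coord_class E2 (Y 2) 0 (symb E2 [] (flag (a * b) - flag a - flag b + flag 1))"
  proof -
    have swap: "coord_class E2 (Y 2) 0 (f + ?T (sq_class u)) = coord_class E2 (Y 2) 0 (f + symb E2 [] (flag u))"
      if "u dvd 1" for f u
      using rep[of u] flag_class[OF that] by metis
    \<comment> \<open>Adding either term to \<open>f - ?T (sq_class u) - symb E2 [] (flag u)\<close>
      leaves \<open>f\<close> minus the other one, so \<open>swap\<close> also covers
      subtraction.\<close>
    have swap': "coord_class E2 (Y 2) 0 (f - ?T (sq_class u)) = coord_class E2 (Y 2) 0 (f - symb E2 [] (flag u))"
      if "u dvd 1" for f u
      using swap[OF that, of "f - ?T (sq_class u) - symb E2 [] (flag u)"] by (simp add: algebra_simps)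
    let ?s = "\<lambda>u. symb E2 [] (flag u)"
    have "coord_class E2 (Y 2) 0 (?T (sq_class (a * b)) - ?T (sq_class a) - ?T (sq_class b) + ?T (sq_class 1))
      = coord_class E2 (Y 2) 0 (?T (sq_class (a * b)) - ?T (sq_class a) - ?T (sq_class b) + ?s 1)"
      by (rule swap) simp
    also have "\<dots> = coord_class E2 (Y 2) 0 (?T (sq_class (a * b)) - ?T (sq_class a) + ?s 1 - ?s b)"
      using swap'[OF assms(2), of "?T (sq_class (a * b)) - ?T (sq_class a) + ?s 1"] by (simp add: algebra_simps)
    also have "\<dots> = coord_class E2 (Y 2) 0 (?T (sq_class (a * b)) + ?s 1 - ?s b - ?s a)"
      using swap'[OF assms(1), of "?T (sq_class (a * b)) + ?s 1 - ?s b"] by (simp add: algebra_simps)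
    also have "\<dots> = coord_class E2 (Y 2) 0 (?s 1 - ?s b - ?s a + ?s (a * b))"
      using swap[OF units_mult[OF assms], of "?s 1 - ?s b - ?s a"] by (simp add: algebra_simps)
    finally show ?thesis
      by (simp add: Modules.additive.add[OF additive_symb] symb_diff algebra_simps)
  qed
  finally show ?thesis .
qed

lemma sq_to_GW_eq:
  fixes a b :: "'a::comm_ring_1"
  assumes "a dvd 1" "b dvd 1"
  shows "sq_to_GW (group_ring_mult sq_classes (pf a) (pf b))
    = coord_class E2 Z1Y 0 (symb E2 [] (Y_bd (flag (a * b) - flag a - flag b + flag 1)))"
proof -
  interpret h: bar_hom E2 "Y 2 :: ('a ychain, 'a^2^2) gmodule" Z1Y Y_bd by (rule bar_hom_Y_bd_Z1Y)
  have "flag (a * b) - flag a - flag b + flag 1 \<in> carrier (Y 2)"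
    using assms by (intro h.N.add_closed h.N.diff_closed flag_Y2 units_mult) simp_all
  then show ?thesis
    unfolding sq_to_GW_def sq_to_Y2_eq[OF assms]
    by (simp add: h.homology_map_eq h.N.symb_closed coord_map_symb)
qed


section \<open>The cycle and its image\<close>

lemma mR_closed:
  fixes z :: "'a::comm_ring_1"
  assumes "z dvd 1" "(2::'a) dvd 1"
  shows "mR z \<in> carrier (bar_res E2 2)"
proof -
  interpret bar_module E2 "trivial_int :: (int, 'a^2^2) gmodule" by (rule bar_module_trivial[OF group_E2])
  have bar2: "bar2 A B \<in> carrier (bar_res E2 2)" if "A \<in> carrier E2" "B \<in> carrier E2" for A B :: "'a^2^2"
    using that by (intro bar_symbol_closed) auto
  have diff: "c - d \<in> carrier (bar_res E2 2)" if "c \<in> carrier (bar_res E2 2)" "d \<in> carrier (bar_res E2 2)" for c d :: "('a^2^2) bar"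
    using that by (auto simp: carrier_bar_res dest!: subsetD[OF keys_diff])
  have "mD z \<in> carrier E2" "mD (2::'a) \<in> carrier E2" "mh x \<in> carrier E2" for x :: 'a
    using assms by (simp_all add: mD_def mh_def upper_triangular_E2 uinv_right)
  then show ?thesis
    unfolding mR_def
    by (intro carrier_bar_res_add diff carrier_bar_res_cmul bar2 E2_mult_closed inv_closed int_pow_closed mw_E2 mg_E2)
qed

definition H2_cycle :: "'a::comm_ring_1 \<Rightarrow> 'a \<Rightarrow> ('a^2^2) bar" where
  "H2_cycle a b = bar2 (mD a) (mD b) + mR (a * b) - mR a - mR b + mR 1"

lemma H2_cycle_closed:
  fixes a b :: "'a::comm_ring_1"
  assumes "(2::'a) dvd 1" "a dvd 1" "b dvd 1"
  shows "H2_cycle a b \<in> carrier (bar_res E2 2)"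
proof -
  interpret bar_module E2 "trivial_int :: (int, 'a^2^2) gmodule" by (rule bar_module_trivial[OF group_E2])
  have diff: "c - d \<in> carrier (bar_res E2 2)" if "c \<in> carrier (bar_res E2 2)" "d \<in> carrier (bar_res E2 2)" for c d :: "('a^2^2) bar"
    using that by (auto simp: carrier_bar_res dest!: subsetD[OF keys_diff])
  have "bar2 (mD a) (mD b) \<in> carrier (bar_res E2 2)"
    using assms by (intro bar_symbol_closed) (auto simp: mD_def upper_triangular_E2 uinv_right)
  then show ?thesis
    unfolding H2_cycle_def
    using assms by (intro carrier_bar_res_add diff mR_closed units_mult) simp_all
qed

text \<open>Vanishes on constants and on homomorphisms from units to the additive group, so it
  isolates the part of \<open>f\<close> that is neither.\<close>

definition cross_effect :: "('a::comm_ring_1 \<Rightarrow> 'b::ab_group_add) \<Rightarrow> 'a \<Rightarrow> 'a \<Rightarrow> 'b" where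
  "cross_effect f a b = f (a * b) - f a - f b + f 1"

text \<open>The term [w^-1] is independent of \<open>z\<close> and drops out. As D(a) D(b) = D(ab),
  the boundary of [D(a)|D(b)] cancels the terms [D(ab)], [D(a)] and [D(b)]; the remaining [D(1)] is
  zero by normalization.\<close>

lemma coord_bd_H2_cycle:
  fixes a b :: "'a::comm_ring_1"
  assumes N: "bar_module E2 N" and units: "(2::'a) dvd 1" "a dvd 1" "b dvd 1"
    and fixed: "\<And>p q s. p * s = 1 \<Longrightarrow> act N (mat2 p q 0 s) m = m"
  shows "coord_bd E2 N (coords_elt E2 N (H2_cycle a b) m) =
    cross_effect (\<lambda>z. symb E2 [inv\<^bsub>E2\<^esub> (mg z)] (act N (inv\<^bsub>E2\<^esub> mw) m - m) - symb E2 [inv\<^bsub>E2\<^esub> (mh z)] (act N (inv\<^bsub>E2\<^esub> mw) m - m)) a b"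
proof -
  interpret bar_module E2 N by fact
  have ab: "a * b * (uinv a * uinv b) = 1"
    using uinv_right[OF units(2)] uinv_right[OF units(3)] by (metis mult.assoc mult.left_commute mult_1_right)
  have D: "mD a ** mD b = mD (a * b)" "mD (1::'a) = mat 1"
    using uinv_eqI[OF ab] uinv_eqI[of "1::'a" 1] by (simp_all add: mD_def mat2_mult mat_1_mat2)
  have DE: "mD a \<in> carrier E2" "mD b \<in> carrier E2"
    using units by (simp_all add: mD_def upper_triangular_E2 uinv_right)
  have "act N (inv\<^bsub>E2\<^esub> (mD a)) m = m"
    using units(2) by (simp add: mD_def inv_upper_triangular uinv_right uinv_left fixed)
  then have "coord_bd E2 N (symb E2 [mD a, mD b] m) = symb E2 [mD b] m - symb E2 [mD (a * b)] m + symb E2 [mD a] m"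
    using coord_bd_symb2[OF DE] D by simp
  moreover have "coord_bd E2 N (coords_elt E2 N (mR z) m) =
    symb E2 [inv\<^bsub>E2\<^esub> mw] m + symb E2 [mD z] m
    + symb E2 [inv\<^bsub>E2\<^esub> (mg z)] (act N (inv\<^bsub>E2\<^esub> mw) m - m) - symb E2 [inv\<^bsub>E2\<^esub> (mh z)] (act N (inv\<^bsub>E2\<^esub> mw) m - m)"
    if "z dvd 1" for z
    by (rule coord_bd_mR[OF N that units(1) fixed])
  moreover have "symb E2 [mD (1::'a)] m = 0"
    by (rule symb_one) (simp add: D)
  ultimately show ?thesis
    using units units_mult[OF units(2,3)]
    by (simp add: H2_cycle_def cross_effect_def coords_elt_add_left coords_elt_diff_left coords_bar_symbol
        coord_bd_add coord_bd_diff)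
qed

text \<open>Since \<open>h_z e2\<close> is \<open>z^-1\<close> times \<open>g_z e2\<close>, both
  matrices send 0 to the same line, and the two moved edges close up to a triangle with
  (\<infinity>, 0).\<close>

lemma mg_mh_lines:
  fixes z :: "'a::comm_ring_1"
  assumes "z dvd 1"
  shows "Y_act (mg z) (frag_of [line_infty, line_zero]) - Y_act (mh z) (frag_of [line_infty, line_zero])
     = Y_bd (flag z) - frag_of [line_infty, line_zero]"
proof -
  have "line (vector [0, - 1] :: 'a^2) = line_zero"
    unfolding line_zero_def by (rule line_eqI[of "- 1"]) (simp_all add: vec_eq_iff forall_2)
  moreover have "line (vector [uinv z, 1] :: 'a^2) = line_unit z"
    unfolding line_unit_def
    by (rule line_eqI[of "uinv z"]) (use assms in \<open>simp_all add: uinv_dvd uinv_left vec_eq_iff forall_2\<close>)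
  ultimately have "Y_act (mg z) (frag_of [line_infty, line_zero]) = frag_of [line_zero, line_unit z]"
    "Y_act (mh z) (frag_of [line_infty, line_zero]) = frag_of [line_infty, line_unit z]"
    by (simp_all add: line_infty_def line_zero_def line_unit_def image_line mg_def mh_def mat2_vector)
  then show ?thesis by (simp add: flag_def Y_bd_3)
qed

lemma infty_fixed:
  fixes p :: "'a::comm_ring_1"
  assumes "p * s = 1" shows "Y_act (mat2 p q 0 s) (frag_of [line_infty]) = frag_of [line_infty]"
proof -
  have "line (vector [p, 0] :: 'a^2) = line_infty"
    unfolding line_infty_def
    by (rule line_eqI[of p]) (use assms in \<open>simp_all add: vec_eq_iff forall_2, metis dvdI\<close>)
  then show ?thesis by (simp add: image_line mat2_vector line_infty_def)
qed

text \<open>\<open>c\<close> is a zig-zag witness whose image over \<open>Y 0\<close> bounds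
  \<open>X\<close>. The unit of the quotient \<open>Esecond_01\<close> is the whole image of the
  first differential, so both inclusions matter: any other witness differs from \<open>c\<close> by
  a cycle of \<open>Y 1\<close> up to a chain of \<open>Z1Y\<close>, and every cycle of
  \<open>Y 1\<close> may be added to \<open>c\<close>.\<close>

lemma dsecond_20_coord_class:
  fixes X :: "('a::comm_ring_1^2^2) list \<Rightarrow>\<^sub>0 'a ychain"
  assumes X: "X \<in> fchains E2 (Y 0) 2" and c: "c \<in> fchains E2 (Y 1) 1" "coord_map Y_bd c = coord_bd E2 (Y 0) X"
    and z: "coord_bd E2 (Y 1) c \<in> fchains E2 Z1Y 0"
  shows "dsecond_20 (coord_class E2 Z1Y 0 (coord_bd E2 (Y 1) c)) = \<one>\<^bsub>Esecond_01\<^esub>"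
proof -
  interpret d: bar_hom E2 "Y 1 :: ('a ychain, 'a^2^2) gmodule" "Y 0" Y_bd by (rule bar_hom_Y_bd_1)
  interpret i: bar_hom E2 "Z1Y :: ('a ychain, 'a^2^2) gmodule" "Y 1" "\<lambda>x. x"
    by (rule bar_hom_inclusion[OF bar_module_Z1Y bar_module_Y]) (auto simp: carrier_Z1Y)
  let ?z = "coord_bd E2 (Y 1) c"
  have num: "Suc 0 = 1" "Suc 1 = 2" by simp_all
  note One_nat_def [simp del]
  have bd: "coord_bd E2 Z1Y = coord_bd E2 (Y 1 :: ('a ychain, 'a^2^2) gmodule)"
    by (rule coord_bd_cong) simp
  have one: "\<one>\<^bsub>Esecond_01\<^esub> = (\<lambda>v. coord_class E2 (Y 0) 1 (coord_map Y_bd v)) ` fcycles E2 (Y 1 :: ('a ychain, 'a^2^2) gmodule) 1"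
    unfolding Esecond_01_def one_FactGroup d.N.carrier_homology image_image
    by (intro image_cong refl d.homology_map_eq d.N.fcycles_fchains)
  show ?thesis
    unfolding one
  proof (intro equalityI subsetI)
    fix W :: "('a^2^2, 'a ychain) hchain set" assume "W \<in> dsecond_20 (coord_class E2 Z1Y 0 ?z)"
    then obtain w t f where w: "W = coord_class E2 (Y 0) 1 w" "w \<in> fcycles E2 (Y 0) 1"
      and t: "t \<in> fchains E2 Z1Y 1" and f: "f \<in> fchains E2 (Y 1) 1"
      and ft: "chain_bd E2 (Y 1) 0 (of_coords E2 (Y 1) 1 f) = coeff_map E2 (Y 1) 0 (\<lambda>x. x) (of_coords E2 Z1Y 0 (?z + coord_bd E2 Z1Y t))"
      and fw: "coeff_map E2 (Y 0) 1 Y_bd (of_coords E2 (Y 1) 1 f) \<in> coord_class E2 (Y 0) 1 w"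
      unfolding dsecond_20_def d.N'.carrier_homology d.N.carrier_chains coord_class_def[of _ Z1Y] num by blast
    have t1: "t \<in> fchains E2 (Y 1) 1"
      using i.coord_map_closed[OF t] by (simp add: coord_map_id)
    have "?z + coord_bd E2 Z1Y t \<in> fchains E2 Z1Y 0"
      using z t i.N.coord_bd_closed[of t 0, unfolded num] by (simp add: i.N.fchains_add)
    then have "of_coords E2 (Y 1) 0 (coord_bd E2 (Y 1) f) = of_coords E2 (Y 1) 0 (?z + coord_bd E2 Z1Y t)"
      using ft f d.N.chain_bd_eq[of f 0, unfolded num] by (simp add: i.coeff_map_eq coord_map_id)
    then have ft: "coord_bd E2 (Y 1) f = ?z + coord_bd E2 (Y 1) t"
      using d.N.of_coords_inj[OF d.N.coord_bd_closed[of f 0, unfolded num, OF f]] by (simp add: bd)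
    obtain s where s: "s \<in> fchains E2 (Y 0) 2" "coord_map Y_bd f = w + coord_bd E2 (Y 0) s"
      using fw d.N'.coord_class_mem[OF d.coord_map_closed[OF f], unfolded num] by (auto simp: d.coeff_map_eq[OF f])
    \<comment> \<open>\<open>t\<close> accounts for the choice of the representative in
      \<open>Z1Y\<close>; it is invisible after \<open>Y_bd\<close>, so subtracting it is
      free.\<close>
    let ?v = "f - c - t"
    have v: "?v \<in> fcycles E2 (Y 1) 1"
      using f c(1) t1 ft by (auto simp: fcycles_def d.N.fchains_diff d.N.coord_bd_diff)
    have "Y_bd (Poly_Mapping.lookup t gs) = 0" for gs
      using t unfolding fchains_def carrier_Z1Y by blast
    then have "coord_map Y_bd t = 0"
      by (intro poly_mapping_eqI) (simp only: lookup_coord_map d.hom_zero lookup_zero)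
    then have "coord_map Y_bd ?v = w + coord_bd E2 (Y 0) (s - X)"
      using s(2) c(2) by (simp add: d.coord_map_diff d.N'.coord_bd_diff)
    then have "W = coord_class E2 (Y 0) 1 (coord_map Y_bd ?v)"
      unfolding w(1) using d.N'.fchains_diff[OF s(1) X]
      by (intro d.N'.coord_class_eqI[symmetric, of "s - X" 1, unfolded num]) simp_all
    then show "W \<in> (\<lambda>v. coord_class E2 (Y 0) 1 (coord_map Y_bd v)) ` fcycles E2 (Y 1) 1"
      using v by blast
  next
    fix W :: "('a^2^2, 'a ychain) hchain set" assume "W \<in> (\<lambda>v. coord_class E2 (Y 0) 1 (coord_map Y_bd v)) ` fcycles E2 (Y 1) 1"
    then obtain v where v: "v \<in> fcycles E2 (Y 1) 1" and W: "W = coord_class E2 (Y 0) 1 (coord_map Y_bd v)" by blast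
    have cv: "c + v \<in> fchains E2 (Y 1) 1" using c(1) v by (simp add: d.N.fchains_add d.N.fcycles_fchains)
    have "W \<in> carrier (homology E2 (Y 0) 1)"
      unfolding W d.N'.carrier_homology using d.coord_map_cycle[OF v] by blast
    moreover have "of_coords E2 Z1Y 0 ?z \<in> coord_class E2 Z1Y 0 ?z"
      by (rule i.N.coord_class_self[OF z])
    moreover have "of_coords E2 (Y 1) 1 (c + v) \<in> carrier (chains E2 (Y 1) 1)"
      unfolding d.N.carrier_chains using cv by blast
    moreover have "chain_bd E2 (Y 1) 0 (of_coords E2 (Y 1) 1 (c + v)) = coeff_map E2 (Y 1) 0 (\<lambda>x. x) (of_coords E2 Z1Y 0 ?z)"
      using d.N.chain_bd_eq[of "c + v" 0, unfolded num] cv z v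
      by (simp add: i.coeff_map_eq coord_map_id d.N.coord_bd_add fcycles_def)
    moreover have "coeff_map E2 (Y 0) 1 Y_bd (of_coords E2 (Y 1) 1 (c + v)) \<in> W"
      unfolding W d.coeff_map_eq[OF cv] d.N'.coord_class_mem[OF d.coord_map_closed[OF cv], unfolded num]
      using X c(2) by (intro bexI[of _ X]) (simp_all add: d.coord_map_add)
    ultimately show "W \<in> dsecond_20 (coord_class E2 Z1Y 0 ?z)"
      unfolding dsecond_20_def by blast
  qed
qed

theorem proposition5p2:
  fixes a b :: "'a::comm_ring_1"
  assumes "(2::'a) dvd 1" and "a dvd 1" and "b dvd 1"
  defines "c \<equiv> tensor_elt E2 (bar_res E2 2) trivial_int
                 (bar2 (mD a) (mD b) + mR (a * b) - mR a - mR b + mR 1) 1"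
  shows "c \<in> cycles E2 trivial_int 2 \<and>
         H2_to_I2 (hclass E2 trivial_int 2 c) = sq_to_GW (group_ring_mult sq_classes (pf a) (pf b)) \<and>
         sq_to_GW (group_ring_mult sq_classes (pf a) (pf b)) \<in> I2"
proof -
  let ?T = "trivial_int :: (int, 'a^2^2) gmodule"
  let ?P = "frag_of [line_infty] :: 'a ychain"
  let ?Q = "frag_of [line_infty, line_zero] :: 'a ychain"
  interpret e: bar_hom E2 "Y 0 :: ('a ychain, 'a^2^2) gmodule" ?T Y_aug by (rule bar_hom_Y_aug)
  interpret d: bar_hom E2 "Y 1 :: ('a ychain, 'a^2^2) gmodule" "Y 0" Y_bd by (rule bar_hom_Y_bd_1)
  interpret i: bar_hom E2 "Z1Y :: ('a ychain, 'a^2^2) gmodule" "Y 1" "\<lambda>x. x"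
    by (rule bar_hom_inclusion[OF bar_module_Z1Y bar_module_Y]) (auto simp: carrier_Z1Y)
  have w: "Y_act (inv\<^bsub>E2\<^esub> mw) ?P - ?P = Y_bd ?Q"
    by (simp add: inv_mw Y_bd_2 line_infty_def line_zero_def image_line mat2_vector)
  have num: "Suc 0 = 1" "Suc 1 = 2" by simp_all
  note One_nat_def [simp del]
  note beta = H2_cycle_closed[OF assms(1-3)]
  have P: "?P \<in> carrier (Y 0)" by (simp add: carrier_Y infty_Y0)
  have Q: "?Q \<in> carrier (Y 1)" using infty_zero_Y1 by (simp add: carrier_Y)
  \<comment> \<open>\<open>X\<close> is the lift for \<delta>_1, as \<infinity> has augmentation 1.
    Its boundary is the image under \<open>Y_bd\<close> of \<open>c1\<close>, which is the lift for
    \<delta>_2.\<close>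
  define X where "X = coords_elt E2 (Y 0) (H2_cycle a b) ?P"
  define x where "x = coords_elt E2 ?T (H2_cycle a b) 1"
  define c1 where "c1 = cross_effect (\<lambda>z. symb E2 [inv\<^bsub>E2\<^esub> (mg z)] ?Q - symb E2 [inv\<^bsub>E2\<^esub> (mh z)] ?Q) a b"
  have X: "X \<in> fchains E2 (Y 0) 2" unfolding X_def by (rule e.N.coords_elt_closed[OF beta P])
  have T1: "1 \<in> carrier ?T" by (simp add: trivial_int_def)
  have x: "x \<in> fchains E2 ?T 2" unfolding x_def by (rule e.N'.coords_elt_closed[OF beta T1])
  have Xx: "coord_map Y_aug X = x"
    unfolding X_def x_def using e.coords_elt_hom[OF beta P] by simp
  have c: "c = of_coords E2 ?T 2 x"
    unfolding c_def x_def H2_cycle_def[symmetric] by (rule e.N'.tensor_elt_eq[OF beta T1])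
  have actT: "act ?T A k = k" for A k by (simp add: trivial_int_def)
  have "coord_bd E2 ?T x = 0"
    unfolding x_def using coord_bd_H2_cycle[OF e.N'.bar_module_axioms assms(1-3), of 1]
    by (simp add: actT cross_effect_def Modules.additive.zero[OF additive_symb])
  then have cyc: "x \<in> fcycles E2 ?T 2" using x by (simp add: fcycles_def)
  have "coord_bd E2 (Y 0) X = cross_effect (\<lambda>z. symb E2 [inv\<^bsub>E2\<^esub> (mg z)] (Y_bd ?Q) - symb E2 [inv\<^bsub>E2\<^esub> (mh z)] (Y_bd ?Q)) a b"
    unfolding X_def
    by (subst coord_bd_H2_cycle[OF e.N.bar_module_axioms assms(1-3)]) (simp_all only: act_Y infty_fixed w)
  also have "\<dots> = coord_map Y_bd c1"
    unfolding c1_def cross_effect_def d.coord_map_add d.coord_map_diff coord_map_symb[of Y_bd, OF d.hom_zero] ..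
  finally have bdX: "coord_bd E2 (Y 0) X = coord_map Y_bd c1" .
  have gh: "inv\<^bsub>E2\<^esub> (mg z) \<in> carrier E2" "inv\<^bsub>E2\<^esub> (mh z) \<in> carrier E2" "mh z \<in> carrier E2" for z :: 'a
    by (simp_all add: mg_E2 mh_def upper_E2)
  then have "symb E2 [inv\<^bsub>E2\<^esub> (mg z)] ?Q \<in> fchains E2 (Y 1) 1" "symb E2 [inv\<^bsub>E2\<^esub> (mh z)] ?Q \<in> fchains E2 (Y 1) 1" for z :: 'a
    using Q by (intro d.N.symb_closed; simp add: One_nat_def)+
  then have c1: "c1 \<in> fchains E2 (Y 1) 1"
    unfolding c1_def cross_effect_def by (intro d.N.fchains_diff d.N.fchains_add)
  have bds: "coord_bd E2 (Y 1) (symb E2 [inv\<^bsub>E2\<^esub> (mg z)] ?Q - symb E2 [inv\<^bsub>E2\<^esub> (mh z)] ?Q)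
      = symb E2 [] (Y_bd (flag z) - ?Q)" if "z dvd 1" for z :: 'a
    unfolding mg_mh_lines[OF that, symmetric]
    using gh[of z] mg_E2[of z] by (simp add: d.N.coord_bd_diff d.N.coord_bd_symb1 symb_diff)
  \<comment> \<open>The instances of \<open>coord_bd_diff\<close> split only the outer differences;
    the pairs [g_z^-1] - [h_z^-1] stay together, as \<open>bds\<close> requires.\<close>
  have bdc1: "coord_bd E2 (Y 1) c1 = symb E2 [] (Y_bd (flag (a * b) - flag a - flag b + flag 1))"
    unfolding c1_def cross_effect_def d.N.coord_bd_add
    using assms(2,3) units_mult[OF assms(2,3)]
    by (simp add: d.N.coord_bd_diff[of "_ - _ - _"] d.N.coord_bd_diff[of "symb E2 _ _ - symb E2 _ _" "symb E2 _ _ - symb E2 _ _"] bds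
        symb_diff Modules.additive.diff[OF additive_Y_bd] Modules.additive.add[OF additive_Y_bd] Modules.additive.add[OF additive_symb])
  note con = connecting_connecting[OF bar_hom_Y_bd_Z0Y bar_hom_Y_aug bar_module_Z1Y carrier_Z1Y carrier_Z0Y _ _
      Y_exact_0 Y_aug_surj X c1 bdX[symmetric], simplified]
  have GW: "sq_to_GW (group_ring_mult sq_classes (pf a) (pf b)) = coord_class E2 Z1Y 0 (coord_bd E2 (Y 1) c1)"
    unfolding sq_to_GW_eq[OF assms(2,3)] bdc1 ..
  have H2: "H2_to_I2 (hclass E2 ?T 2 c) = coord_class E2 Z1Y 0 (coord_bd E2 (Y 1) c1)"
    using con(2) unfolding H2_to_I2_def delta1_def delta2_def c e.N'.hclass_eq[OF x] Xx by simp
  have z: "coord_bd E2 (Y 1) c1 \<in> fcycles E2 Z1Y 0"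
    using con(1) by (simp add: fcycles_def)
  \<comment> \<open>The boundary of \<open>c1\<close> bounds over \<open>Y 1\<close> by
    construction; over \<open>Z1Y\<close> it may survive, since the coefficients of
    \<open>c1\<close> need not lie there.\<close>
  have "coord_class E2 (Y 1) 0 (coord_bd E2 (Y 1) c1) = coord_class E2 (Y 1) 0 0"
    using c1 by (intro d.N.coord_class_eqI[of c1 0, unfolded num]) simp_all
  then have "coord_class E2 Z1Y 0 (coord_bd E2 (Y 1) c1) \<in> I1"
    using z con(1) unfolding I1_def kernel_def GW_def
    by (simp add: i.N.carrier_homology i.homology_map_eq coord_map_id d.N.one_homology)
  then have "coord_class E2 Z1Y 0 (coord_bd E2 (Y 1) c1) \<in> I2"
    using dsecond_20_coord_class[OF X c1 bdX[symmetric] con(1)] by (simp add: I2_def kernel_def)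
  then show ?thesis
    using cyc unfolding GW H2 by (simp add: c e.N'.cycles_eq)
qed

end
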